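(* Let $G$ be a finite group, $p$ a prime number, and consider the poset $\mathcal{S}_G^{p+*}$ of nonidentity $p$-subgroups of $G$ as a $G$-poset with the conjugation action. (1) For $r\ge 1$, $$\widetilde{\chi}_r(\mathcal{S}_G^{p+*},G)=\frac1{|G|}\sum_{A}\widetilde{\chi}(C_{\mathcal{S}_G^{p+*}}(A))\,\varphi_r(A)=\sum_{[A]}\widetilde{\chi}(C_{\mathcal{S}_G^{p+*}}(A))\frac{\varphi_r(A)}{|N_G(A)|},$$ where the first sum runs over the abelian subgroups $A$ of $G$ of order prime to $p$ and the second over the $G$-conjugacy classes $[A]$ of such subgroups. (2) For $r\ge2$, the reduced equivariant Euler class function $\widetilde{\alpha}_r(\mathcal{S}_G^{p+*},G)$ vanishes at every $x\in G$ whose order is divisible by $p$. (3) For $r\ge2$, there are uniquely determined rational coefficients $\widetilde{a}_r(\mathcal{S}_G^{p+*},G)([C])$ such that $$\widetilde{\alpha}_r(\mathcal{S}_G^{p+*},G)=\sum_{[C]}\frac{\widetilde{a}_r(\mathcal{S}_G^{p+*},G)([C])}{|N_G(C):C|}\,1_C^G,$$ where the sum runs over the conjugacy classes $[C]$ of cyclic subgroups $C$ of $G$ of order prime to $p$, and these coefficients (the Artin coefficients) are integers. (4) For $r=2$ and any prime divisor $p$ of $|G|$, $$\sum_{[C]}\widetilde{a}_2(\mathcal{S}_G^{p+*},G)([C])\frac1{|N_G(C)|}=0,$$ where the sum runs over the conjugacy classes $[C]$ of cyclic subgroups of $G$ of order prime to $p$.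
   Context: For a subset, tuple or subgroup $X$ of $G$, $C_{\mathcal{S}_G^{p+*}}(X)$ is the poset of nonidentity $p$-subgroups of $G$ that are normalized by (every element of) $X$. For a finite poset $\mathcal{S}$, $\widetilde{\chi}(\mathcal{S})=\chi(\mathcal{S})-1$ with $\chi$ the Euler characteristic of the order complex ($\chi(\emptyset)=0$). For a finite group $B$ and $r\ge 0$, $C_r(B)$ is the set of $r$-tuples of pairwise commuting elements of $B$ (with $C_0(B)=\{e\}$), and $\varphi_r(B)$ is the number of tuples $(x_1,\dots,x_r)\in C_r(B)$ generating $B$. For a finite poset $\mathcal{S}$ with an action of a finite group $B$ and $r\ge0$, $\widetilde{\chi}_r(\mathcal{S},B)=\frac{1}{|B|}\sum_{x\in C_r(B)}\widetilde{\chi}(C_{\mathcal{S}}(x))$, where $C_{\mathcal{S}}(x)$ is the subposet of elements fixed by all entries of $x$. For $r\ge1$, $\widetilde{\alpha}_r(\mathcal{S},B)$ is the class function on $B$ with value $\widetilde{\chi}_{r-1}(C_{\mathcal{S}}(x),C_B(x))$ at $x\in B$. $1_C^G$ is the character of $G$ induced from the trivial character of $C$. *)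

theory Defs
  imports Complex_Main "HOL-Algebra.Group_Action" "HOL-Algebra.Elementary_Groups" "HOL-Algebra.Multiplicative_Group"
    "HOL-Computational_Algebra.Primes"
begin

section \<open>Euler characteristics of finite posets\<close>

text \<open>A finite poset is a finite subset of an ordered type, with the induced order. The order complex
  has the nonempty finite chains as simplices; a chain \<open>c\<close> is a simplex of dimension
  \<open>card c - 1\<close>.\<close>

definition order_complex :: "'b::order set \<Rightarrow> 'b set set" where
  "order_complex S = {c. c \<subseteq> S \<and> finite c \<and> c \<noteq> {} \<and> Complete_Partial_Order.chain (\<le>) c}"

definition euler_char :: "'b::order set \<Rightarrow> int" where
  "euler_char S = (\<Sum>c\<in>order_complex S. (-1) ^ (card c - 1))"

definition reduced_euler_char :: "'b::order set \<Rightarrow> int" where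
  "reduced_euler_char S = euler_char S - 1"


section \<open>Commuting tuples\<close>

text \<open>The only tuple of length 0 is \<open>[]\<close>, which plays the role of the element \<open>e\<close> of
  \<open>C\<^sub>0(B) = {e}\<close>: it fixes everything and generates the trivial subgroup.\<close>

definition commuting_tuples :: "nat \<Rightarrow> ('a, 'm) monoid_scheme \<Rightarrow> 'a list set" where
  "commuting_tuples r B =
     {xs. length xs = r \<and> set xs \<subseteq> carrier B \<and>
          (\<forall>x\<in>set xs. \<forall>y\<in>set xs. x \<otimes>\<^bsub>B\<^esub> y = y \<otimes>\<^bsub>B\<^esub> x)}"

definition num_generating_tuples :: "nat \<Rightarrow> ('a, 'm) monoid_scheme \<Rightarrow> nat" where
  "num_generating_tuples r B =
     card {xs \<in> commuting_tuples r B. generate B (set xs) = carrier B}"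


section \<open>Equivariant reduced Euler characteristics and class functions\<close>

definition fixed_points :: "'b set \<Rightarrow> ('a \<Rightarrow> 'b \<Rightarrow> 'b) \<Rightarrow> 'a set \<Rightarrow> 'b set" where
  "fixed_points S \<phi> T = {s \<in> S. \<forall>g\<in>T. \<phi> g s = s}"

definition equiv_reduced_euler_char ::
    "nat \<Rightarrow> 'b::order set \<Rightarrow> ('a \<Rightarrow> 'b \<Rightarrow> 'b) \<Rightarrow> ('a, 'm) monoid_scheme \<Rightarrow> rat" where
  "equiv_reduced_euler_char r S \<phi> B =
     1 / of_nat (order B) *
       (\<Sum>xs\<in>commuting_tuples r B. of_int (reduced_euler_char (fixed_points S \<phi> (set xs))))"

definition centralizer :: "('a, 'm) monoid_scheme \<Rightarrow> 'a \<Rightarrow> 'a set" where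
  "centralizer B x = {g \<in> carrier B. g \<otimes>\<^bsub>B\<^esub> x = x \<otimes>\<^bsub>B\<^esub> g}"

text \<open>Only meaningful for \<open>r \<ge> 1\<close> and at elements \<open>x\<close> of \<open>B\<close>.\<close>

definition equiv_reduced_euler_class ::
    "nat \<Rightarrow> 'b::order set \<Rightarrow> ('a \<Rightarrow> 'b \<Rightarrow> 'b) \<Rightarrow> ('a, 'm) monoid_scheme \<Rightarrow> 'a \<Rightarrow> complex" where
  "equiv_reduced_euler_class r S \<phi> B x =
     of_rat (equiv_reduced_euler_char (r - 1) (fixed_points S \<phi> {x}) \<phi>
               (B\<lparr>carrier := centralizer B x\<rparr>))"


section \<open>Subgroups and conjugation\<close>

text \<open>The same conjugation action that the library uses to define \<^const>\<open>normalizer\<close>; the fixed points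
  of a set \<open>T\<close> are the subsets normalized by every element of \<open>X\<close>.\<close>

definition conj_action :: "('a, 'm) monoid_scheme \<Rightarrow> 'a \<Rightarrow> 'a set \<Rightarrow> 'a set" where
  "conj_action G = (\<lambda>g. \<lambda>H\<in>{H. H \<subseteq> carrier G}. g <#\<^bsub>G\<^esub> H #>\<^bsub>G\<^esub> (inv\<^bsub>G\<^esub> g))"

definition conj_classes :: "('a, 'm) monoid_scheme \<Rightarrow> 'a set set \<Rightarrow> 'a set set set" where
  "conj_classes G \<H> = orbits G \<H> (conj_action G)"

definition nontrivial_p_subgroups :: "('a, 'm) monoid_scheme \<Rightarrow> nat \<Rightarrow> 'a set set" where
  "nontrivial_p_subgroups G p =
     {P. subgroup P G \<and> (\<exists>n. card P = p ^ n) \<and> P \<noteq> {\<one>\<^bsub>G\<^esub>}}"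

definition abelian_p'_subgroups :: "('a, 'm) monoid_scheme \<Rightarrow> nat \<Rightarrow> 'a set set" where
  "abelian_p'_subgroups G p =
     {A. subgroup A G \<and> comm_group (G\<lparr>carrier := A\<rparr>) \<and> coprime (card A) p}"

definition cyclic_p'_subgroups :: "('a, 'm) monoid_scheme \<Rightarrow> nat \<Rightarrow> 'a set set" where
  "cyclic_p'_subgroups G p =
     {C. subgroup C G \<and> cyclic_group (G\<lparr>carrier := C\<rparr>) \<and> coprime (card C) p}"


section \<open>Induced characters and Artin expansions\<close>

definition induced_character ::
    "('a, 'm) monoid_scheme \<Rightarrow> 'a set \<Rightarrow> ('a \<Rightarrow> complex) \<Rightarrow> 'a \<Rightarrow> complex" where
  "induced_character G H \<psi> g =
     1 / of_nat (card H) *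
       (\<Sum>x\<in>{x \<in> carrier G. inv\<^bsub>G\<^esub> x \<otimes>\<^bsub>G\<^esub> g \<otimes>\<^bsub>G\<^esub> x \<in> H}. \<psi> (inv\<^bsub>G\<^esub> x \<otimes>\<^bsub>G\<^esub> g \<otimes>\<^bsub>G\<^esub> x))"

text \<open>\<open>a\<close> assigns a rational coefficient to each conjugacy class in \<open>\<K>\<close>, and \<open>rep K\<close> is a member of the
  class \<open>K\<close>. The quotient \<open>N\<^sub>G(C) : C\<close> is the number of cosets of \<open>C\<close> in its normalizer.\<close>

definition artin_expansion ::
    "('a, 'm) monoid_scheme \<Rightarrow> 'a set set set \<Rightarrow> ('a set set \<Rightarrow> 'a set) \<Rightarrow>
     ('a \<Rightarrow> complex) \<Rightarrow> ('a set set \<Rightarrow> rat) \<Rightarrow> bool" where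
  "artin_expansion G \<K> rep \<alpha> a \<longleftrightarrow>
     (\<forall>x\<in>carrier G. \<alpha> x =
        (\<Sum>K\<in>\<K>. of_rat (a K) / of_nat (card (rcosets\<^bsub>G\<lparr>carrier := normalizer G (rep K)\<rparr>\<^esub> (rep K)))
                 * induced_character G (rep K) (\<lambda>_. 1) x))"

end

theory Submission
  imports Defs "HOL-Algebra.Sylow"
begin

text \<open>
  Write \<open>\<S>\<close> for the poset of nontrivial \<open>p\<close>-subgroups of \<open>G\<close> and \<open>C(X)\<close> for the subposet normalized by \<open>X\<close>.
  Everything rests on three facts about \<open>\<S>\<close>.

  \<^item> If \<open>X\<close> generates an abelian group \<open>A\<close> of order divisible by \<open>p\<close>, then \<open>C(X)\<close> is conically contractible:
    for a nontrivial \<open>p\<close>-subgroup \<open>Z\<close> of \<open>A\<close> we have \<open>P \<le> ZP \<ge> Z\<close> in \<open>C(X)\<close>. Hence its reduced Euler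
    characteristic vanishes (\<open>reduced_euler_char_fixed_p_singular\<close>).

  \<^item> For \<open>s \<ge> 1\<close> the sum over commuting \<open>s\<close>-tuples of elements of the centralizer \<open>H\<close> of \<open>x\<close> that defines
    the class function at \<open>x\<close> is divisible by the order of \<open>H\<close>, because it is that order times a signed
    number of orbits of \<open>H\<close> (\<open>order_dvd_sum_fixed_chain_sums\<close>).

  \<^item> If \<open>p\<close> divides the order of \<open>G\<close>, the reduced Euler characteristic of the orbit space of the order
    complex is 0 (\<open>normalizer_chain_sum_nontrivial_p_subgroups\<close>). To prove this, count orbits of chains
    with signs and sort them by their least member \<open>Q\<close>. The chains above \<open>Q\<close> may be replaced by chains of
    subgroups normalizing \<open>Q\<close>, since \<open>R \<mapsto> N\<^sub>R(Q)\<close> is an interior operator; by induction the orbits of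
    \<open>N(Q)\<close> on them cancel unless \<open>Q\<close> is a Sylow subgroup. So the sum is 1, from the empty chain, minus 1,
    from the single class of Sylow subgroups.

  The first two assertions of the theorem follow from the first fact. In the sum that defines the equivariant
  Euler characteristic, tuples are grouped by the abelian subgroup they generate and those of order
  divisible by \<open>p\<close> drop out; conjugacy classes are then counted with the orbit-stabilizer theorem.
  The value of the class function at \<open>x\<close> is a sum over tuples which together with \<open>x\<close> generate an abelian
  group whose order is divisible by that of \<open>x\<close>.

  For the Artin coefficients, evaluating induced characters shows that an expansion of a class function
  \<open>\<alpha>\<close> says precisely \<open>\<alpha>(x) = \<Sum> a([C])\<close>, the sum being over all cyclic subgroups \<open>C\<close> of order prime to \<open>p\<close> that
  contain \<open>x\<close> (\<open>artin_expansion_iff\<close>). Since \<open>\<alpha>(x)\<close> depends only on the group generated by \<open>x\<close> and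
  vanishes if that group has order divisible by \<open>p\<close>, this is a triangular system with unit diagonal
  over the poset of these subgroups: it has a unique solution, which is integral because \<open>\<alpha>\<close> is. For \<open>r = 2\<close>
  the equation at \<open>x = 1\<close> runs over all these subgroups, and its left-hand side is the reduced Euler
  characteristic of the orbit space, which is 0; grouping by classes gives the last assertion.
\<close>

section \<open>Signed counts of chains\<close>

definition chains :: "('b \<Rightarrow> 'b \<Rightarrow> bool) \<Rightarrow> 'b set \<Rightarrow> 'b set set" where
  "chains R S = {c. c \<subseteq> S \<and> Complete_Partial_Order.chain R c}"

text \<open>Including the empty chain turns the reduced Euler characteristic into an alternating sum with no
  correction term, up to sign; this is the form in which every cancellation below takes place.\<close>

definition chain_sum :: "'b::order set \<Rightarrow> int" where
  "chain_sum S = (\<Sum>c\<in>chains (\<le>) S. (-1) ^ card c)"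

lemma finite_chains: "finite S \<Longrightarrow> finite (chains R S)"
  by (rule finite_subset[of _ "Pow S"]) (auto simp: chains_def)

lemma chains_finite: "finite S \<Longrightarrow> c \<in> chains R S \<Longrightarrow> finite c"
  by (auto simp: chains_def intro: finite_subset)

lemma chains_ge: "chains (\<ge>) S = chains ((\<le>) :: 'b::order \<Rightarrow> _) S"
  by (auto simp: chains_def Complete_Partial_Order.chain_def)

lemma reduced_euler_char_eq:
  assumes "finite S"
  shows "reduced_euler_char S = - chain_sum S"
proof -
  have ch: "chains (\<le>) S = insert {} (order_complex S)" "{} \<notin> order_complex S"
    using assms by (auto simp: chains_def order_complex_def Complete_Partial_Order.chain_def intro: finite_subset)
  have fin: "finite (order_complex S)"
    using finite_chains[OF assms, of "(\<le>)"] ch by simp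
  have "euler_char S = (\<Sum>c\<in>order_complex S. - ((-1) ^ card c))"
    unfolding euler_char_def
  proof (rule sum.cong)
    fix c assume "c \<in> order_complex S"
    then have "card c > 0" by (auto simp: order_complex_def card_gt_0_iff)
    then obtain n where "card c = Suc n" by (cases "card c") auto
    then show "(-1) ^ (card c - 1) = - ((-1) ^ card c :: int)" by simp
  qed simp
  then show ?thesis
    unfolding reduced_euler_char_def chain_sum_def ch(1) using ch(2) fin by (simp add: sum_negf)
qed

text \<open>Adding or removing the element \<open>t c\<close> is a sign-reversing involution, provided the choice of
  \<open>t c\<close> does not depend on whether it is already present.\<close>

lemma alternating_sum_toggle:
  fixes C :: "'b set set"
  assumes "\<And>c. c \<in> C \<Longrightarrow> finite c"
    and "\<And>c. c \<in> C \<Longrightarrow> insert (t c) c \<in> C" "\<And>c. c \<in> C \<Longrightarrow> c - {t c} \<in> C"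
    and "\<And>c. c \<in> C \<Longrightarrow> t (insert (t c) c) = t c" "\<And>c. c \<in> C \<Longrightarrow> t (c - {t c}) = t c"
  shows "(\<Sum>c\<in>C. (-1) ^ card c) = (0::int)"
proof -
  define s where "s c = (if t c \<in> c then c - {t c} else insert (t c) c)" for c
  have s: "s c \<in> C" "s (s c) = c" if "c \<in> C" for c
    using assms(2-5)[OF that] by (auto simp: s_def)
  have "(\<Sum>c\<in>C. (-1) ^ card c) = (\<Sum>c\<in>C. - ((-1) ^ card c) :: int)"
  proof (rule sum.reindex_bij_witness[of _ s s])
    fix c assume c: "c \<in> C"
    show "- ((-1) ^ card (s c)) = ((-1) ^ card c :: int)"
    proof (cases "t c \<in> c")
      case True
      have "card c = Suc (card (s c))"
        using card.remove[OF assms(1)[OF c] True] True by (simp add: s_def)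
      then show ?thesis by simp
    next
      case False
      then show ?thesis using assms(1)[OF c] by (simp add: s_def)
    qed
  qed (use s in auto)
  then show ?thesis by (simp add: sum_negf)
qed

lemma finite_chain_has_greatest:
  assumes "finite c" "c \<noteq> {}" "Complete_Partial_Order.chain R c"
    and trans: "\<And>x y z. R x y \<Longrightarrow> R y z \<Longrightarrow> R x z"
  shows "\<exists>m\<in>c. \<forall>y\<in>c. R y m"
  using assms(1-3)
proof (induction rule: finite_ne_induct)
  case (insert x F)
  then obtain m where m: "m \<in> F" "\<forall>y\<in>F. R y m"
    by (meson chain_subset subset_insertI)
  have "R x x" using insert.prems by (auto simp: Complete_Partial_Order.chain_def)
  moreover have "R x m \<or> R m x"
    using insert.prems m(1) by (auto simp: Complete_Partial_Order.chain_def)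
  ultimately show ?case
  proof (elim disjE)
    assume "R x m"
    then show ?case using m by auto
  next
    assume "R m x"
    then have "R y x" if "y \<in> F" for y using m trans that by blast
    then show ?case using \<open>R x x\<close> by auto
  qed
qed (auto simp: Complete_Partial_Order.chain_def)

text \<open>A closure operator is a homotopy equivalence onto its closed elements; here is the cancellation
  behind the equality of Euler characteristics. A chain with a non-closed element has a greatest
  one, \<open>m\<close>. Every closed element above \<open>m\<close> lies above \<open>f m\<close>, so \<open>f m\<close> can be toggled, and since \<open>f m\<close> is
  closed this does not affect \<open>m\<close>. The order is an arbitrary relation so that interior operators
  are covered by reversing it.\<close>

lemma alternating_sum_closure_operator:
  assumes fin: "finite S" and refl: "\<And>x. R x x"
    and trans: "\<And>x y z. R x y \<Longrightarrow> R y z \<Longrightarrow> R x z"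
    and f: "\<And>x. x \<in> S \<Longrightarrow> f x \<in> S" "\<And>x. x \<in> S \<Longrightarrow> R x (f x)" "\<And>x. x \<in> S \<Longrightarrow> f (f x) = f x"
    and mono: "\<And>x y. x \<in> S \<Longrightarrow> y \<in> S \<Longrightarrow> R x y \<Longrightarrow> R (f x) (f y)"
  shows "(\<Sum>c\<in>chains R S. (-1) ^ card c) = (\<Sum>c\<in>chains R {x\<in>S. f x = x}. (-1) ^ card c :: int)"
proof -
  define T where "T = {x\<in>S. f x = x}"
  define C where "C = chains R S - chains R T"
  \<comment> \<open>Applied to \<open>c - T\<close>, which toggling an element of \<open>T\<close> leaves unchanged.\<close>
  define m where "m d = (SOME x. x \<in> d \<and> (\<forall>y\<in>d. R y x))" for d
  have cS: "c \<subseteq> S" "Complete_Partial_Order.chain R c" "finite c" "c - T \<noteq> {}" if "c \<in> C" for c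
    using that fin by (auto simp: C_def chains_def intro: finite_subset)
  have m: "m (c - T) \<in> c - T" "\<And>y. y \<in> c - T \<Longrightarrow> R y (m (c - T))" if "c \<in> C" for c
  proof -
    have "\<exists>x\<in>c - T. \<forall>y\<in>c - T. R y x"
      by (rule finite_chain_has_greatest[OF _ cS(4)[OF that] chain_subset[OF cS(2)[OF that]]])
        (use cS(3)[OF that] trans in blast)+
    then have "\<exists>x. x \<in> c - T \<and> (\<forall>y\<in>c - T. R y x)" by blast
    from someI_ex[OF this]
    show "m (c - T) \<in> c - T" "\<And>y. y \<in> c - T \<Longrightarrow> R y (m (c - T))" by (auto simp: m_def)
  qed
  have fm: "f (m (c - T)) \<in> T" if "c \<in> C" for c
    using m(1)[OF that] cS(1)[OF that] f by (auto simp: T_def)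
  have "(\<Sum>c\<in>C. (-1) ^ card c) = (0::int)"
  proof (rule alternating_sum_toggle[of C "\<lambda>c. f (m (c - T))"])
    fix c assume c: "c \<in> C"
    have eq: "insert (f (m (c - T))) c - T = c - T" "c - {f (m (c - T))} - T = c - T"
      using fm[OF c] by auto
    show "f (m (insert (f (m (c - T))) c - T)) = f (m (c - T))"
      "f (m (c - {f (m (c - T))} - T)) = f (m (c - T))"
      by (simp_all only: eq)
    have mS: "m (c - T) \<in> S" using m(1)[OF c] cS(1)[OF c] by auto
    have "R y (f (m (c - T))) \<or> R (f (m (c - T))) y" if y: "y \<in> c" for y
    proof (cases "y \<in> T")
      case False
      then have "R y (m (c - T))" using m(2)[OF c] y by auto
      from trans[OF this f(2)[OF mS]] show ?thesis ..
    next
      case True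
      have "R y (m (c - T)) \<or> R (m (c - T)) y"
        using cS(2)[OF c] m(1)[OF c] y by (auto simp: Complete_Partial_Order.chain_def)
      then show ?thesis
      proof
        assume "R y (m (c - T))"
        from trans[OF this f(2)[OF mS]] show ?thesis ..
      next
        assume "R (m (c - T)) y"
        from mono[OF mS _ this] show ?thesis using True by (simp add: T_def)
      qed
    qed
    then have "Complete_Partial_Order.chain R (insert (f (m (c - T))) c)"
      using cS(2)[OF c] refl by (auto simp: Complete_Partial_Order.chain_def)
    then show "insert (f (m (c - T))) c \<in> C"
      using cS(1)[OF c] f(1)[OF mS] m(1)[OF c] by (auto simp: C_def chains_def)
    show "c - {f (m (c - T))} \<in> C"
      using cS(1,2)[OF c] m(1)[OF c] fm[OF c] by (auto simp: C_def chains_def Complete_Partial_Order.chain_def)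
  qed (use cS(3) in auto)
  moreover have "chains R T \<subseteq> chains R S" by (auto simp: chains_def T_def)
  ultimately show ?thesis
    using sum.subset_diff[of "chains R T" "chains R S" "\<lambda>c. (-1) ^ card c :: int"] finite_chains[OF fin, of R]
    by (simp add: C_def T_def)
qed

lemma chain_sum_closure_operator:
  fixes S :: "'b::order set"
  assumes "finite S" "\<And>x. x \<in> S \<Longrightarrow> f x \<in> S" "\<And>x. x \<in> S \<Longrightarrow> x \<le> f x" "\<And>x. x \<in> S \<Longrightarrow> f (f x) = f x"
    "\<And>x y. x \<in> S \<Longrightarrow> y \<in> S \<Longrightarrow> x \<le> y \<Longrightarrow> f x \<le> f y"
  shows "chain_sum S = chain_sum {x\<in>S. f x = x}"
  unfolding chain_sum_def by (rule alternating_sum_closure_operator) (use assms in auto)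

lemma chain_sum_interior_operator:
  fixes S :: "'b::order set"
  assumes "finite S" "\<And>x. x \<in> S \<Longrightarrow> f x \<in> S" "\<And>x. x \<in> S \<Longrightarrow> f x \<le> x" "\<And>x. x \<in> S \<Longrightarrow> f (f x) = f x"
    "\<And>x y. x \<in> S \<Longrightarrow> y \<in> S \<Longrightarrow> x \<le> y \<Longrightarrow> f x \<le> f y"
  shows "chain_sum S = chain_sum {x\<in>S. f x = x}"
  unfolding chain_sum_def chains_ge[symmetric]
  by (rule alternating_sum_closure_operator) (use assms in auto)

text \<open>A poset with a least element is a cone: that element can be toggled in every chain.\<close>

lemma chain_sum_least:
  fixes S :: "'b::order set"
  assumes "finite S" "q \<in> S" "\<And>x. x \<in> S \<Longrightarrow> q \<le> x"
  shows "chain_sum S = 0"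
  unfolding chain_sum_def
proof (rule alternating_sum_toggle[of _ "\<lambda>_. q"])
  show "insert q c \<in> chains (\<le>) S" if "c \<in> chains (\<le>) S" for c
    using that assms(2,3) by (auto simp: chains_def Complete_Partial_Order.chain_def)
qed (use chains_finite[OF assms(1)] in \<open>auto simp: chains_def Complete_Partial_Order.chain_def\<close>)

text \<open>Nonempty chains are sorted by their least element.\<close>

lemma chain_sum_by_minimum:
  fixes S :: "'b::order set"
  assumes fin: "finite S"
  shows "chain_sum S = 1 - (\<Sum>x\<in>S. chain_sum {y\<in>S. x < y})"
proof -
  let ?B = "SIGMA x:S. chains (\<le>) {y\<in>S. x < y}"
  have least: "\<exists>m\<in>c. \<forall>y\<in>c. m \<le> y" if "c \<in> chains (\<le>) S" "c \<noteq> {}" for c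
  proof (rule finite_chain_has_greatest[of c "(\<ge>)"])
    show "Complete_Partial_Order.chain (\<ge>) c"
      using that(1) by (auto simp: chains_def Complete_Partial_Order.chain_def)
    show "finite c" by (rule chains_finite[OF fin that(1)])
    show "c \<noteq> {}" by fact
    show "\<And>x y z. x \<ge> y \<Longrightarrow> y \<ge> z \<Longrightarrow> x \<ge> (z::'b)" by (rule order_trans)
  qed
  have img: "chains (\<le>) S - {{}} = (\<lambda>(x, c). insert x c) ` ?B"
  proof (intro equalityI subsetI)
    fix c assume c: "c \<in> chains (\<le>) S - {{}}"
    then obtain m where m: "m \<in> c" "\<And>y. y \<in> c \<Longrightarrow> m \<le> y" using least[of c] by blast
    have "c \<subseteq> S" "Complete_Partial_Order.chain (\<le>) (c - {m})"
      using c by (auto simp: chains_def intro: chain_subset)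
    moreover have "m < y" if "y \<in> c - {m}" for y
      using m(2)[of y] that by (simp add: less_le eq_commute[of m])
    ultimately have "(m, c - {m}) \<in> ?B"
      using m(1) by (auto simp: chains_def)
    moreover have "c = (\<lambda>(x, c). insert x c) (m, c - {m})" using m(1) by (simp add: insert_absorb)
    ultimately show "c \<in> (\<lambda>(x, c). insert x c) ` ?B" by (rule rev_image_eqI)
  next
    fix c assume "c \<in> (\<lambda>(x, c). insert x c) ` ?B"
    then obtain z where z: "z \<in> ?B" "c = (\<lambda>(x, c). insert x c) z" by blast
    obtain x d where "z = (x, d)" by (cases z)
    with z have d: "c = insert x d" "x \<in> S" "d \<subseteq> {y\<in>S. x < y}" "Complete_Partial_Order.chain (\<le>) d"
      by (simp_all add: chains_def)
    have "Complete_Partial_Order.chain (\<le>) c"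
      unfolding d(1)
    proof (rule chainI)
      fix u v assume uv: "u \<in> insert x d" "v \<in> insert x d"
      show "u \<le> v \<or> v \<le> u"
      proof (cases "u = x \<or> v = x")
        case True
        then show ?thesis using uv d(3) less_imp_le by blast
      qed (use uv chainD[OF d(4)] in blast)
    qed
    moreover have "c \<subseteq> S" unfolding d(1) using d(2,3) by blast
    ultimately show "c \<in> chains (\<le>) S - {{}}" using d(1) by (simp add: chains_def)
  qed
  have inj: "inj_on (\<lambda>(x, c). insert x c) ?B"
  proof (rule inj_onI)
    fix z z' assume z: "z \<in> ?B" "z' \<in> ?B" "(\<lambda>(x, c). insert x c) z = (\<lambda>(x, c). insert x c) z'"
    obtain x c x' c' where zz: "z = (x, c)" "z' = (x', c')" by (cases z, cases z')
    have *: "c \<in> chains (\<le>) {y\<in>S. x < y}" "c' \<in> chains (\<le>) {y\<in>S. x' < y}"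
      and eq: "insert x c = insert x' c'" using z unfolding zz by simp_all
    have lt: "\<And>y. y \<in> c \<Longrightarrow> x < y" "\<And>y. y \<in> c' \<Longrightarrow> x' < y"
      using *[unfolded chains_def] by blast+
    then have "x \<notin> c" "x' \<notin> c'" by blast+
    moreover have "x = x'"
    proof (rule ccontr)
      assume "x \<noteq> x'"
      moreover have "x \<in> insert x' c'" "x' \<in> insert x c" using eq by (metis insertI1)+
      ultimately have "x \<in> c'" "x' \<in> c" by simp_all
      then show False using lt less_asym by metis
    qed
    ultimately show "z = z'" using eq unfolding zz by (simp add: insert_ident)
  qed
  have "{} \<in> chains (\<le>) S" by (simp add: chains_def Complete_Partial_Order.chain_def)
  then have "chain_sum S = 1 + (\<Sum>c\<in>chains (\<le>) S - {{}}. (-1) ^ card c)"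
    unfolding chain_sum_def
    using sum.remove[OF finite_chains[OF fin], of "{}" "(\<le>)" "\<lambda>c. (-1) ^ card c :: int"] by simp
  also have "(\<Sum>c\<in>chains (\<le>) S - {{}}. (-1) ^ card c) = (\<Sum>(x, c)\<in>?B. - ((-1) ^ card c) :: int)"
    unfolding img
  proof (subst sum.reindex[OF inj], rule sum.cong, simp, clarify)
    fix x c assume *: "x \<in> S" "c \<in> chains (\<le>) {y\<in>S. x < y}"
    then have "x \<notin> c" by (auto simp: chains_def)
    moreover have "finite c" using chains_finite[OF _ *(2)] fin by simp
    ultimately show "((\<lambda>c. (-1) ^ card c) \<circ> (\<lambda>(x, c). insert x c)) (x, c) = - ((-1) ^ card c :: int)" by simp
  qed
  also have "\<dots> = (\<Sum>x\<in>S. - chain_sum {y\<in>S. x < y})"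
    unfolding chain_sum_def sum_negf[symmetric]
    by (rule sum.Sigma[symmetric]) (simp_all add: fin finite_chains)
  finally show ?thesis by (simp add: sum_negf)
qed

lemma chain_sum_image:
  fixes S :: "'b::order set" and f :: "'b \<Rightarrow> 'c::order"
  assumes "inj_on f S" "\<And>x y. x \<in> S \<Longrightarrow> y \<in> S \<Longrightarrow> f x \<le> f y \<longleftrightarrow> x \<le> y"
  shows "chain_sum (f ` S) = chain_sum S"
proof -
  have "chains (\<le>) (f ` S) = (`) f ` chains (\<le>) S"
  proof -
    have "Complete_Partial_Order.chain (\<le>) (f ` c) \<longleftrightarrow> Complete_Partial_Order.chain (\<le>) c" if "c \<subseteq> S" for c
      unfolding Complete_Partial_Order.chain_def ball_simps using assms(2) that by (meson subsetD)
    then show ?thesis by (auto simp: chains_def subset_image_iff)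
  qed
  moreover have "inj_on ((`) f) (chains (\<le>) S)"
    by (rule inj_onI) (use assms(1) in \<open>auto simp: chains_def inj_on_image_eq_iff\<close>)
  moreover have "card (f ` c) = card c" if "c \<in> chains (\<le>) S" for c
    using that assms(1) by (auto simp: chains_def intro: card_image inj_on_subset)
  ultimately show ?thesis by (simp add: chain_sum_def sum.reindex)
qed

section \<open>Triangular systems over a finite poset\<close>

text \<open>Moebius inversion for sums over upper sets. The system is triangular: a minimal element occurs
  only in its own equation, so it can be removed and its coefficient solved for last.\<close>

lemma upper_sums_solvable:
  fixes T :: "'b::order set" and \<beta> :: "'b \<Rightarrow> 'c::ab_group_add"
  assumes "finite T"
  shows "\<exists>b. \<forall>x\<in>T. (\<Sum>y\<in>{y\<in>T. x \<le> y}. b y) = \<beta> x"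
  using assms
proof (induction "card T" arbitrary: T)
  case (Suc n)
  then have "T \<noteq> {}" by auto
  then obtain m where m: "m \<in> T" "\<And>y. y \<in> T \<Longrightarrow> y \<le> m \<Longrightarrow> y = m"
    using finite_has_minimal[OF \<open>finite T\<close>] by blast
  obtain b where b: "\<And>x. x \<in> T - {m} \<Longrightarrow> (\<Sum>y\<in>{y\<in>T - {m}. x \<le> y}. b y) = \<beta> x"
  proof -
    have "n = card (T - {m})" "finite (T - {m})" using Suc.hyps(2) Suc.prems m(1) by simp_all
    from Suc.hyps(1)[OF this] show ?thesis using that by blast
  qed
  define b' where "b' = b(m := \<beta> m - (\<Sum>y\<in>{y\<in>T - {m}. m \<le> y}. b y))"
  have eq: "(\<Sum>y\<in>{y\<in>T - {m}. x \<le> y}. b' y) = (\<Sum>y\<in>{y\<in>T - {m}. x \<le> y}. b y)" for x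
    by (rule sum.cong) (auto simp: b'_def)
  have "(\<Sum>y\<in>{y\<in>T. x \<le> y}. b' y) = \<beta> x" if x: "x \<in> T" for x
  proof (cases "x = m")
    case True
    have "{y\<in>T. m \<le> y} = insert m {y\<in>T - {m}. m \<le> y}" using m(1) by auto
    then have "(\<Sum>y\<in>{y\<in>T. m \<le> y}. b' y) = b' m + (\<Sum>y\<in>{y\<in>T - {m}. m \<le> y}. b' y)"
      using \<open>finite T\<close> by (simp only: sum.insert finite_Collect_conjI) simp
    then show ?thesis unfolding True eq by (simp add: b'_def)
  next
    case False
    have "{y\<in>T. x \<le> y} = {y\<in>T - {m}. x \<le> y}" using False m(2)[OF x] by auto
    moreover have "x \<in> T - {m}" using x False by simp
    ultimately show ?thesis using eq[of x] b[of x] by (simp only:)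
  qed
  then show ?case by blast
qed auto

text \<open>With \<open>A = {0}\<close>, applied to a difference of two solutions, this gives uniqueness of the solution;
  with \<open>A = \<int>\<close> it gives integrality.\<close>

lemma upper_sums_in_subgroup:
  fixes T :: "'b::order set" and b :: "'b \<Rightarrow> 'c::ab_group_add"
  assumes fin: "finite T" and A: "0 \<in> A" "\<And>u v. u \<in> A \<Longrightarrow> v \<in> A \<Longrightarrow> u - v \<in> A"
    and sums: "\<And>x. x \<in> T \<Longrightarrow> (\<Sum>y\<in>{y\<in>T. x \<le> y}. b y) \<in> A"
    and "x \<in> T"
  shows "b x \<in> A"
  using \<open>x \<in> T\<close>
proof (induction "card {y\<in>T. x < y}" arbitrary: x rule: less_induct)
  case less
  have add: "u + v \<in> A" if "u \<in> A" "v \<in> A" for u v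
    using A(2)[OF that(1) A(2)[OF A(1) that(2)]] by simp
  have "b y \<in> A" if "y \<in> {y\<in>T. x < y}" for y
  proof (rule less.hyps)
    show "card {z\<in>T. y < z} < card {y\<in>T. x < y}"
      by (rule psubset_card_mono) (use fin that in auto)
  qed (use that in auto)
  moreover have "sum b U \<in> A" if "\<And>y. y \<in> U \<Longrightarrow> b y \<in> A" for U
    using that by (induction U rule: infinite_finite_induct) (auto intro: A(1) add)
  ultimately have "(\<Sum>y\<in>{y\<in>T. x < y}. b y) \<in> A" by blast
  moreover have "{y\<in>T. x \<le> y} = insert x {y\<in>T. x < y}" using less.prems by auto
  then have "(\<Sum>y\<in>{y\<in>T. x \<le> y}. b y) = b x + (\<Sum>y\<in>{y\<in>T. x < y}. b y)" using fin by simp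
  ultimately show ?case using A(2)[OF sums[OF less.prems], of "\<Sum>y\<in>{y\<in>T. x < y}. b y"] by simp
qed

section \<open>Counting orbits\<close>

lemma (in group) action_restrict:
  assumes "\<And>g x. g \<in> carrier G \<Longrightarrow> x \<in> E \<Longrightarrow> \<phi> g x \<in> E"
    and "\<And>x. x \<in> E \<Longrightarrow> \<phi> \<one> x = x"
    and "\<And>g h x. g \<in> carrier G \<Longrightarrow> h \<in> carrier G \<Longrightarrow> x \<in> E \<Longrightarrow> \<phi> (g \<otimes> h) x = \<phi> g (\<phi> h x)"
  shows "group_action G E (\<lambda>g. restrict (\<phi> g) E)"
proof -
  have bij: "bij_betw (\<phi> g) E E" if g: "g \<in> carrier G" for g
  proof (rule bij_betw_byWitness[where f' = "\<phi> (inv g)"])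
    have "\<phi> (inv g) (\<phi> g x) = x" "\<phi> g (\<phi> (inv g) x) = x" if "x \<in> E" for x
      using assms(2,3) that g by (metis inv_closed l_inv, metis inv_closed r_inv)
    then show "\<forall>a\<in>E. \<phi> (inv g) (\<phi> g a) = a" "\<forall>a'\<in>E. \<phi> g (\<phi> (inv g) a') = a'" by auto
  qed (use assms(1) g in auto)
  have "(\<lambda>g. restrict (\<phi> g) E) \<in> hom G (BijGroup E)"
  proof (rule homI)
    fix g assume "g \<in> carrier G"
    then show "restrict (\<phi> g) E \<in> carrier (BijGroup E)"
      using bij by (auto simp: BijGroup_def Bij_def)
  next
    fix g h assume gh: "g \<in> carrier G" "h \<in> carrier G"
    have "restrict (\<phi> k) E \<in> Bij E" if "k \<in> carrier G" for k
      using bij[OF that] by (simp add: Bij_def)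
    then show "restrict (\<phi> (g \<otimes> h)) E = restrict (\<phi> g) E \<otimes>\<^bsub>BijGroup E\<^esub> restrict (\<phi> h) E"
      using gh assms by (auto simp: BijGroup_def compose_def fun_eq_iff)
  qed
  then show ?thesis
    using group_BijGroup is_group by (simp add: group_action_def group_hom_def group_hom_axioms_def)
qed

text \<open>The conjugation actions below are given by plain functions, which are not extensional on the set
  acted upon as \<^locale>\<open>group_action\<close> requires; restricting them gives access to the orbit theorems.\<close>

locale plain_action = group G for G :: "('a, 'm) monoid_scheme" (structure) +
  fixes E :: "'e set" and \<phi> :: "'a \<Rightarrow> 'e \<Rightarrow> 'e"
  assumes closed: "\<And>g x. g \<in> carrier G \<Longrightarrow> x \<in> E \<Longrightarrow> \<phi> g x \<in> E"
    and unit: "\<And>x. x \<in> E \<Longrightarrow> \<phi> \<one> x = x"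
    and comp: "\<And>g h x. g \<in> carrier G \<Longrightarrow> h \<in> carrier G \<Longrightarrow> x \<in> E \<Longrightarrow> \<phi> (g \<otimes> h) x = \<phi> g (\<phi> h x)"
begin

abbreviation "\<phi>' \<equiv> \<lambda>g. restrict (\<phi> g) E"

sublocale ext: group_action G E \<phi>'
  using action_restrict[OF closed unit comp] .

lemma orbit_ext: "x \<in> E \<Longrightarrow> orbit G \<phi>' x = orbit G \<phi> x"
  by (auto simp: orbit_def)

lemma orbits_ext: "orbits G E \<phi>' = orbits G E \<phi>"
  unfolding orbits_def using orbit_ext by (metis (no_types, lifting))

lemma sum_by_orbits:
  "finite E \<Longrightarrow> (\<Sum>x\<in>E. f x) = (\<Sum>K\<in>orbits G E \<phi>. \<Sum>x\<in>K. f x)"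
  using ext.disjoint_sum[of f] by (simp add: orbits_ext)

lemma orbit_stabilizer:
  assumes "x \<in> E"
  shows "card (orbit G \<phi> x) * card {g \<in> carrier G. \<phi> g x = x} = order G"
proof -
  have "stabilizer G \<phi>' x = {g \<in> carrier G. \<phi> g x = x}"
    using assms by (auto simp: stabilizer_def)
  then show ?thesis using ext.orbit_stabilizer_theorem[OF assms] orbit_ext[OF assms] by simp
qed

lemma orbit_subset: "x \<in> E \<Longrightarrow> orbit G \<phi> x \<subseteq> E"
  using closed by (auto simp: orbit_def)

lemma orbit_of_member:
  assumes "K \<in> orbits G E \<phi>" "x \<in> K"
  shows "x \<in> E" "K = orbit G \<phi> x"
proof -
  show x: "x \<in> E" using assms orbit_subset by (auto simp: orbits_def)
  have "orbit G \<phi> x \<in> orbits G E \<phi>" using x by (auto simp: orbits_def)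
  moreover have "x \<in> orbit G \<phi> x" using ext.orbit_refl[OF x] orbit_ext[OF x] by simp
  ultimately show "K = orbit G \<phi> x"
    using ext.disjoint_union assms unfolding orbits_ext by blast
qed

lemma self_in_orbit: "x \<in> E \<Longrightarrow> x \<in> orbit G \<phi> x"
  using ext.orbit_refl orbit_ext by auto

lemma sum_card_stabilizers:
  assumes "finite (carrier G)" "K \<in> orbits G E \<phi>"
  shows "(\<Sum>x\<in>K. card {g \<in> carrier G. \<phi> g x = x}) = order G"
proof -
  have "stabilizer G \<phi>' x = {g \<in> carrier G. \<phi> g x = x}" if "x \<in> K" for x
    using orbit_of_member(1)[OF assms(2) that] by (auto simp: stabilizer_def)
  then have "(\<Sum>x\<in>K. card {g \<in> carrier G. \<phi> g x = x}) = (\<Sum>x\<in>K. card (stabilizer G \<phi>' x))"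
    by (intro sum.cong) auto
  then show ?thesis using ext.card_stablizer_sum[OF assms(1)] assms(2) by (simp add: orbits_ext)
qed

text \<open>Each orbit contributes its weight times the group order, by the orbit-stabilizer theorem.\<close>

lemma order_dvd_weighted_stabilizers:
  fixes w :: "'e \<Rightarrow> int"
  assumes fin: "finite (carrier G)" "finite E"
    and inv: "\<And>g x. g \<in> carrier G \<Longrightarrow> x \<in> E \<Longrightarrow> w (\<phi> g x) = w x"
  shows "int (order G) dvd (\<Sum>x\<in>E. w x * int (card {g \<in> carrier G. \<phi> g x = x}))"
  unfolding sum_by_orbits[OF fin(2)]
proof (rule dvd_sum)
  fix K assume K: "K \<in> orbits G E \<phi>"
  then obtain x where x: "x \<in> E" "K = orbit G \<phi> x" by (auto simp: orbits_def)
  have "(\<Sum>y\<in>K. w y * int (card {g \<in> carrier G. \<phi> g y = y})) =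
      (\<Sum>y\<in>K. w x * int (card {g \<in> carrier G. \<phi> g y = y}))"
    by (rule sum.cong) (use x inv in \<open>auto simp: orbit_def\<close>)
  also have "\<dots> = w x * int (order G)"
    using sum_card_stabilizers[OF fin(1) K] by (simp flip: sum_distrib_left of_nat_sum)
  finally show "int (order G) dvd (\<Sum>y\<in>K. w y * int (card {g \<in> carrier G. \<phi> g y = y}))" by simp
qed

text \<open>The orbits of a \<open>p\<close>-group other than the fixed points have size divisible by \<open>p\<close>.\<close>

lemma p_group_fixed_points:
  assumes fin: "finite E" and p: "prime p" "order G = p ^ n" 
  shows "int (card E) mod int p = int (card {x \<in> E. \<forall>g\<in>carrier G. \<phi> g x = x}) mod int p"
proof -
  let ?F = "{x \<in> E. \<forall>g\<in>carrier G. \<phi> g x = x}"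
  let ?w = "\<lambda>x. if x \<in> ?F then 0 else 1 :: int"
  have "int p dvd (\<Sum>x\<in>K. ?w x)" if K: "K \<in> orbits G E \<phi>" for K
  proof -
    obtain x where x: "x \<in> E" "K = orbit G \<phi> x" using K by (auto simp: orbits_def)
    show ?thesis
    proof (cases "\<exists>y\<in>K. y \<in> ?F")
      case True
      then obtain y where "y \<in> K" "y \<in> ?F" by auto
      then have "K = {y}" using orbit_of_member[OF K, of y] monoid.one_closed[OF is_monoid]
        by (auto simp: orbit_def)
      then show ?thesis using \<open>y \<in> ?F\<close> by simp
    next
      case False
      then have "(\<Sum>x\<in>K. ?w x) = (\<Sum>x\<in>K. 1)" by (intro sum.cong) auto
      then have "(\<Sum>x\<in>K. ?w x) = int (card K)" by simp
      moreover have "card K dvd p ^ n" using orbit_stabilizer[OF x(1)] x p(2) by (metis dvd_triv_left)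
      moreover have "card K \<noteq> 1"
      proof
        assume "card K = 1"
        then obtain y where y: "K = {y}" by (auto simp: card_1_singleton_iff)
        then have "y = x" using self_in_orbit[OF x(1)] x by auto
        then have "x \<in> ?F" using x y by (auto simp: orbit_def)
        then show False using False y \<open>y = x\<close> by auto
      qed
      ultimately show ?thesis using divides_primepow_nat[OF p(1), of "card K" n]
        by (metis dvd_power of_nat_dvd_iff power_0 gr0I)
    qed
  qed
  then have "int p dvd (\<Sum>x\<in>E. ?w x)"
    unfolding sum_by_orbits[OF fin] by (rule dvd_sum)
  moreover have "(\<Sum>x\<in>E. ?w x) = int (card E) - int (card ?F)"
  proof -
    have "(\<Sum>x\<in>E. ?w x) = (\<Sum>x\<in>E. 1 - (if x \<in> ?F then 1 else 0))" by (intro sum.cong) auto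
    also have "\<dots> = int (card E) - (\<Sum>x\<in>E. if x \<in> ?F then 1 else 0)" by (simp add: sum_subtractf)
    also have "(\<Sum>x\<in>E. if x \<in> ?F then 1 else 0) = int (card ?F)"
      using sum.inter_restrict[OF fin, of "\<lambda>_. 1::int" ?F] by (simp add: Int_absorb1)
    finally show ?thesis .
  qed
  ultimately show ?thesis by (simp add: mod_eq_dvd_iff)
qed

end

section \<open>Conjugation of subsets\<close>

definition conj_set :: "('a, 'm) monoid_scheme \<Rightarrow> 'a \<Rightarrow> 'a set \<Rightarrow> 'a set" where
  "conj_set G g X = (\<lambda>x. g \<otimes>\<^bsub>G\<^esub> x \<otimes>\<^bsub>G\<^esub> inv\<^bsub>G\<^esub> g) ` X"

context group
begin

lemma conj_mult:
  "g \<in> carrier G \<Longrightarrow> x \<in> carrier G \<Longrightarrow> y \<in> carrier G \<Longrightarrow>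
    g \<otimes> (x \<otimes> y) \<otimes> inv g = (g \<otimes> x \<otimes> inv g) \<otimes> (g \<otimes> y \<otimes> inv g)"
  by (metis (full_types) inv_solve_right m_assoc m_closed r_inv_ex inv_closed)

lemma conj_conj:
  "g \<in> carrier G \<Longrightarrow> h \<in> carrier G \<Longrightarrow> x \<in> carrier G \<Longrightarrow>
    (g \<otimes> h) \<otimes> x \<otimes> inv (g \<otimes> h) = g \<otimes> (h \<otimes> x \<otimes> inv h) \<otimes> inv g"
  by (simp add: m_assoc inv_mult_group)

lemma conj_inverse:
  "g \<in> carrier G \<Longrightarrow> x \<in> carrier G \<Longrightarrow> inv (g \<otimes> x \<otimes> inv g) = g \<otimes> inv x \<otimes> inv g"
  by (simp add: m_assoc inv_mult_group)

lemma conj_commutes_iff: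
  "g \<in> carrier G \<Longrightarrow> x \<in> carrier G \<Longrightarrow> g \<otimes> x \<otimes> inv g = x \<longleftrightarrow> g \<otimes> x = x \<otimes> g"
  by (metis inv_solve_right m_closed)

lemma conj_coset: "g <# X #> inv g = conj_set G g X"
  by (auto simp: conj_set_def l_coset_def r_coset_def)

lemma conj_action_eq: "X \<subseteq> carrier G \<Longrightarrow> conj_action G g X = conj_set G g X"
  by (simp add: conj_action_def conj_coset)

lemma normalizer_eq: "X \<subseteq> carrier G \<Longrightarrow> normalizer G X = {g \<in> carrier G. conj_set G g X = X}"
  by (simp add: normalizer_def stabilizer_def conj_coset)

lemma conj_set_closed: "g \<in> carrier G \<Longrightarrow> X \<subseteq> carrier G \<Longrightarrow> conj_set G g X \<subseteq> carrier G"
  by (auto simp: conj_set_def)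

lemma conj_set_one: "X \<subseteq> carrier G \<Longrightarrow> conj_set G \<one> X = X"
proof -
  assume "X \<subseteq> carrier G"
  then have "(\<lambda>x. \<one> \<otimes> x \<otimes> inv \<one>) ` X = (\<lambda>x. x) ` X" by (intro image_cong) auto
  then show "conj_set G \<one> X = X" by (simp add: conj_set_def)
qed

lemma conj_set_comp:
  "g \<in> carrier G \<Longrightarrow> h \<in> carrier G \<Longrightarrow> X \<subseteq> carrier G \<Longrightarrow>
    conj_set G (g \<otimes> h) X = conj_set G g (conj_set G h X)"
  unfolding conj_set_def image_image by (rule image_cong) (auto simp: conj_conj)

lemma conj_set_inv:
  assumes "g \<in> carrier G" "X \<subseteq> carrier G"
  shows "conj_set G (inv g) (conj_set G g X) = X" "conj_set G g (conj_set G (inv g) X) = X"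
  using assms by (simp_all add: conj_set_comp[symmetric] conj_set_one)

lemma conj_set_eq_iff:
  assumes "g \<in> carrier G" "X \<subseteq> carrier G" "Y \<subseteq> carrier G"
  shows "conj_set G g X = conj_set G g Y \<longleftrightarrow> X = Y"
  using conj_set_inv(1) assms by metis

lemma inj_on_conj: "g \<in> carrier G \<Longrightarrow> inj_on (\<lambda>x. g \<otimes> x \<otimes> inv g) (carrier G)"
  by (rule inj_onI) simp

lemma conj_set_subset_iff:
  assumes "g \<in> carrier G" "X \<subseteq> carrier G" "Y \<subseteq> carrier G"
  shows "conj_set G g X \<subseteq> conj_set G g Y \<longleftrightarrow> X \<subseteq> Y"
proof
  have mono: "conj_set G h U \<subseteq> conj_set G h V" if "U \<subseteq> V" for h U V
    using that unfolding conj_set_def by (rule image_mono)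
  show "X \<subseteq> Y" if "conj_set G g X \<subseteq> conj_set G g Y"
    using mono[OF that, of "inv g"] conj_set_inv(1) assms by metis
qed (auto simp: conj_set_def)

lemma conj_set_Int:
  "g \<in> carrier G \<Longrightarrow> X \<subseteq> carrier G \<Longrightarrow> Y \<subseteq> carrier G \<Longrightarrow>
    conj_set G g (X \<inter> Y) = conj_set G g X \<inter> conj_set G g Y"
  unfolding conj_set_def by (rule inj_on_image_Int[OF inj_on_conj])

lemma card_conj_set: "g \<in> carrier G \<Longrightarrow> X \<subseteq> carrier G \<Longrightarrow> card (conj_set G g X) = card X"
  unfolding conj_set_def by (rule card_image) (auto intro: inj_on_subset[OF inj_on_conj])

lemma subgroup_conj_set:
  assumes g: "g \<in> carrier G" and H: "subgroup H G"
  shows "subgroup (conj_set G g H) G"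
proof (rule subgroupI)
  have HG: "H \<subseteq> carrier G" by (rule subgroup.subset[OF H])
  show "conj_set G g H \<subseteq> carrier G" by (rule conj_set_closed[OF g HG])
  show "conj_set G g H \<noteq> {}" using subgroup.one_closed[OF H] by (auto simp: conj_set_def)
  show "inv a \<in> conj_set G g H" if a: "a \<in> conj_set G g H" for a
  proof -
    obtain x where x: "x \<in> H" "a = g \<otimes> x \<otimes> inv g" using a by (auto simp: conj_set_def)
    then have "inv a = g \<otimes> inv x \<otimes> inv g" using g HG by (auto simp: conj_inverse)
    then show ?thesis using subgroup.m_inv_closed[OF H x(1)] by (auto simp: conj_set_def)
  qed
  show "a \<otimes> b \<in> conj_set G g H" if ab: "a \<in> conj_set G g H" "b \<in> conj_set G g H" for a b
  proof -
    obtain x y where x: "x \<in> H" "a = g \<otimes> x \<otimes> inv g" and y: "y \<in> H" "b = g \<otimes> y \<otimes> inv g"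
      using ab by (auto simp: conj_set_def)
    moreover have "x \<in> carrier G" "y \<in> carrier G" using x(1) y(1) HG by auto
    ultimately have "a \<otimes> b = g \<otimes> (x \<otimes> y) \<otimes> inv g" using conj_mult[OF g, of x y] by simp
    then show ?thesis using subgroup.m_closed[OF H x(1) y(1)] by (auto simp: conj_set_def)
  qed
qed

lemma conj_set_self:
  assumes H: "subgroup H G" and h: "h \<in> H"
  shows "conj_set G h H = H"
proof
  have HG: "H \<subseteq> carrier G" by (rule subgroup.subset[OF H])
  have sub: "conj_set G k H \<subseteq> H" if "k \<in> H" for k
    using that subgroup.m_closed[OF H] subgroup.m_inv_closed[OF H] by (auto simp: conj_set_def)
  show "conj_set G h H \<subseteq> H" by (rule sub[OF h])
  have "conj_set G h (conj_set G (inv h) H) \<subseteq> conj_set G h H"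
    using sub[OF subgroup.m_inv_closed[OF H h]] unfolding conj_set_def by (rule image_mono)
  then show "H \<subseteq> conj_set G h H" using conj_set_inv(2)[of h H] HG h by auto
qed

lemma conj_set_mult:
  assumes "g \<in> carrier G" "X \<subseteq> carrier G" "Y \<subseteq> carrier G"
  shows "conj_set G g (X <#> Y) = conj_set G g X <#> conj_set G g Y"
proof -
  have "g \<otimes> (x \<otimes> y) \<otimes> inv g = (g \<otimes> x \<otimes> inv g) \<otimes> (g \<otimes> y \<otimes> inv g)" if "x \<in> X" "y \<in> Y" for x y
    using assms that by (intro conj_mult) auto
  then show ?thesis by (auto simp: conj_set_def set_mult_def image_UN)
qed

lemma subgroup_normalizer_in:
  assumes H: "subgroup H G" and X: "X \<subseteq> carrier G"
  shows "subgroup {g \<in> H. conj_set G g X = X} G"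
proof -
  have "{g \<in> H. conj_set G g X = X} = H \<inter> normalizer G X"
    using subgroup.subset[OF H] by (auto simp: normalizer_eq[OF X])
  then show ?thesis using subgroups_Inter_pair[OF H normalizer_imp_subgroup[OF X]] by simp
qed

lemma conj_set_plain_action:
  assumes H: "subgroup H G" and E: "\<And>X. X \<in> E \<Longrightarrow> X \<subseteq> carrier G"
    and cl: "\<And>h X. h \<in> H \<Longrightarrow> X \<in> E \<Longrightarrow> conj_set G h X \<in> E"
  shows "plain_action (G\<lparr>carrier := H\<rparr>) E (conj_set G)"
proof -
  interpret H: group "G\<lparr>carrier := H\<rparr>" by (rule subgroup_imp_group[OF H])
  show ?thesis
    using subgroup.mem_carrier[OF H] by unfold_locales (simp_all add: cl E conj_set_one conj_set_comp)
qed

text \<open>If \<open>P\<close> normalizes \<open>Q\<close> then \<open>PQ\<close> is a subgroup, and \<open>P \<times> Q \<rightarrow> PQ\<close> has fibres of the constant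
  size \<open>\<bar>P \<inter> Q\<bar>\<close>.\<close>

lemma subgroup_set_mult:
  assumes P: "subgroup P G" and Q: "subgroup Q G" and N: "\<And>g. g \<in> P \<Longrightarrow> conj_set G g Q = Q"
  shows "subgroup (P <#> Q) G"
proof (rule subgroupI)
  have PG: "P \<subseteq> carrier G" and QG: "Q \<subseteq> carrier G" using P Q subgroup.subset by auto
  have cj: "g \<otimes> q \<otimes> inv g \<in> Q" if "g \<in> P" "q \<in> Q" for g q
    using N[OF that(1)] that(2) by (auto simp: conj_set_def)
  show "P <#> Q \<subseteq> carrier G" by (rule set_mult_closed[OF PG QG])
  show "P <#> Q \<noteq> {}"
    using subgroup.one_closed[OF P] subgroup.one_closed[OF Q] by (auto simp: set_mult_def)
  show "inv a \<in> P <#> Q" if a: "a \<in> P <#> Q" for a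
  proof -
    obtain x y where x: "x \<in> P" "y \<in> Q" "a = x \<otimes> y" using a by (auto simp: set_mult_def)
    then have "inv a = inv x \<otimes> (x \<otimes> inv y \<otimes> inv x)"
      using PG QG by (simp add: subset_iff inv_mult_group m_assoc[symmetric])
    then show ?thesis using cj[OF x(1) subgroup.m_inv_closed[OF Q x(2)]] subgroup.m_inv_closed[OF P x(1)]
      by (auto simp: set_mult_def)
  qed
  show "a \<otimes> b \<in> P <#> Q" if ab: "a \<in> P <#> Q" "b \<in> P <#> Q" for a b
  proof -
    obtain x y u v where x: "x \<in> P" "y \<in> Q" "a = x \<otimes> y" "u \<in> P" "v \<in> Q" "b = u \<otimes> v"
      using ab by (auto simp: set_mult_def)
    have "inv u \<otimes> y \<otimes> u \<in> Q"
      using cj[OF subgroup.m_inv_closed[OF P x(4)] x(2)] x(4) PG by (simp add: subset_iff)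
    moreover have "a \<otimes> b = (x \<otimes> u) \<otimes> ((inv u \<otimes> y \<otimes> u) \<otimes> v)"
    proof -
      have c: "x \<in> carrier G" "y \<in> carrier G" "u \<in> carrier G" "v \<in> carrier G" using x PG QG by auto
      have "u \<otimes> (inv u \<otimes> (y \<otimes> (u \<otimes> v))) = y \<otimes> (u \<otimes> v)"
        using c by (simp add: m_assoc[symmetric])
      then show ?thesis using c x by (simp add: m_assoc)
    qed
    ultimately show ?thesis
      using subgroup.m_closed[OF P x(1,4)] subgroup.m_closed[OF Q _ x(5)] by (auto simp: set_mult_def)
  qed
qed

lemma card_set_mult:
  assumes P: "subgroup P G" and Q: "subgroup Q G" and fin: "finite P" "finite Q"
  shows "card (P <#> Q) * card (P \<inter> Q) = card P * card Q"
proof -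
  have PG: "P \<subseteq> carrier G" and QG: "Q \<subseteq> carrier G" using P Q subgroup.subset by auto
  let ?f = "\<lambda>(x, y). x \<otimes> y"
  have img: "P <#> Q = ?f ` (P \<times> Q)" by (auto simp: set_mult_def)
  have fibre: "card {z \<in> P \<times> Q. ?f z = w} = card (P \<inter> Q)" if w: "w \<in> P <#> Q" for w
  proof -
    obtain x y where x: "x \<in> P" "y \<in> Q" "w = x \<otimes> y" using w by (auto simp: set_mult_def)
    have xc: "x \<in> carrier G" "y \<in> carrier G" using x PG QG by auto
    have "bij_betw (\<lambda>t. (x \<otimes> t, inv t \<otimes> y)) (P \<inter> Q) {z \<in> P \<times> Q. ?f z = w}"
    proof (rule bij_betw_byWitness[where f' = "\<lambda>(u, v). inv x \<otimes> u"])
      show "\<forall>a\<in>P \<inter> Q. (\<lambda>(u, v). inv x \<otimes> u) (x \<otimes> a, inv a \<otimes> y) = a"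
        using xc PG by (auto simp: m_assoc[symmetric])
      show "(\<lambda>t. (x \<otimes> t, inv t \<otimes> y)) ` (P \<inter> Q) \<subseteq> {z \<in> P \<times> Q. ?f z = w}"
      proof safe
        fix t assume t: "t \<in> P" "t \<in> Q"
        then have tc: "t \<in> carrier G" using PG by auto
        show "x \<otimes> t \<in> P" "inv t \<otimes> y \<in> Q"
          using t x P Q by (auto simp: subgroup.m_closed subgroup.m_inv_closed)
        have "t \<otimes> (inv t \<otimes> y) = y" using tc xc by (simp add: m_assoc[symmetric])
        then show "x \<otimes> t \<otimes> (inv t \<otimes> y) = w" using tc xc x(3) by (simp add: m_assoc)
      qed
      have inverse: "inv x \<otimes> u \<in> P \<inter> Q" "x \<otimes> (inv x \<otimes> u) = u" "inv (inv x \<otimes> u) \<otimes> y = v"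
        if u: "u \<in> P" "v \<in> Q" "u \<otimes> v = w" for u v
      proof -
        have uc: "u \<in> carrier G" "v \<in> carrier G" using u(1,2) PG QG by auto
        have "x \<otimes> y = u \<otimes> v" using u(3) x(3) by simp
        then have "x \<otimes> y \<otimes> inv v = u" using uc xc by (simp add: m_assoc)
        then have eq: "inv x \<otimes> u = y \<otimes> inv v" using uc xc by (metis inv_closed inv_solve_left m_assoc m_closed)
        have "inv x \<otimes> u \<in> P" "y \<otimes> inv v \<in> Q"
          using u(1,2) x(1,2) P Q by (simp_all add: subgroup.m_closed subgroup.m_inv_closed)
        then show "inv x \<otimes> u \<in> P \<inter> Q" using eq by simp
        show "x \<otimes> (inv x \<otimes> u) = u" using uc xc by (simp add: m_assoc[symmetric])
        show "inv (inv x \<otimes> u) \<otimes> y = v"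
          unfolding eq using uc xc by (simp add: inv_mult_group m_assoc)
      qed
      show "\<forall>z\<in>{z \<in> P \<times> Q. ?f z = w}. (\<lambda>t. (x \<otimes> t, inv t \<otimes> y)) ((\<lambda>(u, v). inv x \<otimes> u) z) = z"
      proof
        fix z assume z: "z \<in> {z \<in> P \<times> Q. ?f z = w}"
        obtain u v where zu: "z = (u, v)" by (cases z)
        have u: "u \<in> P" "v \<in> Q" "u \<otimes> v = w" using z unfolding zu by simp_all
        show "(\<lambda>t. (x \<otimes> t, inv t \<otimes> y)) ((\<lambda>(u, v). inv x \<otimes> u) z) = z"
          by (simp only: zu prod.case inverse(2,3)[OF u])
      qed
      show "(\<lambda>(u, v). inv x \<otimes> u) ` {z \<in> P \<times> Q. ?f z = w} \<subseteq> P \<inter> Q"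
      proof (rule image_subsetI)
        fix z assume z: "z \<in> {z \<in> P \<times> Q. ?f z = w}"
        obtain u v where zu: "z = (u, v)" by (cases z)
        have u: "u \<in> P" "v \<in> Q" "u \<otimes> v = w" using z unfolding zu by simp_all
        show "(\<lambda>(u, v). inv x \<otimes> u) z \<in> P \<inter> Q"
          by (simp only: zu prod.case inverse(1)[OF u])
      qed
    qed
    from bij_betw_same_card[OF this] show ?thesis by (rule sym)
  qed
  have "finite (P \<times> Q)" using fin by simp
  from sum.image_gen[OF this, of "\<lambda>_. 1::nat" ?f]
  have "card (P \<times> Q) = (\<Sum>w\<in>P <#> Q. card {z \<in> P \<times> Q. ?f z = w})"
    unfolding img card_eq_sum .
  also have "\<dots> = card (P <#> Q) * card (P \<inter> Q)" by (simp only: fibre sum_constant of_nat_id cong: sum.cong)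
  finally show ?thesis by (simp add: card_cartesian_product)
qed

end

section \<open>Maximal \<open>p\<close>-subgroups\<close>

locale finite_group_prime = group G for G :: "('a, 'm) monoid_scheme" (structure) +
  fixes p :: nat
  assumes fin: "finite (carrier G)" and prime: "prime p"
begin

definition p_subgroup :: "'a set \<Rightarrow> bool" where
  "p_subgroup P \<longleftrightarrow> subgroup P G \<and> (\<exists>n. card P = p ^ n)"

definition p_subgroups_above :: "'a set \<Rightarrow> 'a set \<Rightarrow> 'a set set" where
  "p_subgroups_above H Q = {R. p_subgroup R \<and> R \<subseteq> H \<and> Q \<subset> R}"

text \<open>The role of Sylow subgroups of \<open>H\<close> is played by maximal \<open>p\<close>-subgroups: only their conjugacy is
  used, not their order.\<close>

definition maximal_p_subgroup :: "'a set \<Rightarrow> 'a set \<Rightarrow> bool" where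
  "maximal_p_subgroup H M \<longleftrightarrow> p_subgroup M \<and> M \<subseteq> H \<and> p_subgroups_above H M = {}"

lemma subgroup_finite: "subgroup H G \<Longrightarrow> finite H"
  using fin subgroup.subset finite_subset by blast

lemma p_subgroup_subset: "p_subgroup P \<Longrightarrow> P \<subseteq> carrier G"
  by (auto simp: p_subgroup_def dest: subgroup.subset)

lemma p_subgroup_finite: "p_subgroup P \<Longrightarrow> finite P"
  by (auto simp: p_subgroup_def intro: subgroup_finite)

lemma p_subgroup_trivial: "p_subgroup {\<one>}"
  unfolding p_subgroup_def using triv_subgroup exI[of "\<lambda>n. card {\<one>} = p ^ n" 0] by simp

lemma p_subgroup_conj_set:
  assumes "g \<in> carrier G" "p_subgroup P"
  shows "p_subgroup (conj_set G g P)"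
  using assms(2) subgroup_conj_set[OF assms(1)] card_conj_set[OF assms(1) p_subgroup_subset[OF assms(2)]]
  by (simp add: p_subgroup_def)

lemma finite_p_subgroups_above: "finite (p_subgroups_above H Q)"
  by (rule finite_subset[of _ "Pow (carrier G)"])
    (use fin in \<open>auto simp: p_subgroups_above_def dest: p_subgroup_subset\<close>)

lemma p_subgroup_smaller:
  assumes "p_subgroup P" "subgroup Q G" "Q \<subseteq> P"
  shows "p_subgroup Q"
proof -
  obtain n where n: "card P = p ^ n" "subgroup P G" using assms(1) by (auto simp: p_subgroup_def)
  interpret P: group "G\<lparr>carrier := P\<rparr>" by (rule subgroup_imp_group[OF n(2)])
  have "subgroup Q (G\<lparr>carrier := P\<rparr>)" by (rule subgroup_incl[OF assms(2) n(2) assms(3)])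
  from P.lagrange[OF this] have "card (rcosets\<^bsub>G\<lparr>carrier := P\<rparr>\<^esub> Q) * card Q = card P" by (simp add: order_def)
  then have "card Q dvd card P" by (metis dvd_triv_right)
  then show ?thesis
    using divides_primepow_nat[OF prime] n(1) assms(2) unfolding p_subgroup_def by metis
qed

lemma p_subgroup_set_mult:
  assumes P: "p_subgroup P" and Q: "p_subgroup Q" and N: "\<And>g. g \<in> P \<Longrightarrow> conj_set G g Q = Q"
  shows "p_subgroup (P <#> Q)" "P \<subseteq> P <#> Q" "Q \<subseteq> P <#> Q"
proof -
  have sub: "subgroup P G" "subgroup Q G" using P Q by (simp_all add: p_subgroup_def)
  obtain m n where "card P = p ^ m" "card Q = p ^ n" using P Q by (auto simp: p_subgroup_def)
  then have "card (P <#> Q) * card (P \<inter> Q) = p ^ (m + n)"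
    using card_set_mult[OF sub p_subgroup_finite[OF P] p_subgroup_finite[OF Q]] by (simp add: power_add)
  then have "card (P <#> Q) dvd p ^ (m + n)" by (metis dvd_triv_left)
  then show "p_subgroup (P <#> Q)"
    using divides_primepow_nat[OF prime] subgroup_set_mult[OF sub N] unfolding p_subgroup_def by blast
  show "P \<subseteq> P <#> Q"
  proof
    fix x assume "x \<in> P"
    then have "x \<otimes> \<one> \<in> P <#> Q" using subgroup.one_closed[OF sub(2)] unfolding set_mult_def by blast
    then show "x \<in> P <#> Q" using \<open>x \<in> P\<close> subgroup.mem_carrier[OF sub(1)] by simp
  qed
  show "Q \<subseteq> P <#> Q"
  proof
    fix x assume "x \<in> Q"
    then have "\<one> \<otimes> x \<in> P <#> Q" using subgroup.one_closed[OF sub(1)] unfolding set_mult_def by blast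
    then show "x \<in> P <#> Q" using \<open>x \<in> Q\<close> subgroup.mem_carrier[OF sub(2)] by simp
  qed
qed

lemma maximal_p_subgroupD:
  assumes "maximal_p_subgroup H M" "p_subgroup R" "R \<subseteq> H" "M \<subseteq> R"
  shows "R = M"
  using assms by (auto simp: maximal_p_subgroup_def p_subgroups_above_def)

text \<open>If one of \<open>R\<close> and \<open>M\<close> normalizes the other, their product is a \<open>p\<close>-subgroup of \<open>H\<close> containing \<open>M\<close>.\<close>

lemma maximal_p_subgroup_absorbs:
  assumes H: "subgroup H G" and M: "maximal_p_subgroup H M" and R: "p_subgroup R" "R \<subseteq> H"
    and N: "(\<forall>g\<in>R. conj_set G g M = M) \<or> (\<forall>g\<in>M. conj_set G g R = R)"
  shows "R \<subseteq> M"
proof -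
  have M': "p_subgroup M" "M \<subseteq> H" using M by (auto simp: maximal_p_subgroup_def)
  have in_H: "X <#> Y \<subseteq> H" if "X \<subseteq> H" "Y \<subseteq> H" for X Y
    using that subgroup.m_closed[OF H] by (auto simp: set_mult_def)
  from N show ?thesis
  proof
    assume "\<forall>g\<in>R. conj_set G g M = M"
    then have *: "p_subgroup (R <#> M)" "R \<subseteq> R <#> M" "M \<subseteq> R <#> M"
      using p_subgroup_set_mult[OF R(1) M'(1)] by blast+
    with maximal_p_subgroupD[OF M *(1) in_H[OF R(2) M'(2)]] show ?thesis by blast
  next
    assume "\<forall>g\<in>M. conj_set G g R = R"
    then have *: "p_subgroup (M <#> R)" "M \<subseteq> M <#> R" "R \<subseteq> M <#> R"
      using p_subgroup_set_mult[OF M'(1) R(1)] by blast+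
    with maximal_p_subgroupD[OF M *(1) in_H[OF M'(2) R(2)]] show ?thesis by blast
  qed
qed

lemma maximal_p_subgroup_conj_set:
  assumes H: "subgroup H G" and h: "h \<in> H" and M: "maximal_p_subgroup H M"
  shows "maximal_p_subgroup H (conj_set G h M)"
proof -
  have hG: "h \<in> carrier G" using subgroup.mem_carrier[OF H h] .
  have HG: "H \<subseteq> carrier G" by (rule subgroup.subset[OF H])
  have M': "p_subgroup M" "M \<subseteq> H" using M by (auto simp: maximal_p_subgroup_def)
  have MG: "M \<subseteq> carrier G" using M'(2) HG by blast
  have H1: "conj_set G k H = H" if "k \<in> H" for k by (rule conj_set_self[OF H that])
  have "R = conj_set G h M" if R: "p_subgroup R" "R \<subseteq> H" "conj_set G h M \<subseteq> R" for R
  proof -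
    have RG: "R \<subseteq> carrier G" using R(2) HG by blast
    have "inv h \<in> H" using subgroup.m_inv_closed[OF H h] .
    have sub: "conj_set G (inv h) X \<subseteq> conj_set G (inv h) Y" if "X \<subseteq> Y" for X Y
      using that unfolding conj_set_def by (rule image_mono)
    have "conj_set G (inv h) R = M"
    proof (rule maximal_p_subgroupD[OF M])
      show "p_subgroup (conj_set G (inv h) R)" using p_subgroup_conj_set R(1) hG by simp
      show "conj_set G (inv h) R \<subseteq> H" using sub[OF R(2)] H1[OF \<open>inv h \<in> H\<close>] by simp
      show "M \<subseteq> conj_set G (inv h) R" using sub[OF R(3)] conj_set_inv(1)[OF hG MG] by simp
    qed
    then show ?thesis using conj_set_inv(2)[OF hG RG] by simp
  qed
  moreover have "conj_set G h M \<subseteq> H"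
    using M'(2) H1[OF h] unfolding conj_set_def by blast
  ultimately show ?thesis
    using p_subgroup_conj_set[OF hG M'(1)] by (auto simp: maximal_p_subgroup_def p_subgroups_above_def)
qed

lemma exists_maximal_p_subgroup:
  assumes "p_subgroup R" "R \<subseteq> H"
  shows "\<exists>M. maximal_p_subgroup H M \<and> R \<subseteq> M"
proof -
  let ?A = "{P. p_subgroup P \<and> P \<subseteq> H}"
  have "finite ?A"
    by (rule finite_subset[of _ "Pow (carrier G)"]) (use fin in \<open>auto dest: p_subgroup_subset\<close>)
  from finite_has_maximal2[OF this, of R] assms
  obtain M where M: "M \<in> ?A" "R \<subseteq> M" "\<And>P. P \<in> ?A \<Longrightarrow> M \<subseteq> P \<Longrightarrow> M = P" by auto
  then have "maximal_p_subgroup H M" by (auto simp: maximal_p_subgroup_def p_subgroups_above_def)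
  with M(2) show ?thesis by blast
qed

lemma conj_orbit_action:
  assumes H: "subgroup H G" and Q: "Q \<subseteq> carrier G" and K: "subgroup K G" "K \<subseteq> H"
  shows "plain_action (G\<lparr>carrier := K\<rparr>) ((\<lambda>h. conj_set G h Q) ` H) (conj_set G)"
proof (rule conj_set_plain_action[OF K(1)])
  show "X \<subseteq> carrier G" if "X \<in> (\<lambda>h. conj_set G h Q) ` H" for X
    using that conj_set_closed[OF _ Q] subgroup.mem_carrier[OF H] by blast
  show "conj_set G k X \<in> (\<lambda>h. conj_set G h Q) ` H"
    if k: "k \<in> K" and X: "X \<in> (\<lambda>h. conj_set G h Q) ` H" for k X
  proof -
    obtain h where h: "h \<in> H" "X = conj_set G h Q" using X by blast
    have "k \<in> H" using k K(2) by blast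
    then have "conj_set G k X = conj_set G (k \<otimes> h) Q" "k \<otimes> h \<in> H"
      using h conj_set_comp[OF _ _ Q] subgroup.mem_carrier[OF H] subgroup.m_closed[OF H] by auto
    then show ?thesis by blast
  qed
qed

text \<open>A maximal \<open>p\<close>-subgroup \<open>P\<close> acts on the \<open>H\<close>-conjugates of \<open>M\<close>, and by absorption it can fix only
  itself. Counting fixed points of \<open>M\<close> shows that the number of conjugates is 1 modulo \<open>p\<close>, so \<open>M'\<close>
  also has a fixed point, which must be \<open>M'\<close>.\<close>

lemma maximal_p_subgroups_conjugate:
  assumes H: "subgroup H G" and M: "maximal_p_subgroup H M" and M': "maximal_p_subgroup H M'"
  shows "\<exists>h\<in>H. conj_set G h M = M'"
proof -
  let ?X = "(\<lambda>h. conj_set G h M) ` H"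
  have fX: "finite ?X" using subgroup_finite[OF H] by simp
  have X: "maximal_p_subgroup H Y" if "Y \<in> ?X" for Y
    using that maximal_p_subgroup_conj_set[OF H _ M] by auto
  have MG: "M \<subseteq> carrier G" using M p_subgroup_subset by (auto simp: maximal_p_subgroup_def)
  have MX: "M \<in> ?X"
    using conj_set_one[OF MG] subgroup.one_closed[OF H] by (metis imageI)
  have fixed: "int (card ?X) mod int p = int (card {Y \<in> ?X. Y = P}) mod int p" if P: "maximal_p_subgroup H P" for P
  proof -
    have P': "p_subgroup P" "P \<subseteq> H" "subgroup P G" using P by (auto simp: maximal_p_subgroup_def p_subgroup_def)
    then obtain n where n: "card P = p ^ n" by (auto simp: p_subgroup_def)
    interpret act: plain_action "G\<lparr>carrier := P\<rparr>" ?X "conj_set G"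
      by (rule conj_orbit_action[OF H MG P'(3,2)])
    have "{Y \<in> ?X. \<forall>g\<in>carrier (G\<lparr>carrier := P\<rparr>). conj_set G g Y = Y} = {Y \<in> ?X. Y = P}"
    proof (rule Collect_cong, rule conj_cong[OF refl])
      fix Y assume Y: "Y \<in> ?X"
      have Y': "p_subgroup Y" "Y \<subseteq> H" using X[OF Y] by (auto simp: maximal_p_subgroup_def)
      show "(\<forall>g\<in>carrier (G\<lparr>carrier := P\<rparr>). conj_set G g Y = Y) \<longleftrightarrow> Y = P"
      proof
        assume "\<forall>g\<in>carrier (G\<lparr>carrier := P\<rparr>). conj_set G g Y = Y"
        then have "P \<subseteq> Y" using maximal_p_subgroup_absorbs[OF H X[OF Y] P'(1,2)] by simp
        then show "Y = P" using maximal_p_subgroupD[OF P Y'] by simp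
      qed (use conj_set_self[OF P'(3)] in simp)
    qed
    then show ?thesis
      using act.p_group_fixed_points[OF fX prime, of n] n by (simp add: order_def)
  qed
  have "{Y \<in> ?X. Y = M} = {M}" using MX by blast
  then have "int (card ?X) mod int p = 1" using fixed[OF M] prime_gt_1_nat[OF prime] by simp
  then have "{Y \<in> ?X. Y = M'} \<noteq> {}" using fixed[OF M'] by (metis card.empty of_nat_0 mod_0 zero_neq_one)
  then show ?thesis by auto
qed

text \<open>If \<open>Q\<close> were its own normalizer in \<open>R\<close>, the number of \<open>R\<close>-conjugates of \<open>Q\<close> would be the index of \<open>Q\<close>,
  a multiple of \<open>p\<close>. Under conjugation by \<open>Q\<close> the only fixed conjugate would be \<open>Q\<close> itself, because
  \<open>Q\<close> normalizes \<open>xQx\<^bsup>-1\<^esup>\<close> exactly when \<open>x\<^bsup>-1\<^esup>Qx\<close> normalizes \<open>Q\<close>; this contradicts the congruence.\<close>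

lemma p_subgroup_normalizer_grows:
  assumes Q: "p_subgroup Q" and R: "p_subgroup R" and QR: "Q \<subset> R"
  shows "Q \<subset> {x \<in> R. conj_set G x Q = Q}"
proof -
  let ?N = "{x \<in> R. conj_set G x Q = Q}"
  let ?X = "(\<lambda>h. conj_set G h Q) ` R"
  have sub: "subgroup Q G" "subgroup R G" using Q R by (auto simp: p_subgroup_def)
  have QG: "Q \<subseteq> carrier G" and RG: "R \<subseteq> carrier G" using Q R p_subgroup_subset by auto
  have QN: "Q \<subseteq> ?N" using QR conj_set_self[OF sub(1)] by auto
  have "?N \<noteq> Q"
  proof
    assume N: "?N = Q"
    have fX: "finite ?X" using p_subgroup_finite[OF R] by simp
    have QX: "Q \<in> ?X" using conj_set_one[OF QG] subgroup.one_closed[OF sub(2)] by (metis imageI)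
    obtain m n where m: "card R = p ^ m" and n: "card Q = p ^ n" using Q R by (auto simp: p_subgroup_def)
    interpret R: plain_action "G\<lparr>carrier := R\<rparr>" ?X "conj_set G"
      by (rule conj_orbit_action[OF sub(2) QG sub(2) order_refl])
    interpret Q: plain_action "G\<lparr>carrier := Q\<rparr>" ?X "conj_set G"
      by (rule conj_orbit_action[OF sub(2) QG sub(1)]) (use QR in blast)
    have "orbit (G\<lparr>carrier := R\<rparr>) (conj_set G) Q = ?X" by (auto simp: orbit_def)
    then have index: "card ?X * card Q = p ^ m"
      using R.orbit_stabilizer[OF QX] N m by (simp add: order_def)
    have "card Q < card R" by (rule psubset_card_mono[OF p_subgroup_finite[OF R] QR])
    then have "card ?X \<noteq> 1" using index m by auto
    moreover have "card ?X dvd p ^ m" using index by (metis dvd_triv_left)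
    ultimately have "p dvd card ?X"
      using divides_primepow_nat[OF prime, of "card ?X" m] by (metis dvd_power gr0I power_0)
    then have "int (card {Y \<in> ?X. \<forall>g\<in>Q. conj_set G g Y = Y}) mod int p = 0"
      using Q.p_group_fixed_points[OF fX prime, of n] n by (simp add: order_def flip: zmod_int)
    moreover have "card {Y \<in> ?X. \<forall>g\<in>Q. conj_set G g Y = Y} = 1"
    proof -
      have "Y = Q" if Y: "Y \<in> ?X" "\<forall>g\<in>Q. conj_set G g Y = Y" for Y
      proof -
        obtain x where x: "x \<in> R" "Y = conj_set G x Q" using Y(1) by blast
        have xG: "x \<in> carrier G" using x(1) RG by blast
        have ixR: "inv x \<in> R" by (rule subgroup.m_inv_closed[OF sub(2) x(1)])
        have "inv x \<otimes> q \<otimes> x \<in> Q" if q: "q \<in> Q" for q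
        proof -
          have qG: "q \<in> carrier G" and qR: "q \<in> R" using q QG QR by auto
          have "conj_set G (inv x \<otimes> q \<otimes> x) Q = conj_set G (inv x) (conj_set G q (conj_set G x Q))"
            using xG qG QG by (simp add: conj_set_comp conj_set_closed m_assoc)
          also have "\<dots> = Q" using Y(2) q x(2) conj_set_inv(1)[OF xG QG] by simp
          finally have "inv x \<otimes> q \<otimes> x \<in> ?N"
            using ixR qR x(1) subgroup.m_closed[OF sub(2)] by simp
          then show ?thesis unfolding N .
        qed
        then have "conj_set G (inv x) Q \<subseteq> Q" using xG by (auto simp: conj_set_def)
        then have "conj_set G (inv x) Q = Q"
          using card_subset_eq[OF p_subgroup_finite[OF Q]] card_conj_set[of "inv x" Q] xG QG by simp
        then show ?thesis using x(2) conj_set_inv(2)[OF xG QG] by simp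
      qed
      then have "{Y \<in> ?X. \<forall>g\<in>Q. conj_set G g Y = Y} = {Q}"
        using QX conj_set_self[OF sub(1)] by blast
      then show ?thesis by simp
    qed
    ultimately show False using prime_gt_1_nat[OF prime] by simp
  qed
  then show ?thesis using QN by blast
qed

lemma exists_subgroup_of_order_p:
  assumes A: "subgroup A G" and dvd: "p dvd card A"
  shows "\<exists>Z. p_subgroup Z \<and> Z \<subseteq> A \<and> Z \<noteq> {\<one>}"
proof -
  obtain k where "card A = p * k" using dvd by auto
  then have "order (G\<lparr>carrier := A\<rparr>) = p ^ 1 * k" by (simp add: order_def)
  from sylow_thm[OF prime subgroup_imp_group[OF A] this] subgroup_finite[OF A]
  obtain Z where Z: "subgroup Z (G\<lparr>carrier := A\<rparr>)" "card Z = p ^ 1" by auto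
  have "subgroup Z G" by (rule incl_subgroup[OF A Z(1)])
  moreover have "Z \<subseteq> A" using subgroup.subset[OF Z(1)] by simp
  moreover have "Z \<noteq> {\<one>}" using Z(2) prime_gt_1_nat[OF prime] by auto
  ultimately show ?thesis unfolding p_subgroup_def using Z(2) by blast
qed

end

section \<open>Chains of \<open>p\<close>-subgroups\<close>

lemma chain_sum_empty: "chain_sum ({} :: 'a::order set) = 1"
proof -
  have "chains (\<le>) ({} :: 'a set) = {{}}"
    by (auto simp: chains_def Complete_Partial_Order.chain_def)
  then show ?thesis by (simp add: chain_sum_def)
qed

context finite_group_prime
begin

text \<open>The poset is conically contractible: \<open>P \<le> ZP \<ge> Z\<close>. The map \<open>P \<mapsto> ZP\<close> is a closure operator whose closed
  elements are those containing \<open>Z\<close>.\<close>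

lemma chain_sum_fixed_p_subgroups_eq_0:
  assumes X: "X \<subseteq> carrier G" and Z: "p_subgroup Z" "Z \<noteq> {\<one>}"
    and XZ: "\<And>x. x \<in> X \<Longrightarrow> conj_set G x Z = Z"
    and ZP: "\<And>P z. p_subgroup P \<Longrightarrow> (\<And>x. x \<in> X \<Longrightarrow> conj_set G x P = P) \<Longrightarrow> z \<in> Z \<Longrightarrow> conj_set G z P = P"
  shows "chain_sum {P. p_subgroup P \<and> P \<noteq> {\<one>} \<and> (\<forall>x\<in>X. conj_set G x P = P)} = 0"
proof -
  let ?S = "{P. p_subgroup P \<and> P \<noteq> {\<one>} \<and> (\<forall>x\<in>X. conj_set G x P = P)}"
  let ?f = "\<lambda>P. Z <#> P"
  have finS: "finite ?S"
    by (rule finite_subset[of _ "Pow (carrier G)"]) (use fin in \<open>auto dest: p_subgroup_subset\<close>)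
  have ZG: "Z \<subseteq> carrier G" by (rule p_subgroup_subset[OF Z(1)])
  have subZ: "subgroup Z G" using Z(1) by (simp add: p_subgroup_def)
  have ZZ: "Z <#> Z = Z" by (rule subgroup_mult_id[OF subZ])
  have f: "?f P \<in> ?S" "Z \<subseteq> ?f P" "P \<subseteq> ?f P" if P: "P \<in> ?S" for P
  proof -
    have P': "p_subgroup P" "\<And>x. x \<in> X \<Longrightarrow> conj_set G x P = P" using P by simp_all
    have *: "p_subgroup (?f P)" "Z \<subseteq> ?f P" "P \<subseteq> ?f P"
      using p_subgroup_set_mult[OF Z(1) P'(1) ZP[OF P']] by blast+
    have "conj_set G x (?f P) = ?f P" if x: "x \<in> X" for x
    proof -
      have "x \<in> carrier G" using x X by blast
      from conj_set_mult[OF this ZG p_subgroup_subset[OF P'(1)]] show ?thesis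
        unfolding XZ[OF x] P'(2)[OF x] .
    qed
    moreover have "?f P \<noteq> {\<one>}"
    proof
      assume "?f P = {\<one>}"
      then have "Z \<subseteq> {\<one>}" using *(2) by simp
      then show False using Z(2) subgroup.one_closed[OF subZ] by blast
    qed
    ultimately show "?f P \<in> ?S" "Z \<subseteq> ?f P" "P \<subseteq> ?f P" using * by blast+
  qed
  have idem: "?f (?f P) = ?f P" if "P \<in> ?S" for P
  proof -
    have "P \<subseteq> carrier G" using p_subgroup_subset that by simp
    from set_mult_assoc[OF ZG ZG this] show ?thesis unfolding ZZ by (rule sym)
  qed
  have "chain_sum ?S = chain_sum {P\<in>?S. ?f P = P}"
  proof (rule chain_sum_closure_operator[OF finS])
    show "?f P \<subseteq> ?f R" if "P \<subseteq> R" for P R using that by (rule mono_set_mult[OF order_refl])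
  qed (rule f(1) f(3) idem, assumption)+
  also have "\<dots> = 0"
  proof (rule chain_sum_least[of _ Z])
    show "Z \<in> {P\<in>?S. ?f P = P}" using Z XZ ZZ by simp
    show "Z \<subseteq> P" if P: "P \<in> {P\<in>?S. ?f P = P}" for P
    proof -
      have "P \<in> ?S" "?f P = P" using P by simp_all
      with f(2)[of P] show ?thesis by simp
    qed
    show "finite {P\<in>?S. ?f P = P}" by (rule finite_subset[OF _ finS]) blast
  qed
  finally show ?thesis .
qed

abbreviation normalizer_in :: "'a set \<Rightarrow> 'a set \<Rightarrow> 'a set" where
  "normalizer_in H Q \<equiv> {g \<in> H. conj_set G g Q = Q}"

text \<open>Divided by the order of the normalizer, this is the signed number of orbits of \<open>N\<^sub>H(Q)\<close> on the
  chains of \<open>p\<close>-subgroups of \<open>H\<close> lying strictly above \<open>Q\<close>, by Burnside's lemma.\<close>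

definition normalizer_chain_sum :: "'a set \<Rightarrow> 'a set \<Rightarrow> int" where
  "normalizer_chain_sum H Q =
     (\<Sum>g\<in>normalizer_in H Q. chain_sum {R \<in> p_subgroups_above H Q. conj_set G g R = R})"

text \<open>The map \<open>R \<mapsto> N\<^sub>R(Q)\<close> is an interior operator on the \<open>p\<close>-subgroups strictly above \<open>Q\<close>, as normalizers
  grow, and it commutes with the action of \<open>N\<^sub>H(Q)\<close>. So only subgroups that normalize \<open>Q\<close> matter.\<close>

lemma normalizer_chain_sum_normalizer:
  assumes H: "subgroup H G" and Q: "p_subgroup Q" "Q \<subseteq> H"
  shows "normalizer_chain_sum H Q = normalizer_chain_sum (normalizer_in H Q) Q"
proof -
  let ?N = "normalizer_in H Q"
  have QG: "Q \<subseteq> carrier G" by (rule p_subgroup_subset[OF Q(1)])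
  have HG: "H \<subseteq> carrier G" by (rule subgroup.subset[OF H])
  have N: "subgroup ?N G" by (rule subgroup_normalizer_in[OF H QG])
  have NG: "?N \<subseteq> carrier G" by (rule subgroup.subset[OF N])
  have "chain_sum {R \<in> p_subgroups_above H Q. conj_set G g R = R} =
      chain_sum {R \<in> p_subgroups_above ?N Q. conj_set G g R = R}" if g: "g \<in> ?N" for g
  proof -
    let ?S = "{R \<in> p_subgroups_above H Q. conj_set G g R = R}"
    have gG: "g \<in> carrier G" using g NG by blast
    have gN: "conj_set G g ?N = ?N" by (rule conj_set_self[OF N g])
    have f: "R \<inter> ?N \<in> ?S" if "R \<in> ?S" for R
    proof -
      have R: "p_subgroup R" "R \<subseteq> H" "Q \<subset> R" "conj_set G g R = R"
        using that by (auto simp: p_subgroups_above_def)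
      have "subgroup (R \<inter> ?N) G"
        using R(1) N subgroups_Inter_pair unfolding p_subgroup_def by blast
      then have "p_subgroup (R \<inter> ?N)" by (rule p_subgroup_smaller[OF R(1)]) blast
      moreover have "R \<inter> ?N = normalizer_in R Q" using R(2) by blast
      then have "Q \<subset> R \<inter> ?N" using p_subgroup_normalizer_grows[OF Q(1) R(1,3)] by simp
      moreover have "conj_set G g (R \<inter> ?N) = R \<inter> ?N"
        using conj_set_Int[OF gG p_subgroup_subset[OF R(1)] NG] R(4) gN by simp
      ultimately show ?thesis using R(2) unfolding p_subgroups_above_def by blast
    qed
    have "chain_sum ?S = chain_sum {R \<in> ?S. R \<inter> ?N = R}"
    proof (rule chain_sum_interior_operator)
      show "finite ?S" using finite_p_subgroups_above by simp
    qed (use f in blast)+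
    also have "{R \<in> ?S. R \<inter> ?N = R} = {R \<in> p_subgroups_above ?N Q. conj_set G g R = R}"
      unfolding p_subgroups_above_def by blast
    finally show ?thesis .
  qed
  moreover have "normalizer_in ?N Q = ?N" by blast
  ultimately show ?thesis unfolding normalizer_chain_sum_def by (intro sum.cong) simp_all
qed

text \<open>Chains fixed by \<open>g\<close> are sorted by their least element \<open>R\<close>; exchanging the sums over \<open>g\<close> and \<open>R\<close>
  restricts \<open>g\<close> to the normalizer of \<open>R\<close>. The empty chains account for the term \<open>card H\<close>.\<close>

lemma normalizer_chain_sum_normal:
  assumes H: "subgroup H G" and Q: "p_subgroup Q" "Q \<subseteq> H" and N: "normalizer_in H Q = H"
  shows "normalizer_chain_sum H Q = int (card H) - (\<Sum>R\<in>p_subgroups_above H Q. normalizer_chain_sum H R)"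
proof -
  let ?S = "p_subgroups_above H Q"
  have finH: "finite H" by (rule subgroup_finite[OF H])
  have finS: "finite ?S" by (rule finite_p_subgroups_above)
  have rec: "chain_sum {R\<in>?S. conj_set G g R = R} =
      1 - (\<Sum>R\<in>?S. if conj_set G g R = R then chain_sum {R'\<in>p_subgroups_above H R. conj_set G g R' = R'} else 0)" for g
  proof -
    have "chain_sum {R\<in>?S. conj_set G g R = R} =
      1 - (\<Sum>R\<in>{R\<in>?S. conj_set G g R = R}. chain_sum {R'\<in>{R\<in>?S. conj_set G g R = R}. R \<subset> R'})"
      by (rule chain_sum_by_minimum) (use finS in simp)
    also have "(\<Sum>R\<in>{R\<in>?S. conj_set G g R = R}. chain_sum {R'\<in>{R\<in>?S. conj_set G g R = R}. R \<subset> R'}) =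
      (\<Sum>R\<in>{R\<in>?S. conj_set G g R = R}. chain_sum {R'\<in>p_subgroups_above H R. conj_set G g R' = R'})"
    proof (rule sum.cong[OF refl])
      fix R assume "R \<in> {R\<in>?S. conj_set G g R = R}"
      then have "{R'\<in>{R\<in>?S. conj_set G g R = R}. R \<subset> R'} = {R'\<in>p_subgroups_above H R. conj_set G g R' = R'}"
        unfolding p_subgroups_above_def by blast
      then show "chain_sum {R'\<in>{R\<in>?S. conj_set G g R = R}. R \<subset> R'} =
        chain_sum {R'\<in>p_subgroups_above H R. conj_set G g R' = R'}" by simp
    qed
    also have "\<dots> = (\<Sum>R\<in>?S. if conj_set G g R = R then chain_sum {R'\<in>p_subgroups_above H R. conj_set G g R' = R'} else 0)"
      by (rule sum.inter_filter[OF finS])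
    finally show ?thesis .
  qed
  have "normalizer_chain_sum H Q = (\<Sum>g\<in>H. chain_sum {R\<in>?S. conj_set G g R = R})"
    unfolding normalizer_chain_sum_def N ..
  also have "\<dots> = int (card H) -
      (\<Sum>g\<in>H. \<Sum>R\<in>?S. if conj_set G g R = R then chain_sum {R'\<in>p_subgroups_above H R. conj_set G g R' = R'} else 0)"
    unfolding rec by (simp add: sum_subtractf)
  also have "(\<Sum>g\<in>H. \<Sum>R\<in>?S. if conj_set G g R = R then chain_sum {R'\<in>p_subgroups_above H R. conj_set G g R' = R'} else 0) =
      (\<Sum>R\<in>?S. normalizer_chain_sum H R)"
    unfolding normalizer_chain_sum_def by (subst sum.swap) (simp only: sum.inter_filter[OF finH])
  finally show ?thesis .
qed

lemma sum_card_normalizer_maximal: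
  assumes H: "subgroup H G"
  shows "(\<Sum>M\<in>{M. maximal_p_subgroup H M}. card (normalizer_in H M)) = card H"
proof -
  have "{\<one>} \<subseteq> H" using subgroup.one_closed[OF H] by simp
  then obtain M where M: "maximal_p_subgroup H M" using exists_maximal_p_subgroup[OF p_subgroup_trivial] by blast
  have MG: "M \<subseteq> carrier G" using M p_subgroup_subset by (simp add: maximal_p_subgroup_def)
  let ?X = "(\<lambda>h. conj_set G h M) ` H"
  have X: "{M. maximal_p_subgroup H M} = ?X"
    using maximal_p_subgroups_conjugate[OF H M] maximal_p_subgroup_conj_set[OF H _ M] by blast
  interpret act: plain_action "G\<lparr>carrier := H\<rparr>" ?X "conj_set G"
    by (rule conj_orbit_action[OF H MG H order_refl])
  have "M \<in> ?X" using M X by blast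
  moreover have "orbit (G\<lparr>carrier := H\<rparr>) (conj_set G) M = ?X" by (auto simp: orbit_def)
  ultimately have "?X \<in> orbits (G\<lparr>carrier := H\<rparr>) ?X (conj_set G)"
    unfolding orbits_def by blast
  from act.sum_card_stabilizers[OF _ this] show ?thesis
    using subgroup_finite[OF H] by (simp add: X order_def)
qed

text \<open>Up to the factor \<open>card (normalizer_in H Q)\<close> the sum tests whether \<open>Q\<close> is a maximal \<open>p\<close>-subgroup of \<open>H\<close>.
  If \<open>Q\<close> is not normal in \<open>H\<close>, pass to its normalizer, in which \<open>Q\<close> remains non-maximal because
  normalizers grow. If \<open>Q\<close> is normal and not maximal, then all maximal \<open>p\<close>-subgroups lie strictly above
  \<open>Q\<close>; by induction they alone contribute to the recursion, and as they form one conjugacy class they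
  contribute \<open>card H\<close>, cancelling the empty chains. The first step shrinks \<open>H\<close> and the second enlarges \<open>Q\<close>,
  so the difference of their orders decreases.\<close>

theorem normalizer_chain_sum_eq:
  assumes "subgroup H G" "p_subgroup Q" "Q \<subseteq> H"
  shows "normalizer_chain_sum H Q =
    (if p_subgroups_above H Q = {} then int (card (normalizer_in H Q)) else 0)"
  using assms
proof (induction "card H - card Q" arbitrary: H Q rule: less_induct)
  case less
  note H = less.prems(1) and Q = less.prems(2,3)
  have finH: "finite H" by (rule subgroup_finite[OF H])
  show ?case
  proof (cases "p_subgroups_above H Q = {}")
    case True
    then show ?thesis by (simp add: normalizer_chain_sum_def chain_sum_empty)
  next
    case False
    then obtain R where R: "p_subgroup R" "R \<subseteq> H" "Q \<subset> R" by (auto simp: p_subgroups_above_def)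
    have card_less: "card Q < card H"
      using psubset_card_mono[OF finH] R(2,3) by blast
    show ?thesis
    proof (cases "normalizer_in H Q = H")
      case N: False
      let ?N = "normalizer_in H Q"
      have subN: "subgroup ?N G" by (rule subgroup_normalizer_in[OF H p_subgroup_subset[OF Q(1)]])
      have QN: "Q \<subseteq> ?N" using Q(2) conj_set_self Q(1) by (auto simp: p_subgroup_def)
      have "card ?N < card H" by (rule psubset_card_mono[OF finH]) (use N in blast)
      then have "card ?N - card Q < card H - card Q" using card_less by linarith
      from less.hyps[OF this subN Q(1) QN]
      have IH: "normalizer_chain_sum ?N Q = (if p_subgroups_above ?N Q = {} then int (card (normalizer_in ?N Q)) else 0)" .
      let ?R = "normalizer_in R Q"
      have subR: "subgroup ?R G"
        using subgroup_normalizer_in p_subgroup_subset[OF Q(1)] R(1) by (auto simp: p_subgroup_def)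
      have "p_subgroup ?R" by (rule p_subgroup_smaller[OF R(1) subR]) blast
      moreover have "Q \<subset> ?R" by (rule p_subgroup_normalizer_grows[OF Q(1) R(1,3)])
      moreover have "?R \<subseteq> ?N" using R(2) by blast
      ultimately have "p_subgroups_above ?N Q \<noteq> {}" unfolding p_subgroups_above_def by blast
      then show ?thesis using IH normalizer_chain_sum_normalizer[OF H Q] False by simp
    next
      case N: True
      have IH: "normalizer_chain_sum H P = (if maximal_p_subgroup H P then int (card (normalizer_in H P)) else 0)"
        if P: "P \<in> p_subgroups_above H Q" for P
      proof -
        have P': "p_subgroup P" "P \<subseteq> H" "Q \<subset> P" using P by (auto simp: p_subgroups_above_def)
        have "card Q < card P" by (rule psubset_card_mono[OF p_subgroup_finite[OF P'(1)] P'(3)])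
        then have "card H - card P < card H - card Q" using card_less by linarith
        from less.hyps[OF this H P'(1,2)] show ?thesis using P' by (simp add: maximal_p_subgroup_def)
      qed
      have max: "{P \<in> p_subgroups_above H Q. maximal_p_subgroup H P} = {M. maximal_p_subgroup H M}"
      proof (intro equalityI subsetI)
        fix M assume "M \<in> {M. maximal_p_subgroup H M}"
        then have M: "maximal_p_subgroup H M" by simp
        have "\<forall>g\<in>M. conj_set G g Q = Q" using M N unfolding maximal_p_subgroup_def by blast
        then have "Q \<subseteq> M" using maximal_p_subgroup_absorbs[OF H M Q] by blast
        moreover have "Q \<noteq> M" using M False by (auto simp: maximal_p_subgroup_def)
        ultimately show "M \<in> {P \<in> p_subgroups_above H Q. maximal_p_subgroup H P}"
          using M by (auto simp: maximal_p_subgroup_def p_subgroups_above_def)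
      qed blast
      have "(\<Sum>P\<in>p_subgroups_above H Q. normalizer_chain_sum H P) =
          (\<Sum>P\<in>p_subgroups_above H Q. if maximal_p_subgroup H P then int (card (normalizer_in H P)) else 0)"
        using IH by (rule sum.cong[OF refl])
      also have "\<dots> = (\<Sum>P\<in>{P \<in> p_subgroups_above H Q. maximal_p_subgroup H P}. int (card (normalizer_in H P)))"
        by (rule sum.inter_filter[OF finite_p_subgroups_above, symmetric])
      also have "\<dots> = int (card H)"
        unfolding max using sum_card_normalizer_maximal[OF H] by (simp flip: of_nat_sum)
      finally show ?thesis using normalizer_chain_sum_normal[OF H Q N] False by simp
    qed
  qed
qed

text \<open>The case of the trivial subgroup: the orbit space of the order complex of the poset of nontrivial
  \<open>p\<close>-subgroups has Euler characteristic 1. This is the Euler characteristic form of Webb's conjecture.\<close>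

corollary normalizer_chain_sum_nontrivial_p_subgroups:
  assumes "p dvd order G"
  shows "(\<Sum>g\<in>carrier G. chain_sum {P. p_subgroup P \<and> P \<noteq> {\<one>} \<and> conj_set G g P = P}) = 0"
proof -
  have above: "p_subgroups_above (carrier G) {\<one>} = {P. p_subgroup P \<and> P \<noteq> {\<one>}}"
    using p_subgroup_subset subgroup.one_closed unfolding p_subgroups_above_def p_subgroup_def by blast
  obtain Z where "p_subgroup Z" "Z \<noteq> {\<one>}"
    using exists_subgroup_of_order_p[OF subgroup_self] assms by (auto simp: order_def)
  then have "p_subgroups_above (carrier G) {\<one>} \<noteq> {}" unfolding above by blast
  then have "normalizer_chain_sum (carrier G) {\<one>} = 0"
    using normalizer_chain_sum_eq[OF subgroup_self p_subgroup_trivial] by simp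
  moreover have "normalizer_in (carrier G) {\<one>} = carrier G" by (auto simp: conj_set_def)
  ultimately show ?thesis unfolding normalizer_chain_sum_def above by (simp add: conj_assoc)
qed

end

section \<open>Commuting tuples and the abelian subgroups they generate\<close>

context group
begin

lemma conj_set_conj:
  assumes h: "h \<in> carrier G" and x: "x \<in> carrier G" and P: "P \<subseteq> carrier G"
  shows "conj_set G (h \<otimes> x \<otimes> inv h) (conj_set G h P) = conj_set G h (conj_set G x P)"
proof -
  have "conj_set G (h \<otimes> x \<otimes> inv h) (conj_set G h P) = conj_set G ((h \<otimes> x \<otimes> inv h) \<otimes> h) P"
    using h x P by (simp add: conj_set_comp)
  also have "(h \<otimes> x \<otimes> inv h) \<otimes> h = h \<otimes> x" using h x by (simp add: m_assoc)
  also have "conj_set G (h \<otimes> x) P = conj_set G h (conj_set G x P)"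
    using h x P by (simp add: conj_set_comp)
  finally show ?thesis .
qed

lemma conj_set_generate:
  assumes g: "g \<in> carrier G" and X: "X \<subseteq> carrier G"
  shows "generate G (conj_set G g X) = conj_set G g (generate G X)"
proof -
  have sub: "generate G (conj_set G h Y) \<subseteq> conj_set G h (generate G Y)"
    if h: "h \<in> carrier G" and Y: "Y \<subseteq> carrier G" for h Y
  proof (rule generate_subgroup_incl)
    show "conj_set G h Y \<subseteq> conj_set G h (generate G Y)"
      unfolding conj_set_def by (rule image_mono) (auto intro: generate.incl)
    show "subgroup (conj_set G h (generate G Y)) G"
      by (rule subgroup_conj_set[OF h generate_is_subgroup[OF Y]])
  qed
  have gX: "conj_set G g X \<subseteq> carrier G" by (rule conj_set_closed[OF g X])
  have "generate G (conj_set G (inv g) (conj_set G g X)) \<subseteq> conj_set G (inv g) (generate G (conj_set G g X))"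
    by (rule sub[OF inv_closed[OF g] gX])
  then have "generate G X \<subseteq> conj_set G (inv g) (generate G (conj_set G g X))"
    by (simp only: conj_set_inv(1)[OF g X])
  then have "conj_set G g (generate G X) \<subseteq> conj_set G g (conj_set G (inv g) (generate G (conj_set G g X)))"
    unfolding conj_set_def by (rule image_mono)
  then have "conj_set G g (generate G X) \<subseteq> generate G (conj_set G g X)"
    by (simp only: conj_set_inv(2)[OF g subgroup.subset[OF generate_is_subgroup[OF gX]]])
  then show ?thesis using sub[OF g X] by blast
qed

lemma subgroup_centralizer:
  assumes "x \<in> carrier G"
  shows "subgroup (centralizer G x) G"
proof -
  have "centralizer G x = {g \<in> carrier G. conj_set G g {x} = {x}}"
    using conj_commutes_iff[OF _ assms] by (auto simp: centralizer_def conj_set_def)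
  then show ?thesis using subgroup_normalizer_in[OF subgroup_self, of "{x}"] assms by simp
qed

lemma centralizer_commutes_generate:
  assumes X: "X \<subseteq> carrier G" and g: "g \<in> carrier G" "\<And>x. x \<in> X \<Longrightarrow> g \<otimes> x = x \<otimes> g"
    and a: "a \<in> generate G X"
  shows "g \<otimes> a = a \<otimes> g"
proof -
  have "X \<subseteq> centralizer G g"
    unfolding centralizer_def using X g(2) by force
  from generate_subgroup_incl[OF this subgroup_centralizer[OF g(1)]] a
  have "a \<in> centralizer G g" by blast
  then show ?thesis by (simp add: centralizer_def)
qed

text \<open>The centralizer of a set also centralizes the subgroup it generates; apply this in each argument.\<close>

lemma generate_commuting:
  assumes X: "X \<subseteq> carrier G" and comm: "\<And>x y. x \<in> X \<Longrightarrow> y \<in> X \<Longrightarrow> x \<otimes> y = y \<otimes> x"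
    and ab: "a \<in> generate G X" "b \<in> generate G X"
  shows "a \<otimes> b = b \<otimes> a"
proof (rule centralizer_commutes_generate[OF X _ _ ab(2)])
  show aG: "a \<in> carrier G" using ab(1) generate_incl[OF X] by blast
  show "a \<otimes> x = x \<otimes> a" if x: "x \<in> X" for x
  proof (rule sym, rule centralizer_commutes_generate[OF X _ _ ab(1)])
    show "x \<in> carrier G" using x X by blast
  qed (rule comm[OF x])
qed

lemma comm_group_subgroup_iff:
  assumes "subgroup A G"
  shows "comm_group (G\<lparr>carrier := A\<rparr>) \<longleftrightarrow> (\<forall>a\<in>A. \<forall>b\<in>A. a \<otimes> b = b \<otimes> a)"
proof
  assume "comm_group (G\<lparr>carrier := A\<rparr>)"
  then interpret A: comm_group "G\<lparr>carrier := A\<rparr>" .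
  show "\<forall>a\<in>A. \<forall>b\<in>A. a \<otimes> b = b \<otimes> a" using A.m_comm by simp
next
  assume comm: "\<forall>a\<in>A. \<forall>b\<in>A. a \<otimes> b = b \<otimes> a"
  interpret A: group "G\<lparr>carrier := A\<rparr>" by (rule subgroup_imp_group[OF assms])
  show "comm_group (G\<lparr>carrier := A\<rparr>)" by (rule A.group_comm_groupI) (use comm in simp)
qed

lemma commuting_tuples_subgroup:
  "A \<subseteq> carrier G \<Longrightarrow> commuting_tuples r (G\<lparr>carrier := A\<rparr>) = {xs \<in> commuting_tuples r G. set xs \<subseteq> A}"
  by (auto simp: commuting_tuples_def)

lemma num_generating_tuples_subgroup:
  assumes A: "subgroup A G"
  shows "num_generating_tuples r (G\<lparr>carrier := A\<rparr>) = card {xs \<in> commuting_tuples r G. generate G (set xs) = A}"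
proof -
  have "{xs \<in> commuting_tuples r (G\<lparr>carrier := A\<rparr>). generate (G\<lparr>carrier := A\<rparr>) (set xs) = carrier (G\<lparr>carrier := A\<rparr>)} =
      {xs \<in> commuting_tuples r G. generate G (set xs) = A}"
  proof (intro Collect_cong)
    fix xs
    have "generate (G\<lparr>carrier := A\<rparr>) (set xs) = generate G (set xs)" if "set xs \<subseteq> A"
      by (rule generate_consistent[OF that A])
    moreover have "set xs \<subseteq> generate G (set xs)" by (auto intro: generate.incl)
    ultimately show "(xs \<in> commuting_tuples r (G\<lparr>carrier := A\<rparr>) \<and>
        generate (G\<lparr>carrier := A\<rparr>) (set xs) = carrier (G\<lparr>carrier := A\<rparr>)) \<longleftrightarrow>
        (xs \<in> commuting_tuples r G \<and> generate G (set xs) = A)"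
      unfolding commuting_tuples_subgroup[OF subgroup.subset[OF A]] by auto
  qed
  then show ?thesis unfolding num_generating_tuples_def by simp
qed

lemma map_conj_commuting_tuples:
  assumes g: "g \<in> carrier G" and xs: "xs \<in> commuting_tuples r G"
  shows "map (\<lambda>x. g \<otimes> x \<otimes> inv g) xs \<in> commuting_tuples r G"
proof -
  have xsG: "set xs \<subseteq> carrier G" and comm: "\<And>x y. x \<in> set xs \<Longrightarrow> y \<in> set xs \<Longrightarrow> x \<otimes> y = y \<otimes> x"
    using xs by (auto simp: commuting_tuples_def)
  have "(g \<otimes> x \<otimes> inv g) \<otimes> (g \<otimes> y \<otimes> inv g) = (g \<otimes> y \<otimes> inv g) \<otimes> (g \<otimes> x \<otimes> inv g)"
    if "x \<in> set xs" "y \<in> set xs" for x y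
  proof -
    have "x \<in> carrier G" "y \<in> carrier G" using that xsG by auto
    then show ?thesis using comm[OF that] conj_mult[OF g] by metis
  qed
  then show ?thesis using g xs xsG by (auto simp: commuting_tuples_def)
qed

lemma map_conj_inverse:
  assumes "g \<in> carrier G" "set xs \<subseteq> carrier G"
  shows "map (\<lambda>x. inv g \<otimes> x \<otimes> inv (inv g)) (map (\<lambda>x. g \<otimes> x \<otimes> inv g) xs) = xs"
    "map (\<lambda>x. g \<otimes> x \<otimes> inv g) (map (\<lambda>x. inv g \<otimes> x \<otimes> inv (inv g)) xs) = xs"
proof -
  have "inv g \<otimes> (g \<otimes> x \<otimes> inv g) \<otimes> inv (inv g) = x" "g \<otimes> (inv g \<otimes> x \<otimes> inv (inv g)) \<otimes> inv g = x"
    if "x \<in> set xs" for x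
  proof -
    have "x \<in> carrier G" using that assms(2) by blast
    then show "inv g \<otimes> (g \<otimes> x \<otimes> inv g) \<otimes> inv (inv g) = x" "g \<otimes> (inv g \<otimes> x \<otimes> inv (inv g)) \<otimes> inv g = x"
      using conj_conj[of "inv g" g x] conj_conj[of g "inv g" x] assms(1) by auto
  qed
  then show "map (\<lambda>x. inv g \<otimes> x \<otimes> inv (inv g)) (map (\<lambda>x. g \<otimes> x \<otimes> inv g) xs) = xs"
    "map (\<lambda>x. g \<otimes> x \<otimes> inv g) (map (\<lambda>x. inv g \<otimes> x \<otimes> inv (inv g)) xs) = xs"
    by (simp_all add: map_idI)
qed

lemma set_map_conj: "set (map (\<lambda>x. g \<otimes> x \<otimes> inv g) xs) = conj_set G g (set xs)"
  by (simp add: conj_set_def)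

lemma bij_betw_conj_tuples:
  assumes g: "g \<in> carrier G" and A: "A \<subseteq> carrier G"
  shows "bij_betw (map (\<lambda>x. g \<otimes> x \<otimes> inv g)) {xs \<in> commuting_tuples r G. set xs \<subseteq> A}
    {xs \<in> commuting_tuples r G. set xs \<subseteq> conj_set G g A}"
proof (rule bij_betw_byWitness[where f' = "map (\<lambda>x. inv g \<otimes> x \<otimes> inv (inv g))"])
  have c: "set xs \<subseteq> carrier G" if "xs \<in> commuting_tuples r G" for xs
    using that by (simp add: commuting_tuples_def)
  show "\<forall>xs\<in>{xs \<in> commuting_tuples r G. set xs \<subseteq> A}.
      map (\<lambda>x. inv g \<otimes> x \<otimes> inv (inv g)) (map (\<lambda>x. g \<otimes> x \<otimes> inv g) xs) = xs"
    "\<forall>xs\<in>{xs \<in> commuting_tuples r G. set xs \<subseteq> conj_set G g A}.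
      map (\<lambda>x. g \<otimes> x \<otimes> inv g) (map (\<lambda>x. inv g \<otimes> x \<otimes> inv (inv g)) xs) = xs"
    using map_conj_inverse[OF g c] by blast+
  show "map (\<lambda>x. g \<otimes> x \<otimes> inv g) ` {xs \<in> commuting_tuples r G. set xs \<subseteq> A}
      \<subseteq> {xs \<in> commuting_tuples r G. set xs \<subseteq> conj_set G g A}"
  proof (rule image_subsetI, rule CollectI, rule conjI)
    fix xs assume xs: "xs \<in> {xs \<in> commuting_tuples r G. set xs \<subseteq> A}"
    then show "map (\<lambda>x. g \<otimes> x \<otimes> inv g) xs \<in> commuting_tuples r G"
      using map_conj_commuting_tuples[OF g] by simp
    show "set (map (\<lambda>x. g \<otimes> x \<otimes> inv g) xs) \<subseteq> conj_set G g A"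
      unfolding set_map_conj using xs unfolding conj_set_def by blast
  qed
  show "map (\<lambda>x. inv g \<otimes> x \<otimes> inv (inv g)) ` {xs \<in> commuting_tuples r G. set xs \<subseteq> conj_set G g A}
      \<subseteq> {xs \<in> commuting_tuples r G. set xs \<subseteq> A}"
  proof (rule image_subsetI, rule CollectI, rule conjI)
    fix xs assume xs: "xs \<in> {xs \<in> commuting_tuples r G. set xs \<subseteq> conj_set G g A}"
    then show "map (\<lambda>x. inv g \<otimes> x \<otimes> inv (inv g)) xs \<in> commuting_tuples r G"
      using map_conj_commuting_tuples[OF inv_closed[OF g]] by simp
    have "conj_set G (inv g) (set xs) \<subseteq> conj_set G (inv g) (conj_set G g A)"
      using xs unfolding conj_set_def by blast
    then show "set (map (\<lambda>x. inv g \<otimes> x \<otimes> inv (inv g)) xs) \<subseteq> A"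
      unfolding set_map_conj conj_set_inv(1)[OF g A] .
  qed
qed

lemma num_generating_tuples_conj_set:
  assumes g: "g \<in> carrier G" and A: "subgroup A G"
  shows "num_generating_tuples r (G\<lparr>carrier := conj_set G g A\<rparr>) = num_generating_tuples r (G\<lparr>carrier := A\<rparr>)"
proof -
  have AG: "A \<subseteq> carrier G" by (rule subgroup.subset[OF A])
  let ?c = "map (\<lambda>x. g \<otimes> x \<otimes> inv g)"
  have gen: "generate G (set (?c xs)) = conj_set G g A \<longleftrightarrow> generate G (set xs) = A"
    if "xs \<in> commuting_tuples r G" for xs
  proof -
    have xsG: "set xs \<subseteq> carrier G" using that by (simp add: commuting_tuples_def)
    show ?thesis
      unfolding set_map_conj conj_set_generate[OF g xsG]
      by (rule conj_set_eq_iff[OF g generate_incl[OF xsG] AG])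
  qed
  have in_gen: "generate G (set xs) = B \<Longrightarrow> set xs \<subseteq> B" for xs B
    by (auto intro: generate.incl)
  have "bij_betw ?c {xs \<in> commuting_tuples r G. generate G (set xs) = A}
    {xs \<in> commuting_tuples r G. generate G (set xs) = conj_set G g A}"
  proof (rule bij_betw_subset[OF bij_betw_conj_tuples[OF g AG, of r]])
    show sub: "{xs \<in> commuting_tuples r G. generate G (set xs) = A} \<subseteq> {xs \<in> commuting_tuples r G. set xs \<subseteq> A}"
      using in_gen by blast
    show "?c ` {xs \<in> commuting_tuples r G. generate G (set xs) = A} =
        {xs \<in> commuting_tuples r G. generate G (set xs) = conj_set G g A}"
    proof (intro equalityI subsetI)
      fix ys assume "ys \<in> ?c ` {xs \<in> commuting_tuples r G. generate G (set xs) = A}"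
      then obtain xs where xs: "ys = ?c xs" "xs \<in> commuting_tuples r G" "generate G (set xs) = A" by blast
      show "ys \<in> {xs \<in> commuting_tuples r G. generate G (set xs) = conj_set G g A}"
        using gen[OF xs(2)] xs map_conj_commuting_tuples[OF g xs(2)] by simp
    next
      fix ys assume ys: "ys \<in> {xs \<in> commuting_tuples r G. generate G (set xs) = conj_set G g A}"
      then have "ys \<in> {xs \<in> commuting_tuples r G. set xs \<subseteq> conj_set G g A}" using in_gen by blast
      then obtain xs where xs: "ys = ?c xs" "xs \<in> commuting_tuples r G"
        using bij_betw_imp_surj_on[OF bij_betw_conj_tuples[OF g AG, of r]] by blast
      then show "ys \<in> ?c ` {xs \<in> commuting_tuples r G. generate G (set xs) = A}"
        using gen[OF xs(2)] ys by blast
    qed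
  qed
  from bij_betw_same_card[OF this] show ?thesis
    unfolding num_generating_tuples_subgroup[OF A] num_generating_tuples_subgroup[OF subgroup_conj_set[OF g A]]
    by (rule sym)
qed

lemma conj_classes_eq_orbits:
  assumes "\<And>H. H \<in> \<H> \<Longrightarrow> H \<subseteq> carrier G"
  shows "conj_classes G \<H> = orbits G \<H> (conj_set G)"
proof -
  have "orbit G (conj_action G) H = orbit G (conj_set G) H" if "H \<in> \<H>" for H
    unfolding orbit_def conj_action_eq[OF assms[OF that]] ..
  then have "(orbit G (conj_action G)) ` \<H> = (orbit G (conj_set G)) ` \<H>" by (rule image_cong[OF refl])
  then show ?thesis by (simp only: conj_classes_def orbits_def Setcompr_eq_image)
qed

end

text \<open>A union of conjugacy classes of subgroups. It is meant for the abelian and for the cyclic subgroups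
  of order prime to \<open>p\<close>.\<close>

locale conj_closed_family = group G for G :: "('a, 'm) monoid_scheme" (structure) +
  fixes \<H> :: "'a set set"
  assumes finG: "finite (carrier G)"
    and subgroups: "\<And>H. H \<in> \<H> \<Longrightarrow> subgroup H G"
    and conj_closed: "\<And>g H. g \<in> carrier G \<Longrightarrow> H \<in> \<H> \<Longrightarrow> conj_set G g H \<in> \<H>"
begin

sublocale action: plain_action G \<H> "conj_set G"
proof -
  have "plain_action (G\<lparr>carrier := carrier G\<rparr>) \<H> (conj_set G)"
    by (rule conj_set_plain_action[OF subgroup_self])
      (rule subgroup.subset[OF subgroups], assumption, rule conj_closed)
  then show "plain_action G \<H> (conj_set G)" by simp
qed

lemma classes_eq: "conj_classes G \<H> = orbits G \<H> (conj_set G)"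
  by (rule conj_classes_eq_orbits) (rule subgroup.subset[OF subgroups])

lemma finite_family: "finite \<H>"
  by (rule finite_subset[of _ "Pow (carrier G)"]) (use finG subgroup.subset[OF subgroups] in auto)

lemma card_class_times_normalizer:
  assumes "K \<in> conj_classes G \<H>" "C \<in> K"
  shows "card K * card (normalizer G C) = order G"
proof -
  have C: "C \<in> \<H>" "K = orbit G (conj_set G) C"
    using action.orbit_of_member[of K C] assms unfolding classes_eq by blast+
  show ?thesis
    unfolding C(2) normalizer_eq[OF subgroup.subset[OF subgroups[OF C(1)]]]
    by (rule action.orbit_stabilizer[OF C(1)])
qed

lemma card_normalizer_pos: "C \<in> \<H> \<Longrightarrow> card (normalizer G C) > 0"
  using subgroup.one_closed[OF normalizer_imp_subgroup] subgroup.subset[OF normalizer_imp_subgroup]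
    subgroup.subset[OF subgroups] finG by (metis card_gt_0_iff empty_iff finite_subset)

lemma sum_over_classes:
  fixes f :: "'a set \<Rightarrow> rat"
  assumes inv: "\<And>g H. g \<in> carrier G \<Longrightarrow> H \<in> \<H> \<Longrightarrow> f (conj_set G g H) = f H"
    and rep: "\<And>K. K \<in> conj_classes G \<H> \<Longrightarrow> rep K \<in> K"
  shows "(\<Sum>H\<in>\<H>. f H) = of_nat (order G) * (\<Sum>K\<in>conj_classes G \<H>. f (rep K) / of_nat (card (normalizer G (rep K))))"
proof -
  have "(\<Sum>H\<in>K. f H) = of_nat (order G) * (f (rep K) / of_nat (card (normalizer G (rep K))))"
    if K: "K \<in> conj_classes G \<H>" for K
  proof -
    have C: "rep K \<in> \<H>" "K = orbit G (conj_set G) (rep K)"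
      using action.orbit_of_member[of K "rep K"] K rep[OF K] unfolding classes_eq by blast+
    have "f H = f (rep K)" if "H \<in> K" for H
    proof -
      have "H \<in> orbit G (conj_set G) (rep K)" using that C(2) by simp
      then obtain g where "g \<in> carrier G" "H = conj_set G g (rep K)" unfolding orbit_def by blast
      then show ?thesis using inv C(1) by simp
    qed
    then have "(\<Sum>H\<in>K. f H) = of_nat (card K) * f (rep K)" by simp
    moreover have "(of_nat (card K) * of_nat (card (normalizer G (rep K))) :: rat) = of_nat (order G)"
      using card_class_times_normalizer[OF K rep[OF K]] by (metis of_nat_mult)
    ultimately show ?thesis using card_normalizer_pos[OF C(1)] by (simp add: field_simps)
  qed
  then have "(\<Sum>K\<in>conj_classes G \<H>. \<Sum>H\<in>K. f H) =
      (\<Sum>K\<in>conj_classes G \<H>. of_nat (order G) * (f (rep K) / of_nat (card (normalizer G (rep K)))))"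
    by (rule sum.cong[OF refl])
  then show ?thesis
    using action.sum_by_orbits[OF finite_family, of f] by (simp add: classes_eq sum_distrib_left)
qed

end

section \<open>Fixed points on the poset of \<open>p\<close>-subgroups\<close>

context finite_group_prime
begin

definition fixed_p_subgroups :: "'a set \<Rightarrow> 'a set set" where
  "fixed_p_subgroups X = {P. p_subgroup P \<and> P \<noteq> {\<one>} \<and> (\<forall>x\<in>X. conj_set G x P = P)}"

lemma fixed_points_eq: "fixed_points (nontrivial_p_subgroups G p) (conj_action G) X = fixed_p_subgroups X"
proof -
  have S: "P \<in> nontrivial_p_subgroups G p \<longleftrightarrow> p_subgroup P \<and> P \<noteq> {\<one>}" for P
    by (simp add: nontrivial_p_subgroups_def p_subgroup_def)
  have "(\<forall>g\<in>X. conj_action G g P = P) \<longleftrightarrow> (\<forall>g\<in>X. conj_set G g P = P)" if "p_subgroup P" for P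
    using conj_action_eq[OF p_subgroup_subset[OF that]] by simp
  then show ?thesis
    unfolding fixed_points_def fixed_p_subgroups_def S by blast
qed

lemma fixed_points_fixed_points: "fixed_points (fixed_points S \<phi> X) \<phi> Y = fixed_points S \<phi> (X \<union> Y)"
  by (auto simp: fixed_points_def)

lemma fixed_p_subgroups_Un: "fixed_p_subgroups (X \<union> Y) = fixed_p_subgroups X \<inter> fixed_p_subgroups Y"
  by (auto simp: fixed_p_subgroups_def)

lemma finite_fixed_p_subgroups: "finite (fixed_p_subgroups X)"
  by (rule finite_subset[of _ "Pow (carrier G)"])
    (use fin in \<open>auto simp: fixed_p_subgroups_def dest: p_subgroup_subset\<close>)

lemma fixed_p_subgroups_generate:
  assumes X: "X \<subseteq> carrier G"
  shows "fixed_p_subgroups (generate G X) = fixed_p_subgroups X"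
proof (intro equalityI subsetI)
  fix P assume "P \<in> fixed_p_subgroups (generate G X)"
  then show "P \<in> fixed_p_subgroups X"
    by (auto simp: fixed_p_subgroups_def intro: generate.incl)
next
  fix P assume P: "P \<in> fixed_p_subgroups X"
  then have PG: "P \<subseteq> carrier G" using p_subgroup_subset by (simp add: fixed_p_subgroups_def)
  have "X \<subseteq> normalizer_in (carrier G) P" using P X by (auto simp: fixed_p_subgroups_def)
  from generate_subgroup_incl[OF this subgroup_normalizer_in[OF subgroup_self PG]]
  show "P \<in> fixed_p_subgroups (generate G X)" using P unfolding fixed_p_subgroups_def by blast
qed

lemma fixed_p_subgroups_conj_set:
  assumes g: "g \<in> carrier G" and X: "X \<subseteq> carrier G"
  shows "fixed_p_subgroups (conj_set G g X) = conj_set G g ` fixed_p_subgroups X"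
proof -
  have sub: "conj_set G h ` fixed_p_subgroups Y \<subseteq> fixed_p_subgroups (conj_set G h Y)"
    if h: "h \<in> carrier G" and Y: "Y \<subseteq> carrier G" for h Y
  proof (rule image_subsetI)
    fix P assume P: "P \<in> fixed_p_subgroups Y"
    then have P': "p_subgroup P" "P \<noteq> {\<one>}" "P \<subseteq> carrier G"
      using p_subgroup_subset by (simp_all add: fixed_p_subgroups_def)
    have "conj_set G (h \<otimes> x \<otimes> inv h) (conj_set G h P) = conj_set G h P" if x: "x \<in> Y" for x
    proof -
      have xG: "x \<in> carrier G" using x Y by blast
      show ?thesis
        using conj_set_conj[OF h xG P'(3)] P x by (simp add: fixed_p_subgroups_def)
    qed
    then have "\<forall>y\<in>conj_set G h Y. conj_set G y (conj_set G h P) = conj_set G h P"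
      unfolding conj_set_def[of G h Y] by blast
    moreover have "conj_set G h P \<noteq> {\<one>}"
    proof
      assume "conj_set G h P = {\<one>}"
      then have "conj_set G h P = conj_set G h {\<one>}" using h by (simp add: conj_set_def)
      then show False using conj_set_eq_iff[OF h P'(3), of "{\<one>}"] P'(2) by simp
    qed
    ultimately show "conj_set G h P \<in> fixed_p_subgroups (conj_set G h Y)"
      using p_subgroup_conj_set[OF h P'(1)] by (simp add: fixed_p_subgroups_def)
  qed
  have "P \<in> conj_set G g ` fixed_p_subgroups X" if P: "P \<in> fixed_p_subgroups (conj_set G g X)" for P
  proof -
    have "conj_set G (inv g) P \<in> fixed_p_subgroups X"
      using sub[OF inv_closed[OF g] conj_set_closed[OF g X]] P unfolding conj_set_inv(1)[OF g X] by blast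
    moreover have "P \<subseteq> carrier G" using P p_subgroup_subset by (simp add: fixed_p_subgroups_def)
    then have "P = conj_set G g (conj_set G (inv g) P)" by (rule conj_set_inv(2)[OF g, symmetric])
    ultimately show ?thesis by (rule rev_image_eqI)
  qed
  then show ?thesis using sub[OF g X] by blast
qed

lemma reduced_euler_char_fixed:
  "reduced_euler_char (fixed_p_subgroups X) = - chain_sum (fixed_p_subgroups X)"
  by (rule reduced_euler_char_eq[OF finite_fixed_p_subgroups])

lemma reduced_euler_char_fixed_conj_set:
  assumes g: "g \<in> carrier G" and X: "X \<subseteq> carrier G"
  shows "reduced_euler_char (fixed_p_subgroups (conj_set G g X)) = reduced_euler_char (fixed_p_subgroups X)"
proof -
  have c: "P \<subseteq> carrier G" if "P \<in> fixed_p_subgroups X" for P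
    using that p_subgroup_subset by (simp add: fixed_p_subgroups_def)
  have "chain_sum (conj_set G g ` fixed_p_subgroups X) = chain_sum (fixed_p_subgroups X)"
  proof (rule chain_sum_image)
    show "inj_on (conj_set G g) (fixed_p_subgroups X)"
      by (rule inj_onI) (use conj_set_eq_iff[OF g c c] in blast)
  qed (rule conj_set_subset_iff[OF g c c])
  then show ?thesis
    unfolding reduced_euler_char_fixed by (simp only: fixed_p_subgroups_conj_set[OF g X])
qed

text \<open>The abelian subgroup generated by \<open>X\<close> contains a nontrivial \<open>p\<close>-subgroup \<open>Z\<close>. It is centralized by \<open>X\<close>
  and normalizes every \<open>p\<close>-subgroup that \<open>X\<close> normalizes, so the fixed points contract onto \<open>Z\<close>.\<close>

lemma reduced_euler_char_fixed_p_singular: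
  assumes X: "X \<subseteq> carrier G" and comm: "\<And>x y. x \<in> X \<Longrightarrow> y \<in> X \<Longrightarrow> x \<otimes> y = y \<otimes> x"
    and dvd: "p dvd card (generate G X)"
  shows "reduced_euler_char (fixed_p_subgroups X) = 0"
proof -
  obtain Z where Z: "p_subgroup Z" "Z \<subseteq> generate G X" "Z \<noteq> {\<one>}"
    using exists_subgroup_of_order_p[OF generate_is_subgroup[OF X] dvd] by blast
  have "chain_sum {P. p_subgroup P \<and> P \<noteq> {\<one>} \<and> (\<forall>x\<in>X. conj_set G x P = P)} = 0"
  proof (rule chain_sum_fixed_p_subgroups_eq_0[OF X Z(1,3)])
    show "conj_set G x Z = Z" if x: "x \<in> X" for x
    proof -
      have xG: "x \<in> carrier G" using x X by blast
      have xg: "x \<in> generate G X" using x by (rule generate.incl)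
      have "x \<otimes> z \<otimes> inv x = z" if z: "z \<in> Z" for z
      proof -
        have "z \<in> carrier G" using z p_subgroup_subset[OF Z(1)] by blast
        then show ?thesis
          using conj_commutes_iff[OF xG] generate_commuting[OF X comm xg] z Z(2) by blast
      qed
      then show ?thesis unfolding conj_set_def by simp
    qed
    show "conj_set G z P = P"
      if P: "p_subgroup P" "\<And>x. x \<in> X \<Longrightarrow> conj_set G x P = P" and z: "z \<in> Z" for P z
    proof (cases "P = {\<one>}")
      case True
      then show ?thesis using z p_subgroup_subset[OF Z(1)] by (auto simp: conj_set_def)
    next
      case False
      then have "P \<in> fixed_p_subgroups X" using P by (simp add: fixed_p_subgroups_def)
      then have "P \<in> fixed_p_subgroups (generate G X)" unfolding fixed_p_subgroups_generate[OF X] .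
      then show ?thesis using z Z(2) unfolding fixed_p_subgroups_def by blast
    qed
  qed
  then show ?thesis unfolding reduced_euler_char_fixed by (simp add: fixed_p_subgroups_def)
qed

section \<open>Equivariant reduced Euler characteristics\<close>

lemma finite_commuting_tuples: "finite (commuting_tuples r G)"
  by (rule finite_subset[OF _ finite_lists_length_eq[OF fin, of r]]) (auto simp: commuting_tuples_def)

lemma commuting_tupleD:
  assumes "xs \<in> commuting_tuples r G"
  shows "set xs \<subseteq> carrier G" "\<And>x y. x \<in> set xs \<Longrightarrow> y \<in> set xs \<Longrightarrow> x \<otimes> y = y \<otimes> x"
  using assms by (auto simp: commuting_tuples_def)

lemma prime_dvd_iff_not_coprime: "coprime n p \<longleftrightarrow> \<not> p dvd n"
  using prime by (metis coprime_commute prime_imp_coprime coprime_absorb_left not_prime_unit)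

text \<open>The fixed points of a tuple depend only on the abelian subgroup it generates, and subgroups whose order
  is divisible by \<open>p\<close> contribute nothing.\<close>

lemma sum_commuting_tuples_by_generated_subgroup:
  "(\<Sum>xs\<in>commuting_tuples r G. reduced_euler_char (fixed_p_subgroups (set xs))) =
   (\<Sum>A\<in>abelian_p'_subgroups G p. reduced_euler_char (fixed_p_subgroups A) * int (num_generating_tuples r (G\<lparr>carrier := A\<rparr>)))"
proof -
  let ?T = "commuting_tuples r G" and ?A = "abelian_p'_subgroups G p"
  let ?T' = "{xs \<in> ?T. coprime (card (generate G (set xs))) p}"
  have "finite ?A"
    by (rule finite_subset[of _ "Pow (carrier G)"]) (use fin in \<open>auto simp: abelian_p'_subgroups_def dest: subgroup.subset\<close>)
  have "(\<Sum>xs\<in>?T. reduced_euler_char (fixed_p_subgroups (set xs))) =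
      (\<Sum>xs\<in>?T'. reduced_euler_char (fixed_p_subgroups (set xs)))"
  proof (rule sum.mono_neutral_right[OF finite_commuting_tuples])
    show "\<forall>xs\<in>?T - ?T'. reduced_euler_char (fixed_p_subgroups (set xs)) = 0"
    proof
      fix xs assume "xs \<in> ?T - ?T'"
      then have xs: "xs \<in> ?T" "p dvd card (generate G (set xs))" using prime_dvd_iff_not_coprime by auto
      show "reduced_euler_char (fixed_p_subgroups (set xs)) = 0"
        by (rule reduced_euler_char_fixed_p_singular[OF commuting_tupleD[OF xs(1)] xs(2)])
    qed
  qed blast
  also have "\<dots> = (\<Sum>A\<in>?A. \<Sum>xs\<in>{xs \<in> ?T'. generate G (set xs) = A}. reduced_euler_char (fixed_p_subgroups (set xs)))"
  proof (rule sum.group[symmetric])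
    show "finite ?T'" using finite_commuting_tuples by simp
    show "finite ?A" by fact
    show "(\<lambda>xs. generate G (set xs)) ` ?T' \<subseteq> ?A"
    proof (rule image_subsetI)
      fix xs assume xs: "xs \<in> ?T'"
      then have xs': "xs \<in> ?T" by simp
      note D = commuting_tupleD[OF xs']
      have sub: "subgroup (generate G (set xs)) G" by (rule generate_is_subgroup[OF D(1)])
      moreover have "comm_group (G\<lparr>carrier := generate G (set xs)\<rparr>)"
        unfolding comm_group_subgroup_iff[OF sub] using generate_commuting[OF D] by blast
      ultimately show "generate G (set xs) \<in> ?A" using xs by (simp add: abelian_p'_subgroups_def)
    qed
  qed
  also have "\<dots> = (\<Sum>A\<in>?A. reduced_euler_char (fixed_p_subgroups A) * int (num_generating_tuples r (G\<lparr>carrier := A\<rparr>)))"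
  proof (rule sum.cong[OF refl])
    fix A assume "A \<in> ?A"
    then have A: "subgroup A G" "coprime (card A) p" by (simp_all add: abelian_p'_subgroups_def)
    have eq: "{xs \<in> ?T'. generate G (set xs) = A} = {xs \<in> ?T. generate G (set xs) = A}"
      using A(2) by blast
    have "reduced_euler_char (fixed_p_subgroups (set xs)) = reduced_euler_char (fixed_p_subgroups A)"
      if "xs \<in> {xs \<in> ?T. generate G (set xs) = A}" for xs
    proof -
      have xs: "xs \<in> ?T" "generate G (set xs) = A" using that by simp_all
      show ?thesis
        using fixed_p_subgroups_generate[OF commuting_tupleD(1)[OF xs(1)]] unfolding xs(2) by simp
    qed
    then have "(\<Sum>xs\<in>{xs \<in> ?T. generate G (set xs) = A}. reduced_euler_char (fixed_p_subgroups (set xs))) =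
        (\<Sum>xs\<in>{xs \<in> ?T. generate G (set xs) = A}. reduced_euler_char (fixed_p_subgroups A))"
      by (rule sum.cong[OF refl])
    then show "(\<Sum>xs\<in>{xs \<in> ?T'. generate G (set xs) = A}. reduced_euler_char (fixed_p_subgroups (set xs))) =
        reduced_euler_char (fixed_p_subgroups A) * int (num_generating_tuples r (G\<lparr>carrier := A\<rparr>))"
      unfolding eq num_generating_tuples_subgroup[OF A(1)] by simp
  qed
  finally show ?thesis .
qed

lemma equiv_reduced_euler_char_abelian:
  "equiv_reduced_euler_char r (nontrivial_p_subgroups G p) (conj_action G) G =
    1 / of_nat (order G) * (\<Sum>A\<in>abelian_p'_subgroups G p.
      of_int (reduced_euler_char (fixed_p_subgroups A)) * of_nat (num_generating_tuples r (G\<lparr>carrier := A\<rparr>)))"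
proof -
  have "(\<Sum>xs\<in>commuting_tuples r G. of_int (reduced_euler_char (fixed_p_subgroups (set xs))) :: rat) =
      of_int (\<Sum>xs\<in>commuting_tuples r G. reduced_euler_char (fixed_p_subgroups (set xs)))"
    by simp
  then show ?thesis
    unfolding equiv_reduced_euler_char_def fixed_points_eq sum_commuting_tuples_by_generated_subgroup by simp
qed

lemma abelian_p'_subgroups_conj_closed: "conj_closed_family G (abelian_p'_subgroups G p)"
proof (intro conj_closed_family.intro conj_closed_family_axioms.intro)
  show "group G" by (rule is_group)
  show "finite (carrier G)" by (rule fin)
  show "subgroup H G" if "H \<in> abelian_p'_subgroups G p" for H
    using that by (simp add: abelian_p'_subgroups_def)
  show "conj_set G g H \<in> abelian_p'_subgroups G p"
    if g: "g \<in> carrier G" and "H \<in> abelian_p'_subgroups G p" for g H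
  proof -
    have H: "subgroup H G" "\<forall>a\<in>H. \<forall>b\<in>H. a \<otimes> b = b \<otimes> a" "coprime (card H) p"
      using that(2) comm_group_subgroup_iff by (auto simp: abelian_p'_subgroups_def)
    have HG: "H \<subseteq> carrier G" by (rule subgroup.subset[OF H(1)])
    have "(g \<otimes> a \<otimes> inv g) \<otimes> (g \<otimes> b \<otimes> inv g) = (g \<otimes> b \<otimes> inv g) \<otimes> (g \<otimes> a \<otimes> inv g)"
      if "a \<in> H" "b \<in> H" for a b
    proof -
      have "a \<in> carrier G" "b \<in> carrier G" using that HG by auto
      moreover have "a \<otimes> b = b \<otimes> a" using H(2) that by blast
      ultimately show ?thesis using conj_mult[OF g] by metis
    qed
    then have "comm_group (G\<lparr>carrier := conj_set G g H\<rparr>)"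
      unfolding comm_group_subgroup_iff[OF subgroup_conj_set[OF g H(1)]] unfolding conj_set_def by blast
    then show ?thesis
      using subgroup_conj_set[OF g H(1)] H(3) card_conj_set[OF g HG] by (simp add: abelian_p'_subgroups_def)
  qed
qed

lemma equiv_reduced_euler_char_abelian_classes:
  assumes rep: "\<And>K. K \<in> conj_classes G (abelian_p'_subgroups G p) \<Longrightarrow> rep K \<in> K"
  shows "equiv_reduced_euler_char r (nontrivial_p_subgroups G p) (conj_action G) G =
    (\<Sum>K\<in>conj_classes G (abelian_p'_subgroups G p). of_int (reduced_euler_char (fixed_p_subgroups (rep K))) *
      (of_nat (num_generating_tuples r (G\<lparr>carrier := rep K\<rparr>)) / of_nat (card (normalizer G (rep K)))))"
proof -
  interpret A: conj_closed_family G "abelian_p'_subgroups G p" by (rule abelian_p'_subgroups_conj_closed)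
  let ?f = "\<lambda>A. of_int (reduced_euler_char (fixed_p_subgroups A)) * of_nat (num_generating_tuples r (G\<lparr>carrier := A\<rparr>)) :: rat"
  have "?f (conj_set G g H) = ?f H" if "g \<in> carrier G" "H \<in> abelian_p'_subgroups G p" for g H
    using reduced_euler_char_fixed_conj_set[OF that(1) subgroup.subset[OF A.subgroups[OF that(2)]]]
      num_generating_tuples_conj_set[OF that(1) A.subgroups[OF that(2)], of r] by simp
  from A.sum_over_classes[of ?f, OF this rep]
  have "(\<Sum>A\<in>abelian_p'_subgroups G p. ?f A) =
    of_nat (order G) * (\<Sum>K\<in>conj_classes G (abelian_p'_subgroups G p). ?f (rep K) / of_nat (card (normalizer G (rep K))))" .
  moreover have "order G > 0" using fin order_gt_0_iff_finite by blast
  ultimately show ?thesis unfolding equiv_reduced_euler_char_abelian by simp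
qed

end

section \<open>Integrality\<close>

lemma (in group) commuting_tuples_Suc:
  assumes "A \<subseteq> carrier G"
  shows "{ys \<in> commuting_tuples (Suc s) G. set ys \<subseteq> A} =
    (\<lambda>(zs, y). y # zs) ` (SIGMA zs:{zs \<in> commuting_tuples s G. set zs \<subseteq> A}. {y \<in> A. \<forall>z\<in>set zs. y \<otimes> z = z \<otimes> y})"
    (is "?L = ?f ` ?R")
proof (intro equalityI subsetI)
  fix ys assume ys: "ys \<in> ?L"
  then have D: "length ys = Suc s" "set ys \<subseteq> carrier G" "\<forall>u\<in>set ys. \<forall>v\<in>set ys. u \<otimes> v = v \<otimes> u" "set ys \<subseteq> A"
    unfolding commuting_tuples_def mem_Collect_eq by blast+
  obtain y zs where yz: "ys = y # zs" using D(1) by (cases ys) simp_all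
  have zs: "length zs = s" using D(1) by (simp add: yz)
  have set: "set zs \<subseteq> set ys" "y \<in> set ys" by (auto simp only: yz list.set)
  have "zs \<in> commuting_tuples s G"
    unfolding commuting_tuples_def mem_Collect_eq using zs D(2,3) set by blast
  then have "(zs, y) \<in> ?R" using D(3,4) set by blast
  then show "ys \<in> ?f ` ?R" by (rule rev_image_eqI) (simp add: yz)
next
  fix ys assume "ys \<in> ?f ` ?R"
  then obtain v where v: "v \<in> ?R" "ys = ?f v" by blast
  obtain zs y where zy: "v = (zs, y)" by (cases v)
  have y: "zs \<in> commuting_tuples s G" "set zs \<subseteq> A" "y \<in> A" "\<And>z. z \<in> set zs \<Longrightarrow> y \<otimes> z = z \<otimes> y"
    using v(1) unfolding zy by blast+
  have ys: "ys = y # zs" using v(2) by (simp add: zy)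
  have D: "length zs = s" "set zs \<subseteq> carrier G" "\<forall>u\<in>set zs. \<forall>v\<in>set zs. u \<otimes> v = v \<otimes> u"
    using y(1) unfolding commuting_tuples_def mem_Collect_eq by blast+
  have set: "set ys = insert y (set zs)" "length ys = Suc s" using D(1) by (simp_all add: ys)
  have "u \<otimes> v = v \<otimes> u" if uv: "u \<in> set ys" "v \<in> set ys" for u v
  proof -
    consider "u = y" "v = y" | "u = y" "v \<in> set zs" | "u \<in> set zs" "v = y" | "u \<in> set zs" "v \<in> set zs"
      using uv unfolding set(1) by blast
    then show ?thesis
    proof cases
      case 2
      show ?thesis unfolding 2(1) by (rule y(4)[OF 2(2)])
    next
      case 3
      show ?thesis unfolding 3(2) by (rule y(4)[OF 3(1), symmetric])
    next
      case 4
      show ?thesis by (rule D(3)[rule_format, OF 4])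
    qed simp
  qed
  moreover have "set ys \<subseteq> A" unfolding set(1) using y(2,3) by simp
  moreover from this have "set ys \<subseteq> carrier G" using assms by (rule subset_trans)
  ultimately show "ys \<in> ?L"
    unfolding commuting_tuples_def mem_Collect_eq using set(2) by (intro conjI ballI)
qed

text \<open>Conjugation preserves cardinalities, and a chain has at most one member of each size.\<close>

lemma (in group) chain_stabilizer:
  assumes fin: "finite (carrier G)" and c: "Complete_Partial_Order.chain (\<subseteq>) c" "\<And>P. P \<in> c \<Longrightarrow> P \<subseteq> carrier G"
    and h: "h \<in> carrier G" and eq: "conj_set G h ` c = c" and P: "P \<in> c"
  shows "conj_set G h P = P"
proof -
  have hP: "conj_set G h P \<in> c" using P eq by blast
  have f: "finite P" "finite (conj_set G h P)" using c(2)[OF P] c(2)[OF hP] fin finite_subset by blast+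
  have card: "card (conj_set G h P) = card P" by (rule card_conj_set[OF h c(2)[OF P]])
  from chainD[OF c(1) P hP] show ?thesis
  proof
    assume "P \<subseteq> conj_set G h P"
    from card_subset_eq[OF f(2) this] card show ?thesis by simp
  next
    assume "conj_set G h P \<subseteq> P"
    from card_subset_eq[OF f(1) this card] show ?thesis .
  qed
qed

text \<open>The group \<open>H\<close> acts on pairs \<open>(zs, c)\<close> consisting of a commuting \<open>s\<close>-tuple \<open>zs\<close> in \<open>H\<close> and a chain \<open>c\<close> fixed by
  \<open>zs\<close>. Removing the first entry \<open>y\<close> of the tuple \<open>y # zs\<close> turns the sum into a signed count of such
  pairs in which the pair is weighted by the number of admissible \<open>y\<close>, and these \<open>y\<close> form exactly its
  stabilizer. So the sum is the group order times a signed number of orbits.\<close>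

lemma (in group) order_dvd_sum_fixed_chain_sums:
  assumes fin: "finite (carrier G)" and H: "subgroup H G"
    and T: "finite T" "\<And>P. P \<in> T \<Longrightarrow> P \<subseteq> carrier G" "\<And>h P. h \<in> H \<Longrightarrow> P \<in> T \<Longrightarrow> conj_set G h P \<in> T"
  shows "int (card H) dvd
    (\<Sum>ys\<in>{ys \<in> commuting_tuples (Suc s) G. set ys \<subseteq> H}. chain_sum {P\<in>T. \<forall>y\<in>set ys. conj_set G y P = P})"
proof -
  have HG: "H \<subseteq> carrier G" by (rule subgroup.subset[OF H])
  have finH: "finite H" using HG fin by (rule finite_subset)
  define L where "L = {zs \<in> commuting_tuples s G. set zs \<subseteq> H}"
  define Y where "Y zs = {y \<in> H. \<forall>z\<in>set zs. y \<otimes> z = z \<otimes> y}" for zs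
  define C where "C zs = {c \<in> chains (\<subseteq>) T. \<forall>z\<in>set zs. \<forall>P\<in>c. conj_set G z P = P}" for zs :: "'a list"
  define E where "E = (SIGMA zs:L. C zs)"
  define act where "act h = (\<lambda>(zs, c). (map (\<lambda>x. h \<otimes> x \<otimes> inv h) zs, conj_set G h ` c))" for h
  have finL: "finite L"
    by (rule finite_subset[OF _ finite_lists_length_eq[OF finH, of s]]) (auto simp: L_def commuting_tuples_def)
  have finY: "finite (Y zs)" for zs using finH by (simp add: Y_def)
  have finC: "finite (C zs)" for zs using finite_chains[OF T(1)] by (simp add: C_def)
  have finE: "finite E" unfolding E_def using finL finC by blast
  have C_D: "c \<subseteq> T" "Complete_Partial_Order.chain (\<subseteq>) c" "\<And>P. P \<in> c \<Longrightarrow> P \<subseteq> carrier G"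
    "\<And>z P. z \<in> set zs \<Longrightarrow> P \<in> c \<Longrightarrow> conj_set G z P = P" if "c \<in> C zs" for c zs
    using that T(2) by (auto simp: C_def chains_def)
  interpret act: plain_action "G\<lparr>carrier := H\<rparr>" E act
  proof (intro plain_action.intro plain_action_axioms.intro subgroup_imp_group[OF H])
    fix h e assume h: "h \<in> carrier (G\<lparr>carrier := H\<rparr>)" and e: "e \<in> E"
    obtain zs c where ez: "e = (zs, c)" by (cases e)
    have zs: "zs \<in> L" and c: "c \<in> C zs" using e by (simp_all add: E_def ez)
    have hH: "h \<in> H" and hG: "h \<in> carrier G" using h HG by auto
    have zsG: "set zs \<subseteq> carrier G" using zs HG by (auto simp: L_def)
    have "conj_set G h (set zs) \<subseteq> conj_set G h H"
      using zs unfolding L_def conj_set_def by blast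
    then have "conj_set G h (set zs) \<subseteq> H" unfolding conj_set_self[OF H hH] .
    then have "map (\<lambda>x. h \<otimes> x \<otimes> inv h) zs \<in> L"
      using map_conj_commuting_tuples[OF hG] zs unfolding L_def set_map_conj[symmetric] by blast
    moreover have "conj_set G h ` c \<in> C (map (\<lambda>x. h \<otimes> x \<otimes> inv h) zs)"
    proof -
      have "Complete_Partial_Order.chain (\<subseteq>) (conj_set G h ` c)"
        by (rule chain_imageI[OF C_D(2)[OF c]]) (simp only: conj_set_subset_iff[OF hG C_D(3)[OF c] C_D(3)[OF c]])
      moreover have "conj_set G h ` c \<subseteq> T" using C_D(1)[OF c] T(3)[OF hH] by blast
      moreover have "conj_set G (h \<otimes> z \<otimes> inv h) (conj_set G h P) = conj_set G h P"
        if z: "z \<in> set zs" and P: "P \<in> c" for z P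
      proof -
        have "z \<in> carrier G" using z zsG by blast
        then show ?thesis using conj_set_conj[OF hG _ C_D(3)[OF c P]] C_D(4)[OF c z P] by simp
      qed
      ultimately show ?thesis by (simp add: C_def chains_def)
    qed
    ultimately show "act h e \<in> E" by (simp add: act_def E_def ez)
  next
    fix e assume e: "e \<in> E"
    obtain zs c where ez: "e = (zs, c)" by (cases e)
    have zs: "zs \<in> L" and c: "c \<in> C zs" using e by (simp_all add: E_def ez)
    have "map (\<lambda>x. \<one> \<otimes> x \<otimes> inv \<one>) zs = zs"
      by (rule map_idI) (use zs HG in \<open>auto simp: L_def\<close>)
    moreover have "conj_set G \<one> ` c = (\<lambda>P. P) ` c"
      by (rule image_cong[OF refl]) (rule conj_set_one[OF C_D(3)[OF c]])
    ultimately show "act \<one>\<^bsub>G\<lparr>carrier := H\<rparr>\<^esub> e = e" by (simp add: act_def ez)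
  next
    fix g h e assume g: "g \<in> carrier (G\<lparr>carrier := H\<rparr>)" and h: "h \<in> carrier (G\<lparr>carrier := H\<rparr>)" and e: "e \<in> E"
    obtain zs c where ez: "e = (zs, c)" by (cases e)
    have zs: "zs \<in> L" and c: "c \<in> C zs" using e by (simp_all add: E_def ez)
    have gh: "g \<in> carrier G" "h \<in> carrier G" using g h HG by auto
    have "map (\<lambda>x. g \<otimes> h \<otimes> x \<otimes> inv (g \<otimes> h)) zs = map (\<lambda>x. g \<otimes> x \<otimes> inv g) (map (\<lambda>x. h \<otimes> x \<otimes> inv h) zs)"
      unfolding map_map comp_def
      by (rule map_cong[OF refl]) (rule conj_conj[OF gh], use zs HG in \<open>auto simp: L_def\<close>)
    moreover have "conj_set G (g \<otimes> h) ` c = conj_set G g ` (conj_set G h ` c)"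
      unfolding image_image
      by (rule image_cong[OF refl]) (rule conj_set_comp[OF gh C_D(3)[OF c]])
    ultimately show "act (g \<otimes>\<^bsub>G\<lparr>carrier := H\<rparr>\<^esub> h) e = act g (act h e)" by (simp add: act_def ez)
  qed
  have stab: "{h \<in> carrier (G\<lparr>carrier := H\<rparr>). act h e = e} = {y \<in> Y (fst e). \<forall>P\<in>snd e. conj_set G y P = P}"
    if e: "e \<in> E" for e
  proof -
    obtain zs c where ez: "e = (zs, c)" by (cases e)
    have zs: "zs \<in> L" and c: "c \<in> C zs" using e by (simp_all add: E_def ez)
    have "act h e = e \<longleftrightarrow> (\<forall>z\<in>set zs. h \<otimes> z = z \<otimes> h) \<and> (\<forall>P\<in>c. conj_set G h P = P)" if h: "h \<in> H" for h
    proof -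
      have hG: "h \<in> carrier G" using h HG by blast
      have "map (\<lambda>x. h \<otimes> x \<otimes> inv h) zs = zs \<longleftrightarrow> map (\<lambda>x. h \<otimes> x \<otimes> inv h) zs = map (\<lambda>x. x) zs" by simp
      also have "\<dots> \<longleftrightarrow> (\<forall>z\<in>set zs. h \<otimes> z \<otimes> inv h = z)" by (rule map_eq_conv)
      also have "\<dots> \<longleftrightarrow> (\<forall>z\<in>set zs. h \<otimes> z = z \<otimes> h)"
        by (rule ball_cong[OF refl]) (rule conj_commutes_iff[OF hG], use zs HG in \<open>auto simp: L_def\<close>)
      finally have 1: "map (\<lambda>x. h \<otimes> x \<otimes> inv h) zs = zs \<longleftrightarrow> (\<forall>z\<in>set zs. h \<otimes> z = z \<otimes> h)" .
      have 2: "conj_set G h ` c = c \<longleftrightarrow> (\<forall>P\<in>c. conj_set G h P = P)"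
      proof
        assume "conj_set G h ` c = c"
        then show "\<forall>P\<in>c. conj_set G h P = P"
          using chain_stabilizer[OF fin C_D(2,3)[OF c] hG] by blast
      next
        assume "\<forall>P\<in>c. conj_set G h P = P"
        then have "conj_set G h ` c = (\<lambda>P. P) ` c" by (intro image_cong) simp_all
        then show "conj_set G h ` c = c" by simp
      qed
      show ?thesis by (simp add: act_def ez 1 2)
    qed
    then have "{h \<in> H. act h e = e} = {h \<in> H. (\<forall>z\<in>set zs. h \<otimes> z = z \<otimes> h) \<and> (\<forall>P\<in>c. conj_set G h P = P)}" by blast
    then show ?thesis by (simp add: Y_def ez conj_assoc)
  qed
  have w_inv: "(-1) ^ card (snd (act h e)) = ((-1) ^ card (snd e) :: int)"
    if h: "h \<in> carrier (G\<lparr>carrier := H\<rparr>)" and e: "e \<in> E" for h e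
  proof -
    obtain zs c where ez: "e = (zs, c)" by (cases e)
    have c: "c \<in> C zs" using e by (simp add: E_def ez)
    have hG: "h \<in> carrier G" using h HG by auto
    have "inj_on (conj_set G h) c"
      by (rule inj_onI) (use conj_set_eq_iff[OF hG C_D(3)[OF c] C_D(3)[OF c]] in blast)
    then show ?thesis by (simp add: act_def ez card_image)
  qed
  have inj: "inj_on (\<lambda>(zs, y). y # zs) X" for X :: "('a list \<times> 'a) set"
    by (rule inj_onI) (simp add: case_prod_unfold prod_eq_iff)
  have "(\<Sum>ys\<in>{ys \<in> commuting_tuples (Suc s) G. set ys \<subseteq> H}. chain_sum {P\<in>T. \<forall>y\<in>set ys. conj_set G y P = P}) =
      (\<Sum>(zs, y)\<in>(SIGMA zs:L. Y zs). chain_sum {P\<in>T. \<forall>y\<in>set (y # zs). conj_set G y P = P})"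
    unfolding commuting_tuples_Suc[OF HG] L_def[symmetric] Y_def[symmetric] sum.reindex[OF inj]
    by (simp only: comp_def case_prod_unfold)
  also have "\<dots> = (\<Sum>zs\<in>L. \<Sum>y\<in>Y zs. chain_sum {P\<in>T. \<forall>y\<in>set (y # zs). conj_set G y P = P})"
    by (rule sum.Sigma[symmetric]) (use finL finY in auto)
  also have "\<dots> = (\<Sum>zs\<in>L. \<Sum>y\<in>Y zs. \<Sum>c\<in>{c \<in> C zs. \<forall>P\<in>c. conj_set G y P = P}. (-1) ^ card c)"
  proof (intro sum.cong refl)
    fix zs y
    have "chains (\<subseteq>) {P\<in>T. \<forall>y\<in>set (y # zs). conj_set G y P = P} = {c \<in> C zs. \<forall>P\<in>c. conj_set G y P = P}"
      unfolding C_def chains_def list.set by blast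
    then show "chain_sum {P\<in>T. \<forall>y\<in>set (y # zs). conj_set G y P = P} =
        (\<Sum>c\<in>{c \<in> C zs. \<forall>P\<in>c. conj_set G y P = P}. (-1) ^ card c)"
      unfolding chain_sum_def by simp
  qed
  also have "\<dots> = (\<Sum>zs\<in>L. \<Sum>c\<in>C zs. (-1) ^ card c * int (card {y \<in> Y zs. \<forall>P\<in>c. conj_set G y P = P}))"
    by (intro sum.cong refl, subst sum.swap_restrict[OF finY finC]) (simp add: mult.commute)
  also have "\<dots> = (\<Sum>(zs, c)\<in>E. (-1) ^ card c * int (card {y \<in> Y zs. \<forall>P\<in>c. conj_set G y P = P}))"
    unfolding E_def by (rule sum.Sigma) (use finL finC in auto)
  also have "\<dots> = (\<Sum>e\<in>E. (-1) ^ card (snd e) * int (card {h \<in> carrier (G\<lparr>carrier := H\<rparr>). act h e = e}))"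
  proof (rule sum.cong[OF refl])
    fix e assume "e \<in> E"
    from stab[OF this]
    show "(case e of (zs, c) \<Rightarrow> (-1) ^ card c * int (card {y \<in> Y zs. \<forall>P\<in>c. conj_set G y P = P})) =
      (-1) ^ card (snd e) * int (card {h \<in> carrier (G\<lparr>carrier := H\<rparr>). act h e = e})"
      by (simp only: case_prod_unfold)
  qed
  finally show ?thesis
    using act.order_dvd_weighted_stabilizers[OF _ finE w_inv] finH by (simp add: order_def)
qed

section \<open>The equivariant Euler class function\<close>

lemma (in group) centralizer_eq_if_generate_eq:
  assumes x: "x \<in> carrier G" and y: "y \<in> carrier G" and eq: "generate G {x} = generate G {y}"
  shows "centralizer G x = centralizer G y"
proof -
  have sub: "centralizer G u \<subseteq> centralizer G w" if u: "u \<in> carrier G" and w: "w \<in> generate G {u}" for u w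
  proof
    fix g assume "g \<in> centralizer G u"
    then have g: "g \<in> carrier G" "g \<otimes> u = u \<otimes> g" by (simp_all add: centralizer_def)
    have "g \<otimes> w = w \<otimes> g"
    proof (rule centralizer_commutes_generate[OF _ g(1) _ w])
      show "g \<otimes> v = v \<otimes> g" if "v \<in> {u}" for v using that g(2) by simp
    qed (use u in simp)
    then show "g \<in> centralizer G w" using g(1) by (simp add: centralizer_def)
  qed
  have "x \<in> generate G {y}" "y \<in> generate G {x}"
    unfolding eq[symmetric] by (rule generate.incl, simp) (unfold eq, rule generate.incl, simp)
  then show ?thesis using sub[OF x] sub[OF y] by blast
qed

lemma (in group) centralizer_conj:
  assumes g: "g \<in> carrier G" and x: "x \<in> carrier G"
  shows "centralizer G (g \<otimes> x \<otimes> inv g) = conj_set G g (centralizer G x)"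
proof -
  have iff: "g \<otimes> h \<otimes> inv g \<in> centralizer G (g \<otimes> x \<otimes> inv g) \<longleftrightarrow> h \<in> centralizer G x" if h: "h \<in> carrier G" for h
  proof -
    have "(g \<otimes> h \<otimes> inv g) \<otimes> (g \<otimes> x \<otimes> inv g) = (g \<otimes> x \<otimes> inv g) \<otimes> (g \<otimes> h \<otimes> inv g) \<longleftrightarrow>
        g \<otimes> (h \<otimes> x) \<otimes> inv g = g \<otimes> (x \<otimes> h) \<otimes> inv g"
      by (simp only: conj_mult[OF g h x] conj_mult[OF g x h])
    also have "\<dots> \<longleftrightarrow> h \<otimes> x = x \<otimes> h"
      using inj_onD[OF inj_on_conj[OF g]] h x by auto
    finally show ?thesis using g h x by (simp add: centralizer_def)
  qed
  have sub: "centralizer G u \<subseteq> carrier G" for u by (auto simp: centralizer_def)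
  have "y \<in> conj_set G g (centralizer G x)" if y: "y \<in> centralizer G (g \<otimes> x \<otimes> inv g)" for y
  proof -
    have yG: "y \<in> carrier G" using y sub by blast
    have "y = g \<otimes> (inv g \<otimes> y \<otimes> g) \<otimes> inv g" using conjugation_is_surj[OF g yG] by simp
    moreover from this y have "inv g \<otimes> y \<otimes> g \<in> centralizer G x"
      using iff[of "inv g \<otimes> y \<otimes> g"] g yG by simp
    ultimately show ?thesis unfolding conj_set_def by (rule image_eqI)
  qed
  moreover have "conj_set G g (centralizer G x) \<subseteq> centralizer G (g \<otimes> x \<otimes> inv g)"
    unfolding conj_set_def using iff sub by blast
  ultimately show ?thesis by blast
qed

context finite_group_prime
begin

definition centralizer_sum :: "nat \<Rightarrow> 'a \<Rightarrow> int" where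
  "centralizer_sum s x = (\<Sum>xs\<in>{xs \<in> commuting_tuples s G. set xs \<subseteq> centralizer G x}.
     reduced_euler_char (fixed_p_subgroups (insert x (set xs))))"

text \<open>The rational value of \<^const>\<open>equiv_reduced_euler_class\<close>, which takes values in the complex numbers.\<close>

definition euler_class :: "nat \<Rightarrow> 'a \<Rightarrow> rat" where
  "euler_class r x = of_int (centralizer_sum (r - 1) x) / of_nat (card (centralizer G x))"

lemma equiv_reduced_euler_class_eq:
  "equiv_reduced_euler_class r (nontrivial_p_subgroups G p) (conj_action G) G x = of_rat (euler_class r x)"
proof -
  have "centralizer G x \<subseteq> carrier G" by (auto simp: centralizer_def)
  moreover have "fixed_points (fixed_p_subgroups {x}) (conj_action G) Y = fixed_p_subgroups (insert x Y)" for Y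
    using fixed_points_fixed_points[of "nontrivial_p_subgroups G p" "conj_action G" "{x}" Y]
    by (simp add: fixed_points_eq)
  ultimately show ?thesis
    by (simp add: equiv_reduced_euler_class_def equiv_reduced_euler_char_def
      fixed_points_eq commuting_tuples_subgroup euler_class_def centralizer_sum_def order_def)
qed

lemma centralizer_finite: "finite (centralizer G x)"
  using fin by (simp add: centralizer_def)

lemma euler_class_p_singular:
  assumes x: "x \<in> carrier G" and dvd: "p dvd ord x"
  shows "euler_class r x = 0"
proof -
  have "reduced_euler_char (fixed_p_subgroups (insert x (set xs))) = 0"
    if xs: "xs \<in> commuting_tuples s G" "set xs \<subseteq> centralizer G x" for xs s
  proof (rule reduced_euler_char_fixed_p_singular)
    note D = commuting_tupleD[OF xs(1)]
    show sub: "insert x (set xs) \<subseteq> carrier G" using x D(1) by simp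
    have comm: "u \<otimes> x = x \<otimes> u" if "u \<in> set xs" for u
      using that xs(2) by (auto simp: centralizer_def)
    show "u \<otimes> v = v \<otimes> u" if uv: "u \<in> insert x (set xs)" "v \<in> insert x (set xs)" for u v
    proof -
      consider "u = v" | "u = x" "v \<in> set xs" | "v = x" "u \<in> set xs" | "u \<in> set xs" "v \<in> set xs"
        using uv by blast
      then show ?thesis
      proof cases
        case 2
        then show ?thesis using comm[of v] by simp
      next
        case 3
        then show ?thesis using comm[of u] by simp
      next
        case 4
        then show ?thesis by (rule D(2))
      qed simp
    qed
    let ?A = "generate G (insert x (set xs))"
    have A: "subgroup ?A G" by (rule generate_is_subgroup[OF sub])
    interpret A: group "G\<lparr>carrier := ?A\<rparr>" by (rule subgroup_imp_group[OF A])
    have X: "subgroup (generate G {x}) G" by (rule generate_is_subgroup) (use x in simp)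
    have "generate G {x} \<subseteq> ?A" by (rule mono_generate) simp
    from A.lagrange[OF subgroup_incl[OF X A this]]
    have "card (rcosets\<^bsub>G\<lparr>carrier := ?A\<rparr>\<^esub> (generate G {x})) * card (generate G {x}) = card ?A"
      by (simp add: order_def)
    then have "card (generate G {x}) dvd card ?A" by (rule dvdI[OF sym, OF trans[OF mult.commute]])
    with dvd show "p dvd card ?A" unfolding generate_pow_card[OF x] by (rule dvd_trans)
  qed
  then have "centralizer_sum s x = 0" for s
    unfolding centralizer_sum_def by (intro sum.neutral) blast
  then show ?thesis by (simp add: euler_class_def)
qed

lemma euler_class_generate_eq:
  assumes x: "x \<in> carrier G" and y: "y \<in> carrier G" and eq: "generate G {x} = generate G {y}"
  shows "euler_class r x = euler_class r y"
proof -
  have c: "centralizer G x = centralizer G y" by (rule centralizer_eq_if_generate_eq[OF x y eq])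
  have "fixed_p_subgroups {x} = fixed_p_subgroups {y}"
    using fixed_p_subgroups_generate[of "{x}"] fixed_p_subgroups_generate[of "{y}"] x y eq by simp
  then have "fixed_p_subgroups (insert x U) = fixed_p_subgroups (insert y U)" for U
    using fixed_p_subgroups_Un[of "{x}" U] fixed_p_subgroups_Un[of "{y}" U] by simp
  then show ?thesis by (simp only: euler_class_def centralizer_sum_def c)
qed

lemma euler_class_conj:
  assumes g: "g \<in> carrier G" and x: "x \<in> carrier G"
  shows "euler_class r (g \<otimes> x \<otimes> inv g) = euler_class r x"
proof -
  let ?c = "map (\<lambda>x. g \<otimes> x \<otimes> inv g)"
  have C: "centralizer G x \<subseteq> carrier G" by (auto simp: centralizer_def)
  have "centralizer_sum s (g \<otimes> x \<otimes> inv g) = centralizer_sum s x" for s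
    unfolding centralizer_sum_def centralizer_conj[OF g x]
  proof (rule sum.reindex_bij_betw[OF bij_betw_conj_tuples[OF g C], symmetric, THEN trans])
    show "(\<Sum>xs\<in>{xs \<in> commuting_tuples s G. set xs \<subseteq> centralizer G x}.
        reduced_euler_char (fixed_p_subgroups (insert (g \<otimes> x \<otimes> inv g) (set (?c xs))))) =
      (\<Sum>xs\<in>{xs \<in> commuting_tuples s G. set xs \<subseteq> centralizer G x}.
        reduced_euler_char (fixed_p_subgroups (insert x (set xs))))"
    proof (rule sum.cong[OF refl])
      fix xs assume "xs \<in> {xs \<in> commuting_tuples s G. set xs \<subseteq> centralizer G x}"
      then have "insert x (set xs) \<subseteq> carrier G" using C x by auto
      from reduced_euler_char_fixed_conj_set[OF g this]
      show "reduced_euler_char (fixed_p_subgroups (insert (g \<otimes> x \<otimes> inv g) (set (?c xs)))) =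
        reduced_euler_char (fixed_p_subgroups (insert x (set xs)))"
        by (simp add: conj_set_def)
    qed
  qed
  then show ?thesis
    unfolding euler_class_def centralizer_conj[OF g x] card_conj_set[OF g C] by simp
qed

lemma euler_class_integer:
  assumes r: "r \<ge> 2" and x: "x \<in> carrier G"
  shows "euler_class r x \<in> \<int>"
proof -
  let ?H = "centralizer G x" and ?T = "fixed_p_subgroups {x}"
  have H: "subgroup ?H G" by (rule subgroup_centralizer[OF x])
  obtain s where s: "r - 1 = Suc s" using r by (cases "r - 1") auto
  have "int (card ?H) dvd (\<Sum>ys\<in>{ys \<in> commuting_tuples (Suc s) G. set ys \<subseteq> ?H}.
      chain_sum {P\<in>?T. \<forall>y\<in>set ys. conj_set G y P = P})"
  proof (rule order_dvd_sum_fixed_chain_sums[OF fin H finite_fixed_p_subgroups])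
    show "P \<subseteq> carrier G" if "P \<in> ?T" for P using that p_subgroup_subset by (simp add: fixed_p_subgroups_def)
    show "conj_set G h P \<in> ?T" if h: "h \<in> ?H" and P: "P \<in> ?T" for h P
    proof -
      have hG: "h \<in> carrier G" and "h \<otimes> x = x \<otimes> h" using h by (simp_all add: centralizer_def)
      then have "conj_set G h {x} = {x}" using conj_commutes_iff[OF hG x] by (simp add: conj_set_def)
      then show ?thesis using fixed_p_subgroups_conj_set[OF hG, of "{x}"] x P by auto
    qed
  qed
  moreover have "{P\<in>?T. \<forall>y\<in>set ys. conj_set G y P = P} = fixed_p_subgroups (insert x (set ys))" for ys
    unfolding fixed_p_subgroups_def by blast
  ultimately have "int (card ?H) dvd centralizer_sum (Suc s) x"
    unfolding centralizer_sum_def reduced_euler_char_fixed by (simp add: sum_negf)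
  then obtain k where k: "centralizer_sum (Suc s) x = int (card ?H) * k" by (rule dvdE)
  have "card ?H \<noteq> 0" using centralizer_finite subgroup.one_closed[OF H] by auto
  then have "euler_class r x = of_int k" unfolding euler_class_def s k by simp
  then show ?thesis by simp
qed

text \<open>The Artin coefficients for \<open>r = 2\<close> enter the last assertion through this value, because every subgroup
  contains \<open>\<one>\<close>.\<close>

lemma euler_class_2_one:
  assumes "p dvd order G"
  shows "euler_class 2 \<one> = 0"
proof -
  have c: "centralizer G \<one> = carrier G" by (auto simp: centralizer_def)
  have t: "{xs \<in> commuting_tuples 1 G. set xs \<subseteq> carrier G} = (\<lambda>g. [g]) ` carrier G"
    by (auto simp: commuting_tuples_def length_Suc_conv)
  have f: "fixed_p_subgroups {\<one>, g} = {P. p_subgroup P \<and> P \<noteq> {\<one>} \<and> conj_set G g P = P}" for g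
    unfolding fixed_p_subgroups_def using conj_set_one[OF p_subgroup_subset] by blast
  have "centralizer_sum 1 \<one> = - (\<Sum>g\<in>carrier G. chain_sum {P. p_subgroup P \<and> P \<noteq> {\<one>} \<and> conj_set G g P = P})"
    unfolding centralizer_sum_def c t reduced_euler_char_fixed
    by (subst sum.reindex) (simp_all add: inj_on_def f sum_negf)
  then show ?thesis
    using normalizer_chain_sum_nontrivial_p_subgroups[OF assms] by (simp add: euler_class_def)
qed

end

section \<open>Expansions in induced trivial characters of cyclic subgroups\<close>

context conj_closed_family
begin

lemma card_conj_set_eq:
  assumes C: "C \<in> \<H>" and z: "z \<in> carrier G"
  shows "card {y \<in> carrier G. conj_set G y C = conj_set G z C} = card (normalizer G C)"
proof -
  have CG: "C \<subseteq> carrier G" by (rule subgroup.subset[OF subgroups[OF C]])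
  have "bij_betw (\<lambda>n. z \<otimes> n) (normalizer G C) {y \<in> carrier G. conj_set G y C = conj_set G z C}"
    unfolding normalizer_eq[OF CG]
  proof (rule bij_betw_byWitness[where f' = "\<lambda>y. inv z \<otimes> y"])
    show "\<forall>n\<in>{g \<in> carrier G. conj_set G g C = C}. inv z \<otimes> (z \<otimes> n) = n"
      "\<forall>y\<in>{y \<in> carrier G. conj_set G y C = conj_set G z C}. z \<otimes> (inv z \<otimes> y) = y"
      using z by (simp_all add: m_assoc[symmetric])
    show "(\<lambda>n. z \<otimes> n) ` {g \<in> carrier G. conj_set G g C = C} \<subseteq> {y \<in> carrier G. conj_set G y C = conj_set G z C}"
      by (rule image_subsetI) (simp add: conj_set_comp z CG)
    show "(\<lambda>y. inv z \<otimes> y) ` {y \<in> carrier G. conj_set G y C = conj_set G z C} \<subseteq> {g \<in> carrier G. conj_set G g C = C}"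
      by (rule image_subsetI) (simp add: conj_set_comp z CG conj_set_inv(1))
  qed
  from bij_betw_same_card[OF this] show ?thesis by (rule sym)
qed

text \<open>The elements that conjugate \<open>C\<close> to a subgroup containing \<open>x\<close> are counted by the subgroup obtained;
  each conjugate of \<open>C\<close> arises from a coset of the normalizer.\<close>

lemma card_conjugators_into:
  assumes K: "K \<in> conj_classes G \<H>" and C: "C \<in> K" and x: "x \<in> carrier G"
  shows "card {y \<in> carrier G. inv y \<otimes> x \<otimes> y \<in> C} = card (normalizer G C) * card {C' \<in> K. x \<in> C'}"
proof -
  have C': "C \<in> \<H>" "K = orbit G (conj_set G) C"
    using action.orbit_of_member[of K C] K C unfolding classes_eq by blast+
  have CG: "C \<subseteq> carrier G" by (rule subgroup.subset[OF subgroups[OF C'(1)]])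
  have KH: "K \<subseteq> \<H>" using action.orbit_subset[OF C'(1)] C'(2) by simp
  let ?Y = "{y \<in> carrier G. x \<in> conj_set G y C}"
  have "inv y \<otimes> x \<otimes> y \<in> C \<longleftrightarrow> x \<in> conj_set G y C" if y: "y \<in> carrier G" for y
  proof
    assume "inv y \<otimes> x \<otimes> y \<in> C"
    then show "x \<in> conj_set G y C"
      unfolding conj_set_def using conjugation_is_surj[OF y x] by (intro image_eqI[of _ _ "inv y \<otimes> x \<otimes> y"]) simp_all
  next
    assume "x \<in> conj_set G y C"
    then obtain c where c: "c \<in> C" "x = y \<otimes> c \<otimes> inv y" unfolding conj_set_def by blast
    have "c \<in> carrier G" using c(1) CG by blast
    then have "inv y \<otimes> x \<otimes> y = c" unfolding c(2) using y by (simp add: m_assoc) (simp add: m_assoc[symmetric])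
    then show "inv y \<otimes> x \<otimes> y \<in> C" using c(1) by simp
  qed
  then have "{y \<in> carrier G. inv y \<otimes> x \<otimes> y \<in> C} = ?Y" by blast
  then have "card {y \<in> carrier G. inv y \<otimes> x \<otimes> y \<in> C} = (\<Sum>y\<in>?Y. 1)" by simp
  also have "\<dots> = (\<Sum>C'\<in>{C' \<in> K. x \<in> C'}. \<Sum>y\<in>{y \<in> ?Y. conj_set G y C = C'}. 1)"
  proof (rule sum.group[symmetric])
    show "finite {C' \<in> K. x \<in> C'}" using finite_subset[OF KH finite_family] by simp
    show "(\<lambda>y. conj_set G y C) ` ?Y \<subseteq> {C' \<in> K. x \<in> C'}"
      unfolding C'(2) orbit_def by blast
  qed (use finG in simp)
  also have "\<dots> = (\<Sum>C'\<in>{C' \<in> K. x \<in> C'}. card (normalizer G C))"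
  proof (rule sum.cong[OF refl])
    fix D assume D: "D \<in> {C' \<in> K. x \<in> C'}"
    then obtain z where z: "z \<in> carrier G" "D = conj_set G z C" unfolding C'(2) orbit_def by blast
    have "{y \<in> ?Y. conj_set G y C = D} = {y \<in> carrier G. conj_set G y C = conj_set G z C}"
      using D z(2) by blast
    then show "(\<Sum>y\<in>{y \<in> ?Y. conj_set G y C = D}. 1) = card (normalizer G C)"
      using card_conj_set_eq[OF C'(1) z(1)] by simp
  qed
  finally show ?thesis by (simp add: mult.commute)
qed

lemma induced_trivial_character:
  assumes K: "K \<in> conj_classes G \<H>" and C: "C \<in> K" and x: "x \<in> carrier G"
  shows "induced_character G C (\<lambda>_. 1) x / of_nat (card (rcosets\<^bsub>G\<lparr>carrier := normalizer G C\<rparr>\<^esub> C)) =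
    of_nat (card {C' \<in> K. x \<in> C'})"
proof -
  have C': "C \<in> \<H>" using action.orbit_of_member(1)[of K C] K C unfolding classes_eq by blast
  have sC: "subgroup C G" by (rule subgroups[OF C'])
  have CG: "C \<subseteq> carrier G" by (rule subgroup.subset[OF sC])
  let ?N = "normalizer G C"
  have N: "subgroup ?N G" by (rule normalizer_imp_subgroup[OF CG])
  interpret N: group "G\<lparr>carrier := ?N\<rparr>" by (rule subgroup_imp_group[OF N])
  have "C \<subseteq> ?N" unfolding normalizer_eq[OF CG] using conj_set_self[OF sC] CG by blast
  from N.lagrange[OF subgroup_incl[OF sC N this]]
  have "card (rcosets\<^bsub>G\<lparr>carrier := ?N\<rparr>\<^esub> C) * card C = card ?N" by (simp add: order_def)
  then have index: "(of_nat (card (rcosets\<^bsub>G\<lparr>carrier := ?N\<rparr>\<^esub> C)) * of_nat (card C) :: complex) = of_nat (card ?N)"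
    by (metis of_nat_mult)
  have "(of_nat (card ?N) :: complex) \<noteq> 0" using card_normalizer_pos[OF C'] by simp
  then have nz: "(of_nat (card (rcosets\<^bsub>G\<lparr>carrier := ?N\<rparr>\<^esub> C)) :: complex) \<noteq> 0" "(of_nat (card C) :: complex) \<noteq> 0"
    unfolding index[symmetric] mult_eq_0_iff de_Morgan_disj by blast+
  have "induced_character G C (\<lambda>_. 1) x = of_nat (card {y \<in> carrier G. inv y \<otimes> x \<otimes> y \<in> C}) / of_nat (card C)"
    by (simp add: induced_character_def)
  also have "\<dots> = of_nat (card ?N) * of_nat (card {C' \<in> K. x \<in> C'}) / of_nat (card C)"
    unfolding card_conjugators_into[OF K C x] by simp
  finally show ?thesis using nz unfolding index[symmetric] by (simp add: field_simps)
qed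

text \<open>The normalization by the index of \<open>C\<close> in its normalizer makes the term of a class \<open>[C]\<close> at \<open>x\<close> the number
  of conjugates of \<open>C\<close> containing \<open>x\<close>. An expansion is therefore the same as a conjugation-invariant
  solution of the equations whose right-hand sides run over the subgroups containing \<open>x\<close>.\<close>

lemma artin_expansion_iff:
  assumes rep: "\<And>K. K \<in> conj_classes G \<H> \<Longrightarrow> rep K \<in> K"
  shows "artin_expansion G (conj_classes G \<H>) rep (\<lambda>x. of_rat (v x)) a \<longleftrightarrow>
    (\<forall>x\<in>carrier G. v x = (\<Sum>C\<in>{C \<in> \<H>. x \<in> C}. a (orbit G (conj_set G) C)))"
proof -
  have "(\<Sum>K\<in>conj_classes G \<H>. of_rat (a K) / of_nat (card (rcosets\<^bsub>G\<lparr>carrier := normalizer G (rep K)\<rparr>\<^esub> (rep K)))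
      * induced_character G (rep K) (\<lambda>_. 1) x) =
    of_rat (\<Sum>C\<in>{C \<in> \<H>. x \<in> C}. a (orbit G (conj_set G) C))" if x: "x \<in> carrier G" for x
  proof -
    let ?f = "\<lambda>C. if x \<in> C then of_rat (a (orbit G (conj_set G) C)) else 0 :: complex"
    have "of_rat (a K) / of_nat (card (rcosets\<^bsub>G\<lparr>carrier := normalizer G (rep K)\<rparr>\<^esub> (rep K)))
      * induced_character G (rep K) (\<lambda>_. 1) x = (\<Sum>C\<in>K. ?f C)" if K: "K \<in> conj_classes G \<H>" for K
    proof -
      have orb: "orbit G (conj_set G) C = K" if "C \<in> K" for C
        using action.orbit_of_member(2)[of K C] K that unfolding classes_eq by simp
      have "K \<subseteq> \<H>" using action.orbit_of_member(1)[of K] K unfolding classes_eq by blast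
      then have finK: "finite K" by (rule finite_subset[OF _ finite_family])
      have "(\<Sum>C\<in>K. ?f C) = (\<Sum>C\<in>K. if x \<in> C then of_rat (a K) else 0)"
        by (rule sum.cong[OF refl]) (simp only: orb)
      also have "\<dots> = (\<Sum>C\<in>{C \<in> K. x \<in> C}. of_rat (a K))"
        by (rule sum.inter_filter[OF finK, symmetric])
      also have "\<dots> = of_rat (a K) * of_nat (card {C \<in> K. x \<in> C})" by simp
      also have "\<dots> = of_rat (a K) * (induced_character G (rep K) (\<lambda>_. 1) x /
          of_nat (card (rcosets\<^bsub>G\<lparr>carrier := normalizer G (rep K)\<rparr>\<^esub> (rep K))))"
        by (simp only: induced_trivial_character[OF K rep[OF K] x])
      finally show ?thesis by simp
    qed
    then have "(\<Sum>K\<in>conj_classes G \<H>. of_rat (a K) / of_nat (card (rcosets\<^bsub>G\<lparr>carrier := normalizer G (rep K)\<rparr>\<^esub> (rep K)))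
      * induced_character G (rep K) (\<lambda>_. 1) x) = (\<Sum>K\<in>conj_classes G \<H>. \<Sum>C\<in>K. ?f C)"
      by (rule sum.cong[OF refl])
    also have "\<dots> = (\<Sum>C\<in>\<H>. ?f C)"
      using action.sum_by_orbits[OF finite_family, of ?f] unfolding classes_eq by simp
    also have "\<dots> = (\<Sum>C\<in>{C \<in> \<H>. x \<in> C}. of_rat (a (orbit G (conj_set G) C)))"
      by (rule sum.inter_filter[OF finite_family, symmetric])
    finally show ?thesis by (simp add: of_rat_sum)
  qed
  then show ?thesis unfolding artin_expansion_def by (simp add: of_rat_eq_iff)
qed

end

context finite_group_prime
begin

lemma cyclic_subgroup_iff:
  assumes C: "subgroup C G"
  shows "cyclic_group (G\<lparr>carrier := C\<rparr>) \<longleftrightarrow> (\<exists>c\<in>C. C = generate G {c})"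
proof -
  interpret C: group "G\<lparr>carrier := C\<rparr>" by (rule subgroup_imp_group[OF C])
  have "generate G {c} = range (\<lambda>n::int. c [^]\<^bsub>G\<lparr>carrier := C\<rparr>\<^esub> n)" if c: "c \<in> C" for c
  proof -
    have "generate (G\<lparr>carrier := C\<rparr>) {c} = range (\<lambda>n::int. c [^]\<^bsub>G\<lparr>carrier := C\<rparr>\<^esub> n)"
      using C.generate_pow[of c] c by (auto simp: image_def)
    moreover have "generate (G\<lparr>carrier := C\<rparr>) {c} = generate G {c}"
      by (rule generate_consistent[OF _ C]) (use c in simp)
    ultimately show ?thesis by simp
  qed
  then show ?thesis unfolding C.cyclic_group by auto
qed

lemma cyclic_p'_subgroupE:
  assumes "C \<in> cyclic_p'_subgroups G p"
  obtains c where "c \<in> carrier G" "C = generate G {c}" "\<not> p dvd ord c"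
proof -
  have C: "subgroup C G" "cyclic_group (G\<lparr>carrier := C\<rparr>)" "coprime (card C) p"
    using assms by (simp_all add: cyclic_p'_subgroups_def)
  obtain c where c: "c \<in> C" "C = generate G {c}" using C(2) cyclic_subgroup_iff[OF C(1)] by blast
  have "c \<in> carrier G" using c(1) subgroup.subset[OF C(1)] by blast
  moreover have "\<not> p dvd ord c"
    using C(3) generate_pow_card[OF \<open>c \<in> carrier G\<close>] c(2) prime_dvd_iff_not_coprime by simp
  ultimately show thesis using that c(2) by blast
qed

lemma generate_in_cyclic_p'_subgroups:
  assumes c: "c \<in> carrier G" "\<not> p dvd ord c"
  shows "generate G {c} \<in> cyclic_p'_subgroups G p"
proof -
  have sub: "subgroup (generate G {c}) G" by (rule generate_is_subgroup) (use c(1) in simp)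
  have "c \<in> generate G {c}" by (rule generate.incl) simp
  then have "cyclic_group (G\<lparr>carrier := generate G {c}\<rparr>)" using cyclic_subgroup_iff[OF sub] by blast
  moreover have "coprime (card (generate G {c})) p"
    using c(2) generate_pow_card[OF c(1)] prime_dvd_iff_not_coprime by simp
  ultimately show ?thesis using sub by (simp add: cyclic_p'_subgroups_def)
qed

lemma generate_subset_iff: "subgroup C G \<Longrightarrow> generate G {c} \<subseteq> C \<longleftrightarrow> c \<in> C"
  using generate_subgroup_incl[of "{c}" C] generate.incl[of c "{c}" G] by blast

lemma ord_conj:
  assumes g: "g \<in> carrier G" and c: "c \<in> carrier G"
  shows "ord (g \<otimes> c \<otimes> inv g) = ord c"
proof -
  have "generate G {g \<otimes> c \<otimes> inv g} = conj_set G g (generate G {c})"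
    using conj_set_generate[OF g, of "{c}"] c by (simp add: conj_set_def)
  moreover have "generate G {c} \<subseteq> carrier G" by (rule generate_incl) (use c in simp)
  ultimately show ?thesis
    using generate_pow_card[OF c] generate_pow_card[of "g \<otimes> c \<otimes> inv g"] card_conj_set[OF g] g c by simp
qed

lemma cyclic_p'_subgroups_conj_closed: "conj_closed_family G (cyclic_p'_subgroups G p)"
proof (intro conj_closed_family.intro conj_closed_family_axioms.intro)
  show "group G" by (rule is_group)
  show "finite (carrier G)" by (rule fin)
  show "subgroup H G" if "H \<in> cyclic_p'_subgroups G p" for H
    using that by (simp add: cyclic_p'_subgroups_def)
  show "conj_set G g H \<in> cyclic_p'_subgroups G p"
    if g: "g \<in> carrier G" and H: "H \<in> cyclic_p'_subgroups G p" for g H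
  proof -
    obtain c where c: "c \<in> carrier G" "H = generate G {c}" "\<not> p dvd ord c" by (rule cyclic_p'_subgroupE[OF H])
    have "conj_set G g H = generate G {g \<otimes> c \<otimes> inv g}"
      using conj_set_generate[OF g, of "{c}"] c(1,2) by (simp add: conj_set_def)
    then show ?thesis
      using generate_in_cyclic_p'_subgroups[of "g \<otimes> c \<otimes> inv g"] ord_conj[OF g c(1)] g c(1,3) by simp
  qed
qed

sublocale cyc: conj_closed_family G "cyclic_p'_subgroups G p"
  by (rule cyclic_p'_subgroups_conj_closed)

lemma cyclic_p'_subgroups_containing:
  assumes "C \<in> cyclic_p'_subgroups G p" "C = generate G {c}"
  shows "{D \<in> cyclic_p'_subgroups G p. c \<in> D} = {D \<in> cyclic_p'_subgroups G p. C \<subseteq> D}"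
  using generate_subset_iff[OF cyc.subgroups] assms(2) by blast

text \<open>A cyclic subgroup contains \<open>x\<close> exactly when it contains \<open>\<langle>x\<rangle>\<close>, so the equations are sums over upper
  sets in the poset of cyclic subgroups.\<close>

lemma artin_coefficients_in_subgroup:
  assumes A: "0 \<in> A" "\<And>u v. u \<in> A \<Longrightarrow> v \<in> A \<Longrightarrow> u - v \<in> A"
    and sums: "\<And>x. x \<in> carrier G \<Longrightarrow> (\<Sum>C\<in>{C \<in> cyclic_p'_subgroups G p. x \<in> C}. b C) \<in> A"
    and C: "C \<in> cyclic_p'_subgroups G p"
  shows "b C \<in> (A :: rat set)"
proof (rule upper_sums_in_subgroup[OF cyc.finite_family A])
  fix D assume D: "D \<in> cyclic_p'_subgroups G p"
  obtain c where c: "c \<in> carrier G" "D = generate G {c}" by (rule cyclic_p'_subgroupE[OF D])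
  show "(\<Sum>E\<in>{E \<in> cyclic_p'_subgroups G p. D \<subseteq> E}. b E) \<in> A"
    using sums[OF c(1)] cyclic_p'_subgroups_containing[OF D c(2)] by simp
qed (use C in auto)

text \<open>Moebius inversion solves the equation at every \<open>x\<close> of order prime to \<open>p\<close>. At the other \<open>x\<close> the sum is
  empty, which is why the class function has to vanish there.\<close>

lemma artin_coefficients_exist:
  fixes v :: "'a \<Rightarrow> rat"
  assumes gen: "\<And>x y. x \<in> carrier G \<Longrightarrow> y \<in> carrier G \<Longrightarrow> generate G {x} = generate G {y} \<Longrightarrow> v x = v y"
    and conj: "\<And>g x. g \<in> carrier G \<Longrightarrow> x \<in> carrier G \<Longrightarrow> v (g \<otimes> x \<otimes> inv g) = v x"
    and sing: "\<And>x. x \<in> carrier G \<Longrightarrow> p dvd ord x \<Longrightarrow> v x = 0"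
  shows "\<exists>b. (\<forall>x\<in>carrier G. v x = (\<Sum>C\<in>{C \<in> cyclic_p'_subgroups G p. x \<in> C}. b C)) \<and>
    (\<forall>g\<in>carrier G. \<forall>C\<in>cyclic_p'_subgroups G p. b (conj_set G g C) = b C)"
proof -
  let ?T = "cyclic_p'_subgroups G p"
  define \<beta> where "\<beta> C = v (SOME c. c \<in> carrier G \<and> C = generate G {c})" for C
  have \<beta>: "\<beta> (generate G {c}) = v c" if c: "c \<in> carrier G" for c
  proof -
    have "\<exists>d. d \<in> carrier G \<and> generate G {c} = generate G {d}" using c by blast
    note d = someI_ex[OF this]
    show ?thesis unfolding \<beta>_def by (rule gen[OF c conjunct1[OF d] conjunct2[OF d], symmetric])
  qed
  obtain b where b: "\<And>C. C \<in> ?T \<Longrightarrow> (\<Sum>D\<in>{D \<in> ?T. C \<subseteq> D}. b D) = \<beta> C"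
    using upper_sums_solvable[OF cyc.finite_family, of \<beta>] by blast
  have sums: "v x = (\<Sum>C\<in>{C \<in> ?T. x \<in> C}. b C)" if x: "x \<in> carrier G" for x
  proof (cases "p dvd ord x")
    case True
    have "{C \<in> ?T. x \<in> C} = {}"
    proof (intro equals0I)
      fix C assume "C \<in> {C \<in> ?T. x \<in> C}"
      then have C: "C \<in> ?T" "x \<in> C" by simp_all
      have sC: "subgroup C G" by (rule cyc.subgroups[OF C(1)])
      interpret C: group "G\<lparr>carrier := C\<rparr>" by (rule subgroup_imp_group[OF sC])
      have X: "subgroup (generate G {x}) G" by (rule generate_is_subgroup) (use x in simp)
      have "generate G {x} \<subseteq> C" using generate_subset_iff[OF sC] C(2) by simp
      from C.lagrange[OF subgroup_incl[OF X sC this]]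
      have "card (rcosets\<^bsub>G\<lparr>carrier := C\<rparr>\<^esub> (generate G {x})) * card (generate G {x}) = card C"
        by (simp add: order_def)
      then have "card (generate G {x}) dvd card C" by (rule dvdI[OF sym, OF trans[OF mult.commute]])
      with True have "p dvd card C" unfolding generate_pow_card[OF x] by (rule dvd_trans)
      then show False using C(1) prime_dvd_iff_not_coprime by (simp add: cyclic_p'_subgroups_def)
    qed
    then show ?thesis using sing[OF x True] by (simp only: sum.empty)
  next
    case False
    have C: "generate G {x} \<in> ?T" by (rule generate_in_cyclic_p'_subgroups[OF x False])
    show ?thesis
      using b[OF C] \<beta>[OF x] cyclic_p'_subgroups_containing[OF C refl] by simp
  qed
  \<comment> \<open>Conjugating a solution by \<open>g\<close> gives another one, as the class function is invariant; now use uniqueness.\<close>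
  have "b (conj_set G g C) = b C" if g: "g \<in> carrier G" and C: "C \<in> ?T" for g C
  proof -
    have "b (conj_set G g C) - b C \<in> {0}"
    proof (rule artin_coefficients_in_subgroup[where b = "\<lambda>C. b (conj_set G g C) - b C", OF _ _ _ C])
      fix x assume x: "x \<in> carrier G"
      have bij: "bij_betw (conj_set G g) {C \<in> ?T. x \<in> C} {C \<in> ?T. g \<otimes> x \<otimes> inv g \<in> C}"
      proof (rule bij_betw_byWitness[where f' = "conj_set G (inv g)"])
        have sub: "D \<subseteq> carrier G" if "D \<in> ?T" for D by (rule subgroup.subset[OF cyc.subgroups[OF that]])
        show "\<forall>D\<in>{C \<in> ?T. x \<in> C}. conj_set G (inv g) (conj_set G g D) = D"
          "\<forall>D\<in>{C \<in> ?T. g \<otimes> x \<otimes> inv g \<in> C}. conj_set G g (conj_set G (inv g) D) = D"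
          by (simp_all add: conj_set_inv[OF g sub])
        show "conj_set G g ` {C \<in> ?T. x \<in> C} \<subseteq> {C \<in> ?T. g \<otimes> x \<otimes> inv g \<in> C}"
        proof (rule image_subsetI)
          fix D assume "D \<in> {C \<in> ?T. x \<in> C}"
          then show "conj_set G g D \<in> {C \<in> ?T. g \<otimes> x \<otimes> inv g \<in> C}"
            using cyc.conj_closed[OF g, of D] by (simp add: conj_set_def)
        qed
        show "conj_set G (inv g) ` {C \<in> ?T. g \<otimes> x \<otimes> inv g \<in> C} \<subseteq> {C \<in> ?T. x \<in> C}"
        proof (rule image_subsetI)
          fix D assume D: "D \<in> {C \<in> ?T. g \<otimes> x \<otimes> inv g \<in> C}"
          have "inv g \<otimes> (g \<otimes> x \<otimes> inv g) \<otimes> inv (inv g) = x"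
            using conj_conj[OF inv_closed[OF g] g x] g x by simp
          then have "x \<in> conj_set G (inv g) D"
            using D unfolding conj_set_def by (intro image_eqI[of _ _ "g \<otimes> x \<otimes> inv g"]) simp_all
          then show "conj_set G (inv g) D \<in> {C \<in> ?T. x \<in> C}"
            using D cyc.conj_closed[OF inv_closed[OF g], of D] by simp
        qed
      qed
      have "(\<Sum>C\<in>{C \<in> ?T. x \<in> C}. b (conj_set G g C)) = (\<Sum>C\<in>{C \<in> ?T. g \<otimes> x \<otimes> inv g \<in> C}. b C)"
        by (rule sum.reindex_bij_betw[OF bij])
      also have "\<dots> = v (g \<otimes> x \<otimes> inv g)" by (rule sums[symmetric]) (use g x in simp)
      also have "\<dots> = (\<Sum>C\<in>{C \<in> ?T. x \<in> C}. b C)" unfolding conj[OF g x] by (rule sums[OF x])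
      finally show "(\<Sum>C\<in>{C \<in> ?T. x \<in> C}. b (conj_set G g C) - b C) \<in> {0}" by (simp add: sum_subtractf)
    qed auto
    then show ?thesis by simp
  qed
  with sums show ?thesis by blast
qed

lemma artin_expansion_exists_unique:
  fixes v :: "'a \<Rightarrow> rat"
  assumes rep: "\<And>K. K \<in> conj_classes G (cyclic_p'_subgroups G p) \<Longrightarrow> rep K \<in> K"
    and gen: "\<And>x y. x \<in> carrier G \<Longrightarrow> y \<in> carrier G \<Longrightarrow> generate G {x} = generate G {y} \<Longrightarrow> v x = v y"
    and conj: "\<And>g x. g \<in> carrier G \<Longrightarrow> x \<in> carrier G \<Longrightarrow> v (g \<otimes> x \<otimes> inv g) = v x"
    and sing: "\<And>x. x \<in> carrier G \<Longrightarrow> p dvd ord x \<Longrightarrow> v x = 0"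
  shows "\<exists>!a. a \<in> extensional (conj_classes G (cyclic_p'_subgroups G p)) \<and>
    artin_expansion G (conj_classes G (cyclic_p'_subgroups G p)) rep (\<lambda>x. of_rat (v x)) a"
proof -
  let ?T = "cyclic_p'_subgroups G p"
  let ?K = "conj_classes G ?T"
  let ?orb = "orbit G (conj_set G)"
  have K_eq: "?K = ?orb ` ?T" unfolding cyc.classes_eq orbits_def by blast
  obtain b where b: "\<And>x. x \<in> carrier G \<Longrightarrow> v x = (\<Sum>C\<in>{C \<in> ?T. x \<in> C}. b C)"
    "\<And>g C. g \<in> carrier G \<Longrightarrow> C \<in> ?T \<Longrightarrow> b (conj_set G g C) = b C"
    using artin_coefficients_exist[of v, OF gen conj sing] by blast
  show ?thesis
  proof (rule ex1I)
    let ?a = "restrict (\<lambda>K. b (rep K)) ?K"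
    have "?a (?orb C) = b C" if C: "C \<in> ?T" for C
    proof -
      have K: "?orb C \<in> ?K" using C unfolding K_eq by blast
      then have "rep (?orb C) \<in> ?orb C" by (rule rep)
      then obtain g where "g \<in> carrier G" "rep (?orb C) = conj_set G g C" unfolding orbit_def by blast
      then show ?thesis using b(2) C K by simp
    qed
    then have "(\<Sum>C\<in>{C \<in> ?T. x \<in> C}. ?a (?orb C)) = (\<Sum>C\<in>{C \<in> ?T. x \<in> C}. b C)" for x
      by (intro sum.cong refl) blast
    then have "artin_expansion G ?K rep (\<lambda>x. of_rat (v x)) ?a"
      using cyc.artin_expansion_iff[of rep v ?a, OF rep] b(1) by simp
    then show "?a \<in> extensional ?K \<and> artin_expansion G ?K rep (\<lambda>x. of_rat (v x)) ?a" by simp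
  next
    fix a' assume a': "a' \<in> extensional ?K \<and> artin_expansion G ?K rep (\<lambda>x. of_rat (v x)) a'"
    let ?a = "restrict (\<lambda>K. b (rep K)) ?K"
    have a'_sum: "v x = (\<Sum>C\<in>{C \<in> ?T. x \<in> C}. a' (?orb C))" if "x \<in> carrier G" for x
      using a' that cyc.artin_expansion_iff[of rep v a', OF rep] by blast
    show "a' = ?a"
    proof (rule extensionalityI[of _ ?K])
      fix K assume K: "K \<in> ?K"
      have C: "rep K \<in> ?T" "K = ?orb (rep K)"
        using cyc.action.orbit_of_member[of K "rep K"] K rep[OF K] unfolding cyc.classes_eq by blast+
      have "a' (?orb (rep K)) - b (rep K) \<in> {0}"
        by (rule artin_coefficients_in_subgroup[where b = "\<lambda>C. a' (?orb C) - b C", OF _ _ _ C(1)])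
          (simp_all add: sum_subtractf a'_sum[symmetric] b(1)[symmetric])
      then show "a' K = ?a K" using C(2) K by simp
    qed (use a' in auto)
  qed
qed

lemma artin_coefficients_integer:
  assumes rep: "\<And>K. K \<in> conj_classes G (cyclic_p'_subgroups G p) \<Longrightarrow> rep K \<in> K"
    and int: "\<And>x. x \<in> carrier G \<Longrightarrow> v x \<in> \<int>"
    and a: "artin_expansion G (conj_classes G (cyclic_p'_subgroups G p)) rep (\<lambda>x. of_rat (v x)) a"
    and K: "K \<in> conj_classes G (cyclic_p'_subgroups G p)"
  shows "a K \<in> \<int>"
proof -
  let ?T = "cyclic_p'_subgroups G p"
  have a_sum: "v x = (\<Sum>C\<in>{C \<in> ?T. x \<in> C}. a (orbit G (conj_set G) C))" if "x \<in> carrier G" for x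
    using a that cyc.artin_expansion_iff[of rep v a, OF rep] by blast
  have C: "rep K \<in> ?T" "K = orbit G (conj_set G) (rep K)"
    using cyc.action.orbit_of_member[of K "rep K"] K rep[OF K] unfolding cyc.classes_eq by blast+
  have "a (orbit G (conj_set G) (rep K)) \<in> \<int>"
    by (rule artin_coefficients_in_subgroup[where b = "\<lambda>C. a (orbit G (conj_set G) C)", OF _ _ _ C(1)])
      (simp_all add: a_sum[symmetric] int)
  then show ?thesis using C(2) by simp
qed

lemma sum_artin_coefficients_over_normalizers:
  assumes rep: "\<And>K. K \<in> conj_classes G (cyclic_p'_subgroups G p) \<Longrightarrow> rep K \<in> K"
    and a: "artin_expansion G (conj_classes G (cyclic_p'_subgroups G p)) rep (\<lambda>x. of_rat (v x)) a"
  shows "v \<one> = of_nat (order G) *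
    (\<Sum>K\<in>conj_classes G (cyclic_p'_subgroups G p). a K * (1 / of_nat (card (normalizer G (rep K)))))"
proof -
  let ?T = "cyclic_p'_subgroups G p"
  let ?orb = "orbit G (conj_set G)"
  have orb: "?orb C = K" if "K \<in> conj_classes G ?T" "C \<in> K" for C K
    using cyc.action.orbit_of_member(2)[of K C] that unfolding cyc.classes_eq by simp
  have "?orb (conj_set G g C) = ?orb C" if g: "g \<in> carrier G" and C: "C \<in> ?T" for g C
  proof (rule orb)
    show "?orb C \<in> conj_classes G ?T" using C unfolding cyc.classes_eq orbits_def by blast
    show "conj_set G g C \<in> ?orb C" using g unfolding orbit_def by blast
  qed
  then have "(\<Sum>C\<in>?T. a (?orb C)) =
    of_nat (order G) * (\<Sum>K\<in>conj_classes G ?T. a (?orb (rep K)) / of_nat (card (normalizer G (rep K))))"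
    by (intro cyc.sum_over_classes[OF _ rep]) simp_all
  moreover have "{C \<in> ?T. \<one> \<in> C} = ?T" using subgroup.one_closed[OF cyc.subgroups] by blast
  then have "v \<one> = (\<Sum>C\<in>?T. a (?orb C))"
    using a cyc.artin_expansion_iff[of rep v a, OF rep] by simp
  moreover have "(\<Sum>K\<in>conj_classes G ?T. a (?orb (rep K)) / of_nat (card (normalizer G (rep K)))) =
      (\<Sum>K\<in>conj_classes G ?T. a K * (1 / of_nat (card (normalizer G (rep K)))))"
    by (rule sum.cong[OF refl]) (simp add: orb[OF _ rep])
  ultimately show ?thesis by simp
qed

end

theorem corollary3p15:
  fixes G :: "('a, 'm) monoid_scheme"
    and p :: nat
    and rep :: "'a set set \<Rightarrow> 'a set"
  assumes "group G" and "finite (carrier G)" and "prime p"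
    and "\<And>K. K \<in> conj_classes G {H. subgroup H G} \<Longrightarrow> rep K \<in> K"
  defines "S \<equiv> nontrivial_p_subgroups G p"
    and "\<phi> \<equiv> conj_action G"
    and "\<A> \<equiv> abelian_p'_subgroups G p"
    and "\<K> \<equiv> conj_classes G (cyclic_p'_subgroups G p)"
  shows
    "(\<forall>r\<ge>1.
        equiv_reduced_euler_char r S \<phi> G =
          1 / of_nat (order G) *
            (\<Sum>A\<in>\<A>. of_int (reduced_euler_char (fixed_points S \<phi> A)) *
                     of_nat (num_generating_tuples r (G\<lparr>carrier := A\<rparr>))) \<and>
        equiv_reduced_euler_char r S \<phi> G =
          (\<Sum>K\<in>conj_classes G \<A>. of_int (reduced_euler_char (fixed_points S \<phi> (rep K))) *
             (of_nat (num_generating_tuples r (G\<lparr>carrier := rep K\<rparr>)) /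
              of_nat (card (normalizer G (rep K))))))
   \<and> (\<forall>r\<ge>2. \<forall>x\<in>carrier G. p dvd group.ord G x \<longrightarrow> equiv_reduced_euler_class r S \<phi> G x = 0)
   \<and> (\<forall>r\<ge>2.
        (\<exists>!a. a \<in> extensional \<K> \<and>
              artin_expansion G \<K> rep (equiv_reduced_euler_class r S \<phi> G) a) \<and>
        (\<forall>a. artin_expansion G \<K> rep (equiv_reduced_euler_class r S \<phi> G) a \<longrightarrow>
              (\<forall>K\<in>\<K>. a K \<in> \<int>)))
   \<and> (p dvd order G \<longrightarrow>
        (\<forall>a. artin_expansion G \<K> rep (equiv_reduced_euler_class 2 S \<phi> G) a \<longrightarrow>
              (\<Sum>K\<in>\<K>. a K * (1 / of_nat (card (normalizer G (rep K))))) = 0))"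
proof -
  interpret finite_group_prime G p
    using assms(1-3) by (simp add: finite_group_prime_def finite_group_prime_axioms_def)
  have rep: "rep K \<in> K" if "K \<in> conj_classes G \<H>" "\<H> \<subseteq> {H. subgroup H G}" for K \<H>
  proof (rule assms(4))
    show "K \<in> conj_classes G {H. subgroup H G}"
      using that unfolding conj_classes_def orbits_def by blast
  qed
  have rep_A: "rep K \<in> K" if "K \<in> conj_classes G (abelian_p'_subgroups G p)" for K
    using that by (rule rep) (auto simp: abelian_p'_subgroups_def)
  have rep_K: "rep K \<in> K" if "K \<in> conj_classes G (cyclic_p'_subgroups G p)" for K
    using that by (rule rep) (auto simp: cyclic_p'_subgroups_def)
  have cl: "equiv_reduced_euler_class r S \<phi> G = (\<lambda>x. of_rat (euler_class r x))" for r
    unfolding S_def \<phi>_def by (rule ext) (rule equiv_reduced_euler_class_eq)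
  have 1: "equiv_reduced_euler_char r S \<phi> G =
          1 / of_nat (order G) *
            (\<Sum>A\<in>\<A>. of_int (reduced_euler_char (fixed_points S \<phi> A)) *
                     of_nat (num_generating_tuples r (G\<lparr>carrier := A\<rparr>))) \<and>
        equiv_reduced_euler_char r S \<phi> G =
          (\<Sum>K\<in>conj_classes G \<A>. of_int (reduced_euler_char (fixed_points S \<phi> (rep K))) *
             (of_nat (num_generating_tuples r (G\<lparr>carrier := rep K\<rparr>)) /
              of_nat (card (normalizer G (rep K)))))" for r
    unfolding S_def \<phi>_def \<A>_def fixed_points_eq
    by (intro conjI equiv_reduced_euler_char_abelian equiv_reduced_euler_char_abelian_classes rep_A)
  have 2: "equiv_reduced_euler_class r S \<phi> G x = 0" if "x \<in> carrier G" "p dvd ord x" for r x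
    unfolding cl euler_class_p_singular[OF that] by simp
  have 3: "\<exists>!a. a \<in> extensional \<K> \<and> artin_expansion G \<K> rep (equiv_reduced_euler_class r S \<phi> G) a" for r
    unfolding cl \<K>_def
    by (rule artin_expansion_exists_unique[OF rep_K euler_class_generate_eq euler_class_conj euler_class_p_singular])
  have 4: "a K \<in> \<int>"
    if r: "r \<ge> 2" and a: "artin_expansion G \<K> rep (equiv_reduced_euler_class r S \<phi> G) a" and K: "K \<in> \<K>" for r a K
    by (rule artin_coefficients_integer[OF rep_K euler_class_integer[OF r] a[unfolded cl \<K>_def] K[unfolded \<K>_def]])
  have 5: "(\<Sum>K\<in>\<K>. a K * (1 / of_nat (card (normalizer G (rep K))))) = 0"
    if dvd: "p dvd order G" and a: "artin_expansion G \<K> rep (equiv_reduced_euler_class 2 S \<phi> G) a" for a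
  proof -
    have "order G > 0" using fin order_gt_0_iff_finite by blast
    then show ?thesis
      using sum_artin_coefficients_over_normalizers[OF rep_K a[unfolded cl \<K>_def]] euler_class_2_one[OF dvd]
      unfolding \<K>_def by simp
  qed
  show ?thesis
    by (intro conjI allI impI ballI)
      (rule 1[THEN conjunct1] 1[THEN conjunct2] 3 | rule 2 4 5; assumption)+
qed

end
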